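(* Let $\zeta=(P,B,\Delta_P)$ be a quantum principal $\mathcal G$-bundle. Completing $B$ into a $C^\ast$-algebra, the pair $(E^V_{\mathrm R},\langle-,-\rangle_{\mathrm R})$, consisting of the associated right quantum vector bundle $E^V_{\mathrm R}=\mathrm{Mor}(\delta^V,\Delta_P)$ and its canonical Hermitian structure, is a right Hilbert $C^\ast$-module for every finite-dimensional $\mathcal G$-corepresentation $\delta^V$.
   Context: All algebras are associative unital $\ast$-algebras over $\mathbb C$. $\mathcal G$ is a compact matrix quantum group (Woronowicz) with dense $\ast$-Hopf algebra $(H,\Delta,\epsilon,S,\ast)$. A corepresentation is a linear map $\delta^V:V\to V\otimes H$ with $(\mathrm{id}\otimes\epsilon)\delta^V=\mathrm{id}$, $(\mathrm{id}\otimes\Delta)\delta^V=(\delta^V\otimes\mathrm{id})\delta^V$; $\mathrm{Mor}(\delta^V,\delta^W)$ is the set of linear $T:V\to W$ with $(T\otimes \mathrm{id})\delta^V=\delta^W T$. Every finite-dimensional corepresentation is assumed unitary, i.e. $V$ is equipped with an inner product making $\delta^V$ unitary. A quantum principal $\mathcal G$-bundle $\zeta=(P,B,\Delta_P)$ consists of a $\ast$-algebra $P$, a $\ast$-subalgebra $B$, and a $\ast$-algebra morphism $\Delta_P:P\to P\otimes H$ that is a corepresentation, such that $\Delta_P(x)=x\otimes 1$ iff $x\in B$, and $x\otimes y\mapsto (x\otimes 1)\Delta_P(y)$ maps $P\otimes P$ onto $P\otimes H$. Standing assumption: $B$ can be completed to a $C^\ast$-algebra. In this case, for every irreducible finite-dimensional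 $\delta^V$ with orthonormal basis $\{e_i\}_{i=1}^{n_V}$ of $V$ there are $T^{\mathrm L}_1,\dots,T^{\mathrm L}_{d_V}\in\mathrm{Mor}(\delta^V,\Delta_P)$ with $\sum_k T^{\mathrm L}_k(e_i)^\ast T^{\mathrm L}_k(e_j)=\delta_{ij}1$. $E^V_{\mathrm R}$ denotes $\mathrm{Mor}(\delta^V,\Delta_P)$ with the right $B$-module structure $(Tb)(v)=T(v)\,b$; it is a finitely generated projective right $B$-module. Its canonical Hermitian structure is the sesquilinear map (antilinear in the first coordinate) $\langle-,-\rangle_{\mathrm R}:E^V_{\mathrm R}\times E^V_{\mathrm R}\to B$, $\langle T_1,T_2\rangle_{\mathrm R}=\sum_{k=1}^{n_V}T_1(e_k)^\ast T_2(e_k)$, where $\{e_k\}_{k=1}^{n_V}$ is any orthonormal basis of $V$.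
   Formalization: It is assumed, for the given V, that the canonical Hermitian structure takes values in B; this fails in general (e.g. SU_q(2), P=H, B=ℂ, V fundamental), and the pair is then undefined. *)

theory Defs
  imports "HOL-Analysis.Analysis" "HOL-Library.Function_Algebras"
begin

section \<open>Complex vector spaces, *-algebras and C*-algebras\<close>

class complex_vector = ab_group_add +
  fixes scaleC :: "complex \<Rightarrow> 'a \<Rightarrow> 'a"  (infixr \<open>*\<^sub>C\<close> 75)
  assumes scaleC_add_right: "a *\<^sub>C (x + y) = a *\<^sub>C x + a *\<^sub>C y"
    and scaleC_add_left: "(a + b) *\<^sub>C x = a *\<^sub>C x + b *\<^sub>C x"
    and scaleC_scaleC: "a *\<^sub>C b *\<^sub>C x = (a * b) *\<^sub>C x"
    and scaleC_one: "1 *\<^sub>C x = x"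

global_interpretation cvec: vector_space "scaleC :: complex \<Rightarrow> 'a \<Rightarrow> 'a::complex_vector"
  by unfold_locales (simp_all add: scaleC_add_right scaleC_add_left scaleC_scaleC scaleC_one)

global_interpretation cvec: vector_space_pair
    "scaleC :: complex \<Rightarrow> 'a \<Rightarrow> 'a::complex_vector" "scaleC :: complex \<Rightarrow> 'b \<Rightarrow> 'b::complex_vector"
  by unfold_locales

abbreviation clinear :: "('a::complex_vector \<Rightarrow> 'b::complex_vector) \<Rightarrow> bool"
  where "clinear \<equiv> Vector_Spaces.linear scaleC scaleC"

class complex_star_algebra = complex_vector + ring_1 +
  fixes star :: "'a \<Rightarrow> 'a"
  assumes mult_scaleC_left: "(c *\<^sub>C x) * y = c *\<^sub>C (x * y)"
    and mult_scaleC_right: "x * (c *\<^sub>C y) = c *\<^sub>C (x * y)"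
    and star_star: "star (star x) = x"
    and star_add: "star (x + y) = star x + star y"
    and star_scaleC: "star (c *\<^sub>C x) = cnj c *\<^sub>C star x"
    and star_mult: "star (x * y) = star y * star x"

class cstar_algebra = complex_star_algebra + real_normed_algebra + banach +
  assumes scaleR_scaleC: "scaleR r x = complex_of_real r *\<^sub>C x"
    and norm_scaleC: "norm (c *\<^sub>C x) = cmod c * norm x"
    and cstar_identity: "norm (star x * x) = (norm x)\<^sup>2"

instantiation complex :: complex_star_algebra
begin
definition scaleC_complex :: "complex \<Rightarrow> complex \<Rightarrow> complex" where "scaleC_complex = (*)"
definition star_complex :: "complex \<Rightarrow> complex" where "star_complex = cnj"
instance
  by standard (simp_all add: scaleC_complex_def star_complex_def algebra_simps)
end

instantiation "fun" :: (type, complex_vector) complex_vector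
begin
definition scaleC_fun :: "complex \<Rightarrow> ('a \<Rightarrow> 'b) \<Rightarrow> 'a \<Rightarrow> 'b"
  where "scaleC_fun c f = (\<lambda>x. c *\<^sub>C f x)"
instance
  by standard (simp_all add: scaleC_fun_def fun_eq_iff scaleC_add_right scaleC_add_left
      scaleC_scaleC scaleC_one)
end

lemma clinear_iff:
  "clinear f \<longleftrightarrow> (\<forall>x y. f (x + y) = f x + f y) \<and> (\<forall>c x. f (c *\<^sub>C x) = c *\<^sub>C f x)"
  unfolding Vector_Spaces.linear_iff
  using cvec.vector_space_axioms[where 'a = 'a] cvec.vector_space_axioms[where 'a = 'b] by blast

lemma clinearI:
  "(\<And>x y. f (x + y) = f x + f y) \<Longrightarrow> (\<And>c x. f (c *\<^sub>C x) = c *\<^sub>C f x) \<Longrightarrow> clinear f"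
  by (simp add: clinear_iff)

lemma clinearD:
  assumes "clinear f"
  shows "f (x + y) = f x + f y" "f (c *\<^sub>C x) = c *\<^sub>C f x" "f 0 = 0"
  using assms by (auto simp: clinear_iff cvec.linear_0[OF assms])

lemma separating_functional:
  fixes x y :: "'a::complex_vector"
  assumes "\<And>\<phi> :: 'a \<Rightarrow> complex. clinear \<phi> \<Longrightarrow> \<phi> x = \<phi> y"
  shows "x = y"
proof (rule ccontr)
  assume "x \<noteq> y"
  then have "cvec.independent {x - y}" by simp
  from cvec.linear_independent_extend[OF this, where f = "\<lambda>_. 1::complex"]
  obtain \<phi> :: "'a \<Rightarrow> complex" where "clinear \<phi>" "\<phi> (x - y) = 1" by auto
  with assms[of \<phi>] show False by (simp add: cvec.linear_diff)
qed

lemma cnj_scaleC: "cnj (c *\<^sub>C z) = cnj c *\<^sub>C cnj z"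
  by (simp add: scaleC_complex_def)

definition cbilinear :: "('a::complex_vector \<Rightarrow> 'b::complex_vector \<Rightarrow> 'c::complex_vector) \<Rightarrow> bool"
  where "cbilinear f \<longleftrightarrow> (\<forall>b. clinear (\<lambda>a. f a b)) \<and> (\<forall>a. clinear (f a))"

section \<open>Algebraic tensor products\<close>

text \<open>The algebraic tensor product over the complex numbers, realised as the span of the
  evaluation functionals on the space of bilinear forms. Over a field this is the usual tensor
  product; the universal property is \<open>tensor_lift\<close> below.\<close>

definition bilinear_evaluation ::
    "'a::complex_vector \<Rightarrow> 'b::complex_vector \<Rightarrow> ('a \<Rightarrow> 'b \<Rightarrow> complex) \<Rightarrow> complex"
  where "bilinear_evaluation a b = (\<lambda>\<beta>. if cbilinear \<beta> then \<beta> a b else 0)"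

typedef (overloaded) ('a, 'b) tensor =
    "cvec.span {bilinear_evaluation a b | (a :: 'a::complex_vector) (b :: 'b::complex_vector). True}"
  by (rule exI[of _ 0]) (rule cvec.span_zero)

definition tensor_pure :: "'a::complex_vector \<Rightarrow> 'b::complex_vector \<Rightarrow> ('a, 'b) tensor"
    (infixr \<open>\<otimes>\<^sub>C\<close> 66)
  where "a \<otimes>\<^sub>C b = Abs_tensor (bilinear_evaluation a b)"

instantiation tensor :: (complex_vector, complex_vector) complex_vector
begin
definition zero_tensor where "0 = Abs_tensor 0"
definition plus_tensor where "x + y = Abs_tensor (Rep_tensor x + Rep_tensor y)"
definition minus_tensor where "x - y = Abs_tensor (Rep_tensor x - Rep_tensor y)"
definition uminus_tensor where "- x = Abs_tensor (- Rep_tensor x)"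
definition scaleC_tensor where "c *\<^sub>C x = Abs_tensor (c *\<^sub>C Rep_tensor x)"

lemma Rep_tensor_simps:
  "Rep_tensor (0 :: ('a, 'b) tensor) = 0"
  "Rep_tensor (x + y) = Rep_tensor x + Rep_tensor (y :: ('a, 'b) tensor)"
  "Rep_tensor (x - y) = Rep_tensor x - Rep_tensor (y :: ('a, 'b) tensor)"
  "Rep_tensor (- x) = - Rep_tensor (x :: ('a, 'b) tensor)"
  "Rep_tensor (c *\<^sub>C x) = c *\<^sub>C Rep_tensor (x :: ('a, 'b) tensor)"
  unfolding zero_tensor_def plus_tensor_def minus_tensor_def uminus_tensor_def scaleC_tensor_def
  by (intro Abs_tensor_inverse cvec.span_zero cvec.span_add cvec.span_diff cvec.span_neg
      cvec.span_scale Rep_tensor)+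

instance
  by standard (simp_all add: Rep_tensor_inject[symmetric] Rep_tensor_simps algebra_simps
      scaleC_add_right scaleC_add_left scaleC_scaleC scaleC_one)
end

lemma Rep_tensor_pure: "Rep_tensor (a \<otimes>\<^sub>C b) = bilinear_evaluation a b"
  unfolding tensor_pure_def by (rule Abs_tensor_inverse) (auto intro: cvec.span_base)

lemma tensor_pure_bilinear:
  "(a + a') \<otimes>\<^sub>C b = a \<otimes>\<^sub>C b + a' \<otimes>\<^sub>C b"
  "a \<otimes>\<^sub>C (b + b') = a \<otimes>\<^sub>C b + a \<otimes>\<^sub>C b'"
  "(c *\<^sub>C a) \<otimes>\<^sub>C b = c *\<^sub>C (a \<otimes>\<^sub>C b)"
  "a \<otimes>\<^sub>C (c *\<^sub>C b) = c *\<^sub>C (a \<otimes>\<^sub>C b)"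
  by (auto simp: Rep_tensor_inject[symmetric] Rep_tensor_simps Rep_tensor_pure fun_eq_iff
      bilinear_evaluation_def cbilinear_def clinear_iff scaleC_fun_def)

lemma tensor_induct [case_names pure add]:
  assumes pure: "\<And>a b. P (a \<otimes>\<^sub>C b)"
    and add: "\<And>x y. P x \<Longrightarrow> P y \<Longrightarrow> P (x + y)"
  shows "P (z :: ('a::complex_vector, 'b::complex_vector) tensor)"
proof -
  have "Rep_tensor z \<in> cvec.span {bilinear_evaluation a b | (a::'a) (b::'b). True}"
    by (rule Rep_tensor)
  then have "\<exists>x. Rep_tensor x = Rep_tensor z \<and> P x"
  proof (induction rule: cvec.span_induct_alt)
    case base
    have "P (0 \<otimes>\<^sub>C 0)" by (rule pure)
    then show ?case
      using tensor_pure_bilinear(3)[of 0 0 "0::'b"] by (metis Rep_tensor_simps(1) cvec.scale_zero_left)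
  next
    case (step c x y)
    then obtain a b w where x: "x = bilinear_evaluation a b" and w: "Rep_tensor w = y" "P w" by auto
    have "Rep_tensor ((c *\<^sub>C a) \<otimes>\<^sub>C b + w) = c *\<^sub>C x + y"
      unfolding tensor_pure_bilinear Rep_tensor_simps Rep_tensor_pure x w ..
    moreover have "P ((c *\<^sub>C a) \<otimes>\<^sub>C b + w)" by (intro add pure w)
    ultimately have "\<exists>x'. Rep_tensor x' = c *\<^sub>C x + y \<and> P x'" by blast
    then show ?case by blast
  qed
  then show ?thesis by (auto simp: Rep_tensor_inject)
qed

definition tensor_lift ::
    "('a::complex_vector \<Rightarrow> 'b::complex_vector \<Rightarrow> 'c::complex_vector) \<Rightarrow> ('a, 'b) tensor \<Rightarrow> 'c"
  where "tensor_lift f = (THE F. clinear F \<and> (\<forall>a b. F (a \<otimes>\<^sub>C b) = f a b))"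

lemma tensor_lift_unique:
  assumes "clinear F" "clinear G" "\<And>a b. F (a \<otimes>\<^sub>C b) = G (a \<otimes>\<^sub>C b)"
  shows "F = G"
proof
  fix z show "F z = G z"
    by (induction z rule: tensor_induct) (simp_all add: assms clinearD[OF assms(1)] clinearD[OF assms(2)])
qed

lemma tensor_lift:
  assumes f: "cbilinear f"
  shows "clinear (tensor_lift f)" and "tensor_lift f (a \<otimes>\<^sub>C b) = f a b"
proof -
  have bil: "cbilinear (\<lambda>a b. \<phi> (f a b))" if "clinear \<phi>" for \<phi> :: "'c \<Rightarrow> complex"
    using f that by (simp add: cbilinear_def clinear_iff)
  have "\<exists>w. \<forall>\<phi>. clinear \<phi> \<longrightarrow> \<phi> w = Rep_tensor z (\<lambda>a b. \<phi> (f a b))" for z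
  proof (induction z rule: tensor_induct)
    case (pure a b)
    show ?case
      by (rule exI[of _ "f a b"]) (simp add: Rep_tensor_pure bilinear_evaluation_def bil)
  next
    case (add x y)
    then obtain v w where "\<forall>\<phi>. clinear \<phi> \<longrightarrow> \<phi> v = Rep_tensor x (\<lambda>a b. \<phi> (f a b))"
      "\<forall>\<phi>. clinear \<phi> \<longrightarrow> \<phi> w = Rep_tensor y (\<lambda>a b. \<phi> (f a b))" by blast
    then show ?case
      by (intro exI[of _ "v + w"]) (simp add: Rep_tensor_simps clinearD)
  qed
  then obtain F where F: "\<And>z \<phi>. clinear \<phi> \<Longrightarrow> \<phi> (F z) = Rep_tensor z (\<lambda>a b. \<phi> (f a b))"
    by metis
  have lin: "clinear F"
  proof (rule clinearI; rule separating_functional)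
    fix \<phi> :: "'c \<Rightarrow> complex" and x y c assume \<phi>: "clinear \<phi>"
    show "\<phi> (F (x + y)) = \<phi> (F x + F y)"
      by (simp add: F[OF \<phi>] clinearD[OF \<phi>] Rep_tensor_simps)
    show "\<phi> (F (c *\<^sub>C x)) = \<phi> (c *\<^sub>C F x)"
      by (simp add: F[OF \<phi>] clinearD[OF \<phi>] Rep_tensor_simps scaleC_fun_def)
  qed
  have pure: "F (a \<otimes>\<^sub>C b) = f a b" for a b
    by (rule separating_functional) (simp add: F Rep_tensor_pure bilinear_evaluation_def bil)
  have "tensor_lift f = F"
    unfolding tensor_lift_def
    by (rule the_equality) (auto simp: lin pure intro!: tensor_lift_unique)
  then show "clinear (tensor_lift f)" "tensor_lift f (a \<otimes>\<^sub>C b) = f a b"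
    using lin pure by auto
qed

lemma tensor_lift_add:
  assumes "cbilinear f" "cbilinear g"
  shows "tensor_lift (\<lambda>a b. f a b + g a b) x = tensor_lift f x + tensor_lift g x"
proof -
  have *: "cbilinear (\<lambda>a b. f a b + g a b)"
    using assms by (simp add: cbilinear_def clinear_iff scaleC_add_right)
  show ?thesis
    by (induction x rule: tensor_induct)
      (simp_all add: tensor_lift(2) clinearD(1)[OF tensor_lift(1)] assms *)
qed

lemma tensor_lift_scaleC:
  assumes "cbilinear f"
  shows "tensor_lift (\<lambda>a b. c *\<^sub>C f a b) x = c *\<^sub>C tensor_lift f x"
proof -
  have *: "cbilinear (\<lambda>a b. c *\<^sub>C f a b)"
    using assms by (simp add: cbilinear_def clinear_iff scaleC_add_right scaleC_scaleC mult.commute)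
  show ?thesis
    by (induction x rule: tensor_induct)
      (simp_all add: tensor_lift(2) clinearD(1)[OF tensor_lift(1)] assms * scaleC_add_right)
qed

definition tensor_map ::
    "('a::complex_vector \<Rightarrow> 'c::complex_vector) \<Rightarrow> ('b::complex_vector \<Rightarrow> 'd::complex_vector)
      \<Rightarrow> ('a, 'b) tensor \<Rightarrow> ('c, 'd) tensor"
  where "tensor_map f g = tensor_lift (\<lambda>a b. f a \<otimes>\<^sub>C g b)"

definition tensor_assoc ::
    "(('a::complex_vector, 'b::complex_vector) tensor, 'c::complex_vector) tensor
      \<Rightarrow> ('a, ('b, 'c) tensor) tensor"
  where "tensor_assoc = tensor_lift (\<lambda>x c. tensor_lift (\<lambda>a b. a \<otimes>\<^sub>C (b \<otimes>\<^sub>C c)) x)"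

lemma cbilinear_tensor_pure:
  "clinear f \<Longrightarrow> clinear g \<Longrightarrow> cbilinear (\<lambda>a b. f a \<otimes>\<^sub>C g b)"
  by (simp add: cbilinear_def clinear_iff tensor_pure_bilinear)

lemma tensor_map:
  assumes "clinear f" "clinear g"
  shows "clinear (tensor_map f g)" "tensor_map f g (a \<otimes>\<^sub>C b) = f a \<otimes>\<^sub>C g b"
  unfolding tensor_map_def using tensor_lift[OF cbilinear_tensor_pure[OF assms]] by auto

lemma cbilinear_tensor_lift:
  assumes f: "\<And>y. cbilinear (\<lambda>a b. f a b y)" and g: "\<And>a b. clinear (f a b)"
  shows "cbilinear (\<lambda>x y. tensor_lift (\<lambda>a b. f a b y) x)"
proof -
  have "tensor_lift (\<lambda>a b. f a b (y + y')) x
      = tensor_lift (\<lambda>a b. f a b y) x + tensor_lift (\<lambda>a b. f a b y') x" for x y y'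
    unfolding clinearD(1)[OF g] by (rule tensor_lift_add[OF f f])
  moreover have "tensor_lift (\<lambda>a b. f a b (c *\<^sub>C y)) x = c *\<^sub>C tensor_lift (\<lambda>a b. f a b y) x" for x y c
    unfolding clinearD(2)[OF g] by (rule tensor_lift_scaleC[OF f])
  ultimately show ?thesis
    using tensor_lift(1)[OF f] by (auto simp: cbilinear_def clinear_iff)
qed

lemma tensor_assoc:
  fixes a :: "'a::complex_vector" and b :: "'b::complex_vector" and c :: "'c::complex_vector"
  shows "clinear (tensor_assoc :: (('a, 'b) tensor, 'c) tensor \<Rightarrow> _)"
    and "tensor_assoc ((a \<otimes>\<^sub>C b) \<otimes>\<^sub>C c) = a \<otimes>\<^sub>C (b \<otimes>\<^sub>C c)"
proof -
  have 1: "cbilinear (\<lambda>a b. a \<otimes>\<^sub>C (b \<otimes>\<^sub>C c))" for c :: 'c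
    by (simp add: cbilinear_def clinear_iff tensor_pure_bilinear)
  have 2: "clinear (\<lambda>c. a \<otimes>\<^sub>C (b \<otimes>\<^sub>C c))" for a :: 'a and b :: 'b
    by (simp add: clinear_iff tensor_pure_bilinear)
  have 3: "cbilinear (\<lambda>x (c::'c). tensor_lift (\<lambda>(a::'a) (b::'b). a \<otimes>\<^sub>C (b \<otimes>\<^sub>C c)) x)"
    by (rule cbilinear_tensor_lift) (rule 1 2)+
  show "clinear (tensor_assoc :: (('a, 'b) tensor, 'c) tensor \<Rightarrow> _)"
    unfolding tensor_assoc_def by (rule tensor_lift(1)[OF 3])
  show "tensor_assoc ((a \<otimes>\<^sub>C b) \<otimes>\<^sub>C c) = a \<otimes>\<^sub>C (b \<otimes>\<^sub>C c)"
    unfolding tensor_assoc_def by (simp add: tensor_lift(2)[OF 3] tensor_lift(2)[OF 1])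
qed

text \<open>The \<open>star\<close> below is the antilinear involution with
  \<open>star (a \<otimes>\<^sub>C b) = star a \<otimes>\<^sub>C star b\<close>.\<close>

instantiation tensor :: (complex_star_algebra, complex_star_algebra) complex_star_algebra
begin
definition one_tensor :: "('a, 'b) tensor" where "1 = 1 \<otimes>\<^sub>C 1"
definition times_tensor :: "('a, 'b) tensor \<Rightarrow> ('a, 'b) tensor \<Rightarrow> ('a, 'b) tensor"
  where "x * y = tensor_lift (\<lambda>a b. tensor_lift (\<lambda>c d. (a * c) \<otimes>\<^sub>C (b * d)) y) x"
definition star_tensor :: "('a, 'b) tensor \<Rightarrow> ('a, 'b) tensor"
  where "star x = Abs_tensor (\<lambda>\<beta>. cnj (Rep_tensor x (\<lambda>a b. cnj (\<beta> (star a) (star b)))))"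

lemma times_tensor_bilinear:
  "cbilinear (\<lambda>x y :: ('a, 'b) tensor. x * y)"
  and times_tensor_pure: "(a \<otimes>\<^sub>C b) * (c \<otimes>\<^sub>C d) = (a * c) \<otimes>\<^sub>C (b * d :: 'b)" for a c :: 'a
proof -
  have 1: "cbilinear (\<lambda>c d. (a * c) \<otimes>\<^sub>C (b * d))" for a :: 'a and b :: 'b
    by (simp add: cbilinear_def clinear_iff tensor_pure_bilinear distrib_left mult_scaleC_right)
  have 2: "cbilinear (\<lambda>a b. tensor_lift (\<lambda>c d. (a * c) \<otimes>\<^sub>C (b * d)) y)" for y :: "('a, 'b) tensor"
    unfolding cbilinear_def clinear_iff
    by (simp add: distrib_right mult_scaleC_left tensor_pure_bilinear tensor_lift_add
        tensor_lift_scaleC 1)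
  have 3: "clinear (tensor_lift (\<lambda>c d. (a * c) \<otimes>\<^sub>C (b * d)))" for a :: 'a and b :: 'b
    by (rule tensor_lift(1)[OF 1])
  show "cbilinear (\<lambda>x y :: ('a, 'b) tensor. x * y)"
    unfolding times_tensor_def
    by (rule cbilinear_tensor_lift[where f = "\<lambda>a b y. tensor_lift (\<lambda>c d. (a * c) \<otimes>\<^sub>C (b * d)) y"])
      (rule 2 3)+
  show "(a \<otimes>\<^sub>C b) * (c \<otimes>\<^sub>C d) = (a * c) \<otimes>\<^sub>C (b * d :: 'b)" for a c :: 'a and b d
    unfolding times_tensor_def
    by (rule trans[OF tensor_lift(2)[OF 2] tensor_lift(2)[OF 1]])
qed

lemma times_tensor_simps:
  "(x + x') * y = x * y + x' * (y :: ('a, 'b) tensor)"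
  "x * (y + y') = x * y + x * (y' :: ('a, 'b) tensor)"
  "(k *\<^sub>C x) * y = k *\<^sub>C (x * (y :: ('a, 'b) tensor))"
  "x * (k *\<^sub>C y) = k *\<^sub>C (x * (y :: ('a, 'b) tensor))"
  using times_tensor_bilinear by (simp_all add: cbilinear_def clinear_iff)

lemma Rep_star_tensor:
  "Rep_tensor (star x) = (\<lambda>\<beta>. cnj (Rep_tensor x (\<lambda>a b. cnj (\<beta> (star a) (star b)))))"
  for x :: "('a, 'b) tensor"
proof -
  have bil: "cbilinear (\<lambda>a b. cnj (\<beta> (star a) (star b))) \<longleftrightarrow> cbilinear \<beta>" for \<beta> :: "'a \<Rightarrow> 'b \<Rightarrow> complex"
  proof -
    have *: "cbilinear (\<lambda>a b. cnj (\<beta> (star a) (star b)))" if "cbilinear \<beta>" for \<beta> :: "'a \<Rightarrow> 'b \<Rightarrow> complex"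
      using that by (simp add: cbilinear_def clinear_iff star_add star_scaleC cnj_scaleC)
    show ?thesis using *[of \<beta>] *[of "\<lambda>a b. cnj (\<beta> (star a) (star b))"] by (auto simp: star_star)
  qed
  have "\<exists>y. Rep_tensor y = (\<lambda>\<beta>. cnj (Rep_tensor x (\<lambda>a b. cnj (\<beta> (star a) (star b)))))"
  proof (induction x rule: tensor_induct)
    case (pure a b)
    show ?case
      by (rule exI[of _ "star a \<otimes>\<^sub>C star b"])
        (simp add: Rep_tensor_pure bilinear_evaluation_def bil fun_eq_iff)
  next
    case (add x y)
    then obtain x' y' where "Rep_tensor x' = (\<lambda>\<beta>. cnj (Rep_tensor x (\<lambda>a b. cnj (\<beta> (star a) (star b)))))"
      "Rep_tensor y' = (\<lambda>\<beta>. cnj (Rep_tensor y (\<lambda>a b. cnj (\<beta> (star a) (star b)))))" by blast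
    then show ?case
      by (intro exI[of _ "x' + y'"]) (simp add: Rep_tensor_simps fun_eq_iff)
  qed
  then show ?thesis
    unfolding star_tensor_def by (metis Rep_tensor_inverse)
qed

lemma star_tensor_simps:
  "star (x + y) = star x + star (y :: ('a, 'b) tensor)"
  "star (c *\<^sub>C x) = cnj c *\<^sub>C star (x :: ('a, 'b) tensor)"
  by (simp_all add: Rep_tensor_inject[symmetric] Rep_star_tensor Rep_tensor_simps fun_eq_iff
      scaleC_fun_def scaleC_complex_def)

lemma star_tensor_pure: "star (a \<otimes>\<^sub>C b) = star (a::'a) \<otimes>\<^sub>C star (b::'b)"
proof -
  have *: "cbilinear (\<lambda>a b. cnj (\<beta> (star a) (star b)))" if "cbilinear \<beta>" for \<beta> :: "'a \<Rightarrow> 'b \<Rightarrow> complex"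
    using that by (simp add: cbilinear_def clinear_iff star_add star_scaleC cnj_scaleC)
  have "cbilinear (\<lambda>a b. cnj (\<beta> (star a) (star b))) \<longleftrightarrow> cbilinear \<beta>" for \<beta> :: "'a \<Rightarrow> 'b \<Rightarrow> complex"
    using *[of \<beta>] *[of "\<lambda>a b. cnj (\<beta> (star a) (star b))"] by (auto simp: star_star)
  then show ?thesis
    by (simp add: Rep_tensor_inject[symmetric] Rep_star_tensor Rep_tensor_pure
        bilinear_evaluation_def fun_eq_iff)
qed

instance
proof
  fix x y z :: "('a, 'b) tensor" and c :: complex
  show "x * y * z = x * (y * z)"
  proof (induction x rule: tensor_induct)
    case (pure a b)
    show ?case
    proof (induction y rule: tensor_induct)
      case (pure a' b')
      show ?case
        by (induction z rule: tensor_induct) (simp_all add: times_tensor_pure times_tensor_simps mult.assoc)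
    qed (simp add: times_tensor_simps)
  qed (simp add: times_tensor_simps)
  show "1 * x = x" "x * 1 = x"
    by (induction x rule: tensor_induct)
      (simp_all add: one_tensor_def times_tensor_pure times_tensor_simps)
  show "0 \<noteq> (1 :: ('a, 'b) tensor)"
  proof
    assume 0: "0 = (1 :: ('a, 'b) tensor)"
    have "cvec.independent {1 :: 'a}" "cvec.independent {1 :: 'b}" by simp_all
    then obtain \<phi> :: "'a \<Rightarrow> complex" and \<psi> :: "'b \<Rightarrow> complex"
      where "clinear \<phi>" "\<phi> 1 = 1" "clinear \<psi>" "\<psi> 1 = 1"
      using cvec.linear_independent_extend[of "{1 :: 'a}" "\<lambda>_. 1 :: complex"]
        cvec.linear_independent_extend[of "{1 :: 'b}" "\<lambda>_. 1 :: complex"] by auto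
    then have "cbilinear (\<lambda>a b. \<phi> a * \<psi> b)" "\<phi> 1 * \<psi> 1 = 1"
      by (simp_all add: cbilinear_def clinear_iff mult_scaleC_left mult_scaleC_right algebra_simps)
    then show False
      using tensor_lift[of "\<lambda>a b. \<phi> a * \<psi> b"] 0 clinearD(3) unfolding one_tensor_def
      by (metis zero_neq_one)
  qed
  show "(x + y) * z = x * z + y * z" "x * (y + z) = x * y + x * z"
    "(c *\<^sub>C x) * y = c *\<^sub>C (x * y)" "x * (c *\<^sub>C y) = c *\<^sub>C (x * y)"
    by (simp_all add: times_tensor_simps)
  show "star (star x) = x"
    by (induction x rule: tensor_induct) (simp_all add: star_tensor_pure star_tensor_simps star_star)
  show "star (x + y) = star x + star y" "star (c *\<^sub>C x) = cnj c *\<^sub>C star x"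
    by (simp_all add: star_tensor_simps)
  show "star (x * y) = star y * star x"
  proof (induction x rule: tensor_induct)
    case (pure a b)
    show ?case
      by (induction y rule: tensor_induct)
        (simp_all add: star_tensor_pure star_tensor_simps times_tensor_pure times_tensor_simps star_mult)
  qed (simp add: star_tensor_simps times_tensor_simps)
qed
end

section \<open>Compact matrix quantum groups\<close>

definition star_hom :: "('a::complex_star_algebra \<Rightarrow> 'b::complex_star_algebra) \<Rightarrow> bool"
  where "star_hom f \<longleftrightarrow> clinear f \<and> f 1 = 1 \<and> (\<forall>x y. f (x * y) = f x * f y)
    \<and> (\<forall>x. f (star x) = star (f x))"

definition star_subalgebra :: "'a::complex_star_algebra set \<Rightarrow> bool"
  where "star_subalgebra A \<longleftrightarrow> cvec.subspace A \<and> 1 \<in> A \<and> (\<forall>x\<in>A. \<forall>y\<in>A. x * y \<in> A)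
    \<and> (\<forall>x\<in>A. star x \<in> A)"

text \<open>The identification of \<open>V\<close> with \<open>V \<otimes> \<complex>\<close> is written out as \<open>v \<otimes>\<^sub>C 1\<close>.\<close>

definition hopf_star_algebra ::
    "('h::complex_star_algebra \<Rightarrow> ('h, 'h) tensor) \<Rightarrow> ('h \<Rightarrow> complex) \<Rightarrow> ('h \<Rightarrow> 'h) \<Rightarrow> bool"
  where "hopf_star_algebra \<Delta> \<epsilon> S \<longleftrightarrow> star_hom \<Delta> \<and> star_hom \<epsilon> \<and> clinear S
    \<and> (\<forall>h. tensor_map id \<Delta> (\<Delta> h) = tensor_assoc (tensor_map \<Delta> id (\<Delta> h)))
    \<and> (\<forall>h. tensor_map \<epsilon> id (\<Delta> h) = 1 \<otimes>\<^sub>C h) \<and> (\<forall>h. tensor_map id \<epsilon> (\<Delta> h) = h \<otimes>\<^sub>C 1)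
    \<and> (\<forall>h. tensor_lift (*) (tensor_map S id (\<Delta> h)) = \<epsilon> h *\<^sub>C 1)
    \<and> (\<forall>h. tensor_lift (*) (tensor_map id S (\<Delta> h)) = \<epsilon> h *\<^sub>C 1)"

definition corepresentation ::
    "('h::complex_star_algebra \<Rightarrow> ('h, 'h) tensor) \<Rightarrow> ('h \<Rightarrow> complex)
      \<Rightarrow> ('v::complex_vector \<Rightarrow> ('v, 'h) tensor) \<Rightarrow> bool"
  where "corepresentation \<Delta> \<epsilon> \<delta> \<longleftrightarrow> clinear \<delta> \<and> (\<forall>v. tensor_map id \<epsilon> (\<delta> v) = v \<otimes>\<^sub>C 1)
    \<and> (\<forall>v. tensor_map id \<Delta> (\<delta> v) = tensor_assoc (tensor_map \<delta> id (\<delta> v)))"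

definition Mor ::
    "('v::complex_vector \<Rightarrow> ('v, 'h::complex_star_algebra) tensor)
      \<Rightarrow> ('w::complex_vector \<Rightarrow> ('w, 'h) tensor) \<Rightarrow> ('v \<Rightarrow> 'w) set"
  where "Mor \<delta>V \<delta>W = {T. clinear T \<and> (\<forall>v. tensor_map T id (\<delta>V v) = \<delta>W (T v))}"

text \<open>A corepresentation on \<open>\<complex>\<^sup>n\<close> in coordinates: \<open>e\<^sub>j\<close> is sent to the sum of the
  \<open>e\<^sub>i \<otimes>\<^sub>C u i j\<close>. Matrices are indexed by \<open>{..<n}\<close>; entries outside that range are ignored. This
  form is used wherever one has to quantify over all finite-dimensional corepresentations inside a
  formula.\<close>

definition matrix_corepresentation ::
    "('h::complex_star_algebra \<Rightarrow> ('h, 'h) tensor) \<Rightarrow> ('h \<Rightarrow> complex)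
      \<Rightarrow> nat \<Rightarrow> (nat \<Rightarrow> nat \<Rightarrow> 'h) \<Rightarrow> bool"
  where "matrix_corepresentation \<Delta> \<epsilon> n u \<longleftrightarrow> (\<forall>i<n. \<forall>j<n.
    \<Delta> (u i j) = (\<Sum>k<n. u i k \<otimes>\<^sub>C u k j) \<and> \<epsilon> (u i j) = (if i = j then 1 else 0))"

definition unitary_matrix :: "nat \<Rightarrow> (nat \<Rightarrow> nat \<Rightarrow> 'h::complex_star_algebra) \<Rightarrow> bool"
  where "unitary_matrix n u \<longleftrightarrow> (\<forall>i<n. \<forall>j<n.
    (\<Sum>k<n. star (u k i) * u k j) = (if i = j then 1 else 0)
    \<and> (\<Sum>k<n. u i k * star (u j k)) = (if i = j then 1 else 0))"

text \<open>\<open>\<complex>\<^sup>n\<close> is realised inside \<open>nat \<Rightarrow> complex\<close>.\<close>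

definition coordinate_space :: "nat \<Rightarrow> (nat \<Rightarrow> complex) set"
  where "coordinate_space n = {w. \<forall>i\<ge>n. w i = 0}"

definition matrix_coaction ::
    "nat \<Rightarrow> (nat \<Rightarrow> nat \<Rightarrow> 'h::complex_star_algebra) \<Rightarrow> (nat \<Rightarrow> complex) \<Rightarrow> (nat \<Rightarrow> complex, 'h) tensor"
  where "matrix_coaction n u w =
    (\<Sum>i<n. \<Sum>j<n. (\<lambda>k. if k = i then 1 else 0) \<otimes>\<^sub>C (w j *\<^sub>C u i j))"

definition irreducible_matrix :: "nat \<Rightarrow> (nat \<Rightarrow> nat \<Rightarrow> 'h::complex_star_algebra) \<Rightarrow> bool"
  where "irreducible_matrix n u \<longleftrightarrow> 0 < n \<and> (\<forall>W. cvec.subspace W \<and> W \<subseteq> coordinate_space n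
      \<and> (\<forall>w\<in>W. matrix_coaction n u w \<in> cvec.span {v \<otimes>\<^sub>C h | v h. v \<in> W})
    \<longrightarrow> W = {0} \<or> W = coordinate_space n)"

definition state :: "('a::cstar_algebra \<Rightarrow> complex) \<Rightarrow> bool"
  where "state \<phi> \<longleftrightarrow> clinear \<phi> \<and> \<phi> 1 = 1 \<and> (\<forall>x. 0 \<le> Re (\<phi> (star x * x)) \<and> Im (\<phi> (star x * x)) = 0)"

text \<open>\<open>spatial_norm_le z r\<close> says that the minimal (spatial) C*-norm of \<open>z\<close> is at most \<open>r\<close>: the minimal
  norm is the supremum of the operator norms of \<open>z\<close> in the GNS representations of the product
  states.\<close>

definition product_functional ::
    "('a::complex_vector \<Rightarrow> complex) \<Rightarrow> ('b::complex_vector \<Rightarrow> complex) \<Rightarrow> ('a, 'b) tensor \<Rightarrow> complex"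
  where "product_functional \<phi> \<psi> = tensor_lift (\<lambda>a b. \<phi> a * \<psi> b)"

definition spatial_norm_le :: "('a::cstar_algebra, 'b::cstar_algebra) tensor \<Rightarrow> real \<Rightarrow> bool"
  where "spatial_norm_le z r \<longleftrightarrow> (\<forall>\<phi> \<psi> y. state \<phi> \<and> state \<psi> \<longrightarrow>
    Re (product_functional \<phi> \<psi> (star (z * y) * (z * y)))
      \<le> r\<^sup>2 * Re (product_functional \<phi> \<psi> (star y * y)))"

text \<open>Woronowicz's compact matrix quantum group: \<open>\<iota>\<close> embeds the *-Hopf algebra of the group as a
  dense *-subalgebra of a C*-algebra, it is generated as a *-algebra by the entries of the
  fundamental corepresentation \<open>u\<close> of size \<open>N\<close>, and the last clause says that the comultiplication
  extends to a *-homomorphism from the C*-algebra to its minimal tensor square.\<close>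

definition compact_matrix_quantum_group ::
    "('h::complex_star_algebra \<Rightarrow> ('h, 'h) tensor) \<Rightarrow> ('h \<Rightarrow> complex) \<Rightarrow> ('h \<Rightarrow> 'h)
      \<Rightarrow> ('h \<Rightarrow> 'a::cstar_algebra) \<Rightarrow> nat \<Rightarrow> (nat \<Rightarrow> nat \<Rightarrow> 'h) \<Rightarrow> bool"
  where "compact_matrix_quantum_group \<Delta> \<epsilon> S \<iota> N u \<longleftrightarrow> hopf_star_algebra \<Delta> \<epsilon> S
    \<and> star_hom \<iota> \<and> inj \<iota> \<and> closure (range \<iota>) = UNIV
    \<and> matrix_corepresentation \<Delta> \<epsilon> N u
    \<and> (\<forall>A. star_subalgebra A \<and> (\<forall>i<N. \<forall>j<N. u i j \<in> A) \<longrightarrow> A = UNIV)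
    \<and> (\<forall>h. spatial_norm_le (tensor_map \<iota> \<iota> (\<Delta> h)) (norm (\<iota> h)))"

text \<open>\<open>G i j\<close> plays the role of the inner product of \<open>e\<^sub>i\<close> and \<open>e\<^sub>j\<close>.\<close>

definition corepresentations_unitarizable ::
    "('h::complex_star_algebra \<Rightarrow> ('h, 'h) tensor) \<Rightarrow> ('h \<Rightarrow> complex) \<Rightarrow> bool"
  where "corepresentations_unitarizable \<Delta> \<epsilon> \<longleftrightarrow> (\<forall>n u. matrix_corepresentation \<Delta> \<epsilon> n u \<longrightarrow>
    (\<exists>G :: nat \<Rightarrow> nat \<Rightarrow> complex.
      (\<forall>i<n. \<forall>j<n. G j i = cnj (G i j))
      \<and> (\<forall>c. (\<exists>i<n. c i \<noteq> 0) \<longrightarrow> 0 < Re (\<Sum>i<n. \<Sum>j<n. cnj (c i) * G i j * c j))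
      \<and> (\<forall>i<n. \<forall>j<n. (\<Sum>k<n. \<Sum>l<n. G k l *\<^sub>C (star (u k i) * u l j)) = G i j *\<^sub>C 1)))"

section \<open>Unitary corepresentations\<close>

definition inner_product :: "('v::complex_vector \<Rightarrow> 'v \<Rightarrow> complex) \<Rightarrow> bool"
  where "inner_product ip \<longleftrightarrow> (\<forall>v. clinear (ip v)) \<and> (\<forall>v w. ip w v = cnj (ip v w))
    \<and> (\<forall>v. v \<noteq> 0 \<longrightarrow> 0 < Re (ip v v))"

definition orthonormal_basis ::
    "('v::complex_vector \<Rightarrow> 'v \<Rightarrow> complex) \<Rightarrow> nat \<Rightarrow> (nat \<Rightarrow> 'v) \<Rightarrow> bool"
  where "orthonormal_basis ip n e \<longleftrightarrow> cvec.span (e ` {..<n}) = UNIV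
    \<and> (\<forall>i<n. \<forall>j<n. ip (e i) (e j) = (if i = j then 1 else 0))"

text \<open>The \<open>'h\<close>-valued sesquilinear pairing on \<open>V \<otimes> H\<close> induced by the inner product, see
  \<open>coefficient_pairing_pure\<close>.\<close>

definition coefficient_pairing ::
    "('v::complex_vector \<Rightarrow> 'v \<Rightarrow> complex) \<Rightarrow> ('v, 'h::complex_star_algebra) tensor \<Rightarrow> ('v, 'h) tensor \<Rightarrow> 'h"
  where "coefficient_pairing ip x y =
    tensor_lift (\<lambda>w h. star (tensor_lift (\<lambda>v g. ip w v *\<^sub>C (star h * g)) x)) y"

lemma coefficient_pairing_pure:
  fixes g h :: "'h::complex_star_algebra"
  assumes "inner_product ip"
  shows "coefficient_pairing ip (v \<otimes>\<^sub>C g) (w \<otimes>\<^sub>C h) = ip v w *\<^sub>C (star g * h)"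
proof -
  have lin: "ip x (y + z) = ip x y + ip x z" "ip x (c *\<^sub>C y) = c * ip x y" for x y z c
  proof -
    have "clinear (ip x)" using assms unfolding inner_product_def by blast
    then show "ip x (y + z) = ip x y + ip x z" "ip x (c *\<^sub>C y) = c * ip x y"
      by (simp_all add: clinearD scaleC_complex_def)
  qed
  have sym: "ip y x = cnj (ip x y)" for x y
    using assms unfolding inner_product_def by blast
  have lin': "ip (y + z) x = ip y x + ip z x" for x y z
    unfolding sym[of _ x] lin by (rule complex_cnj_add)
  have scale': "ip (c *\<^sub>C y) x = cnj c * ip y x" for x y c
    unfolding sym[of _ x] lin by (rule complex_cnj_mult)
  have 1: "cbilinear (\<lambda>v (g::'h). ip w v *\<^sub>C (star h * g))" for w and h :: 'h
    unfolding cbilinear_def clinear_iff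
    by (auto simp: lin scaleC_add_left scaleC_add_right distrib_left mult_scaleC_right
        scaleC_scaleC mult.commute)
  have 2: "cbilinear (\<lambda>w (h::'h). star (ip w v *\<^sub>C (star h * g)))" for v and g :: 'h
    unfolding cbilinear_def clinear_iff
    by (auto simp: lin' scale' scaleC_add_left scaleC_add_right distrib_left mult_scaleC_right
        scaleC_scaleC star_add star_mult star_scaleC star_star mult.commute)
  have "coefficient_pairing ip (v \<otimes>\<^sub>C g) (w \<otimes>\<^sub>C h) = star (ip w v *\<^sub>C (star h * g))"
    unfolding coefficient_pairing_def tensor_lift(2)[OF 1] by (rule tensor_lift(2)[OF 2])
  also have "\<dots> = ip v w *\<^sub>C (star g * h)"
    unfolding star_scaleC star_mult star_star sym[of w v] complex_cnj_cnj ..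
  finally show ?thesis .
qed

definition unitary_corepresentation ::
    "('v::complex_vector \<Rightarrow> 'v \<Rightarrow> complex) \<Rightarrow> ('v \<Rightarrow> ('v, 'h::complex_star_algebra) tensor) \<Rightarrow> bool"
  where "unitary_corepresentation ip \<delta> \<longleftrightarrow>
    (\<forall>v w. coefficient_pairing ip (\<delta> v) (\<delta> w) = ip v w *\<^sub>C 1)"

section \<open>Quantum principal bundles\<close>

definition quantum_principal_bundle ::
    "('h::complex_star_algebra \<Rightarrow> ('h, 'h) tensor) \<Rightarrow> ('h \<Rightarrow> complex)
      \<Rightarrow> 'p::complex_star_algebra set \<Rightarrow> ('p \<Rightarrow> ('p, 'h) tensor) \<Rightarrow> bool"
  where "quantum_principal_bundle \<Delta> \<epsilon> B \<Delta>P \<longleftrightarrow> star_subalgebra B \<and> star_hom \<Delta>P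
    \<and> corepresentation \<Delta> \<epsilon> \<Delta>P \<and> (\<forall>x. \<Delta>P x = x \<otimes>\<^sub>C 1 \<longleftrightarrow> x \<in> B)
    \<and> surj (tensor_lift (\<lambda>x y. (x \<otimes>\<^sub>C 1) * \<Delta>P y))"

text \<open>\<open>\<iota>\<close> exhibits the C*-algebra \<open>'c\<close> as a completion of \<open>B\<close>; only its values on \<open>B\<close> matter.\<close>

definition cstar_completion ::
    "'p::complex_star_algebra set \<Rightarrow> ('p \<Rightarrow> 'c::cstar_algebra) \<Rightarrow> bool"
  where "cstar_completion B \<iota> \<longleftrightarrow> \<iota> 1 = 1
    \<and> (\<forall>x\<in>B. \<forall>y\<in>B. \<iota> (x + y) = \<iota> x + \<iota> y \<and> \<iota> (x * y) = \<iota> x * \<iota> y)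
    \<and> (\<forall>x\<in>B. \<iota> (star x) = star (\<iota> x) \<and> (\<forall>c. \<iota> (c *\<^sub>C x) = c *\<^sub>C \<iota> x))
    \<and> inj_on \<iota> B \<and> closure (\<iota> ` B) = UNIV"

text \<open>For every irreducible unitary corepresentation \<open>u\<close> on \<open>\<complex>\<^sup>n\<close> there are morphisms
  \<open>T\<^sub>k\<close> into \<open>\<Delta>P\<close>, given by \<open>T k i = T\<^sub>k(e\<^sub>i)\<close>, such that the sum over \<open>k\<close> of
  \<open>T\<^sub>k(e\<^sub>i)\<^sup>* T\<^sub>k(e\<^sub>j)\<close> is the Kronecker delta.\<close>

definition admits_left_frames ::
    "('h::complex_star_algebra \<Rightarrow> ('h, 'h) tensor) \<Rightarrow> ('h \<Rightarrow> complex)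
      \<Rightarrow> ('p::complex_star_algebra \<Rightarrow> ('p, 'h) tensor) \<Rightarrow> bool"
  where "admits_left_frames \<Delta> \<epsilon> \<Delta>P \<longleftrightarrow> (\<forall>n u.
    matrix_corepresentation \<Delta> \<epsilon> n u \<and> unitary_matrix n u \<and> irreducible_matrix n u \<longrightarrow>
    (\<exists>d (T :: nat \<Rightarrow> nat \<Rightarrow> 'p).
      (\<forall>k<d. \<forall>i<n. \<Delta>P (T k i) = (\<Sum>j<n. T k j \<otimes>\<^sub>C u j i))
      \<and> (\<forall>i<n. \<forall>j<n. (\<Sum>k<d. star (T k i) * T k j) = (if i = j then 1 else 0))))"

definition right_multiplication :: "('v \<Rightarrow> 'p::times) \<Rightarrow> 'p \<Rightarrow> 'v \<Rightarrow> 'p"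
  where "right_multiplication T b = (\<lambda>v. T v * b)"

definition canonical_hermitian_right ::
    "nat \<Rightarrow> (nat \<Rightarrow> 'v) \<Rightarrow> ('v \<Rightarrow> 'p::complex_star_algebra) \<Rightarrow> ('v \<Rightarrow> 'p) \<Rightarrow> 'p"
  where "canonical_hermitian_right n e T\<^sub>1 T\<^sub>2 = (\<Sum>k<n. star (T\<^sub>1 (e k)) * T\<^sub>2 (e k))"

section \<open>Hilbert C*-modules\<close>

definition cstar_positive :: "'c::cstar_algebra \<Rightarrow> bool"
  where "cstar_positive x \<longleftrightarrow> (\<exists>y. x = star y * y)"

text \<open>An inner product module over a *-algebra \<open>B\<close> with C*-completion \<open>\<iota>\<close>; positivity is that of
  the C*-completion.\<close>

definition right_inner_product_module ::
    "'b::complex_star_algebra set \<Rightarrow> ('b \<Rightarrow> 'c::cstar_algebra) \<Rightarrow> 'x::complex_vector set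
      \<Rightarrow> ('x \<Rightarrow> 'b \<Rightarrow> 'x) \<Rightarrow> ('x \<Rightarrow> 'x \<Rightarrow> 'b) \<Rightarrow> bool"
  where "right_inner_product_module B \<iota> E act ip \<longleftrightarrow> cvec.subspace E
    \<and> (\<forall>x\<in>E. \<forall>b\<in>B. act x b \<in> E)
    \<and> (\<forall>x\<in>E. \<forall>y\<in>E. \<forall>b\<in>B. act (x + y) b = act x b + act y b)
    \<and> (\<forall>x\<in>E. \<forall>b\<in>B. \<forall>b'\<in>B. act x (b + b') = act x b + act x b' \<and> act x (b * b') = act (act x b) b')
    \<and> (\<forall>x\<in>E. \<forall>b\<in>B. \<forall>c. act (c *\<^sub>C x) b = c *\<^sub>C act x b \<and> act x (c *\<^sub>C b) = c *\<^sub>C act x b)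
    \<and> (\<forall>x\<in>E. act x 1 = x)
    \<and> (\<forall>x\<in>E. \<forall>y\<in>E. ip x y \<in> B \<and> ip y x = star (ip x y))
    \<and> (\<forall>x\<in>E. \<forall>y\<in>E. \<forall>z\<in>E. ip x (y + z) = ip x y + ip x z)
    \<and> (\<forall>x\<in>E. \<forall>y\<in>E. \<forall>c. ip x (c *\<^sub>C y) = c *\<^sub>C ip x y)
    \<and> (\<forall>x\<in>E. \<forall>y\<in>E. \<forall>b\<in>B. ip x (act y b) = ip x y * b)
    \<and> (\<forall>x\<in>E. cstar_positive (\<iota> (ip x x)))
    \<and> (\<forall>x\<in>E. ip x x = 0 \<longrightarrow> x = 0)"

definition hilbert_norm :: "('x \<Rightarrow> 'x \<Rightarrow> 'c::cstar_algebra) \<Rightarrow> 'x \<Rightarrow> real"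
  where "hilbert_norm ip x = sqrt (norm (ip x x))"

definition right_hilbert_module ::
    "'x::complex_vector set \<Rightarrow> ('x \<Rightarrow> 'c::cstar_algebra \<Rightarrow> 'x) \<Rightarrow> ('x \<Rightarrow> 'x \<Rightarrow> 'c) \<Rightarrow> bool"
  where "right_hilbert_module E act ip \<longleftrightarrow> right_inner_product_module UNIV id E act ip
    \<and> (\<forall>X :: nat \<Rightarrow> 'x. range X \<subseteq> E
        \<and> (\<forall>r>0. \<exists>N. \<forall>m\<ge>N. \<forall>n\<ge>N. hilbert_norm ip (X m - X n) < r)
      \<longrightarrow> (\<exists>x\<in>E. (\<lambda>n. hilbert_norm ip (X n - x)) \<longlonglongrightarrow> 0))"

text \<open>The balanced tensor product of the right \<open>B\<close>-module \<open>E\<close> with the completion \<open>'c\<close> of \<open>B\<close>,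
  i.e. the extension of scalars of \<open>E\<close> along \<open>\<iota>\<close>, realised like \<open>tensor\<close> as the span of the
  evaluation functionals on balanced bilinear forms.\<close>

definition balanced_form ::
    "'b::complex_star_algebra set \<Rightarrow> ('b \<Rightarrow> 'c::cstar_algebra) \<Rightarrow> 'x::complex_vector set
      \<Rightarrow> ('x \<Rightarrow> 'b \<Rightarrow> 'x) \<Rightarrow> ('x \<Rightarrow> 'c \<Rightarrow> complex) \<Rightarrow> bool"
  where "balanced_form B \<iota> E act \<beta> \<longleftrightarrow> (\<forall>x\<in>E. clinear (\<beta> x))
    \<and> (\<forall>x\<in>E. \<forall>y\<in>E. \<forall>c. \<beta> (x + y) c = \<beta> x c + \<beta> y c)
    \<and> (\<forall>x\<in>E. \<forall>z c. \<beta> (z *\<^sub>C x) c = z *\<^sub>C \<beta> x c)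
    \<and> (\<forall>x\<in>E. \<forall>b\<in>B. \<forall>c. \<beta> (act x b) c = \<beta> x (\<iota> b * c))"

definition balanced_pure ::
    "'b::complex_star_algebra set \<Rightarrow> ('b \<Rightarrow> 'c::cstar_algebra) \<Rightarrow> 'x::complex_vector set
      \<Rightarrow> ('x \<Rightarrow> 'b \<Rightarrow> 'x) \<Rightarrow> 'x \<Rightarrow> 'c \<Rightarrow> ('x \<Rightarrow> 'c \<Rightarrow> complex) \<Rightarrow> complex"
  where "balanced_pure B \<iota> E act x c = (\<lambda>\<beta>. if balanced_form B \<iota> E act \<beta> then \<beta> x c else 0)"

definition scalar_extension ::
    "'b::complex_star_algebra set \<Rightarrow> ('b \<Rightarrow> 'c::cstar_algebra) \<Rightarrow> 'x::complex_vector set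
      \<Rightarrow> ('x \<Rightarrow> 'b \<Rightarrow> 'x) \<Rightarrow> (('x \<Rightarrow> 'c \<Rightarrow> complex) \<Rightarrow> complex) set"
  where "scalar_extension B \<iota> E act = cvec.span {balanced_pure B \<iota> E act x c | x c. x \<in> E}"

text \<open>Completing \<open>B\<close> turns \<open>E\<close> into a Hilbert C*-module: \<open>E\<close> is an inner product module over \<open>B\<close>,
  and its scalar extension to the completion, with the induced action and inner product, is a
  (complete) Hilbert C*-module. The two induced operations are determined by their values on the
  generators. As \<open>\<iota> ` B\<close> is dense, \<open>E\<close> embeds isometrically with dense image, so the scalar
  extension is also the completion of \<open>E\<close>; if \<open>B\<close> is already complete it is \<open>E\<close> itself.\<close>

definition right_hilbert_module_by_completion ::
    "'b::complex_star_algebra set \<Rightarrow> ('b \<Rightarrow> 'c::cstar_algebra) \<Rightarrow> 'x::complex_vector set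
      \<Rightarrow> ('x \<Rightarrow> 'b \<Rightarrow> 'x) \<Rightarrow> ('x \<Rightarrow> 'x \<Rightarrow> 'b) \<Rightarrow> bool"
  where "right_hilbert_module_by_completion B \<iota> E act ip \<longleftrightarrow> right_inner_product_module B \<iota> E act ip
    \<and> (\<exists>act' ip'. right_hilbert_module (scalar_extension B \<iota> E act) act' ip'
      \<and> (\<forall>x\<in>E. \<forall>c d. act' (balanced_pure B \<iota> E act x c) d = balanced_pure B \<iota> E act x (c * d))
      \<and> (\<forall>x\<in>E. \<forall>y\<in>E. \<forall>c d. ip' (balanced_pure B \<iota> E act x c) (balanced_pure B \<iota> E act y d)
            = star c * \<iota> (ip x y) * d))"

end

theory Submission
  imports Defs
begin

text \<open>A right frame of \<open>E = Mor \<delta>V \<Delta>P\<close>, i.e. morphisms \<open>Y\<^sub>k\<close> such that the sum over \<open>k\<close> of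
  \<open>Y\<^sub>k(e\<^sub>i) Y\<^sub>k(e\<^sub>j)\<^sup>*\<close> is the Kronecker delta, expands every \<open>T\<close> as the sum of the \<open>Y\<^sub>k b\<^sub>k\<close> with
  \<open>b\<^sub>k = \<langle>Y\<^sub>k, T\<rangle> \<in> B\<close>, so that \<open>\<langle>T, T\<rangle>\<close> is the sum of the \<open>b\<^sub>k\<^sup>* b\<^sub>k\<close>. Positivity and definiteness are
  then the fact that sums of elements \<open>b\<^sup>* b\<close> of a C*-algebra are again of this form and dominate
  their summands. The same frame identifies the scalar extension of \<open>E\<close> with a closed submodule of
  a finite power of the completion of \<open>B\<close>, which is complete.

  Right frames are adjoints of left frames of the conjugate corepresentation, once this is known to
  be unitary. Left frames are given for irreducible unitary corepresentations and extend to all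
  unitary ones by complete reducibility.\<close>

section \<open>Positive elements of C*-algebras\<close>

text \<open>Two obstacles shape the argument. \<open>P\<close> carries no norm, so a single summand
  \<open>star (T (e k)) * T (e k)\<close> has no positivity of its own: only elements of
  \<open>B\<close> can be judged in the completion, and the frame is what rewrites their sum through
  the \<open>b\<^sub>k\<close> in \<open>B\<close>. Moreover, the conjugate of a unitary
  corepresentation is in general unitary only for another inner product. Adjoints of its left frames
  then satisfy the frame relation with the Gram matrix of that inner product in place of the
  identity, and the expansion of T fails. Unitarity of the conjugate is a relation among the
  products \<open>star (u l i) * u m i\<close>, and exactly these products appear when
  \<open>\<Delta>P\<close> is applied to the Hermitian structure; this is how
  \<open>hermitian_into_B\<close> enters.

  Positivity of \<open>star a * a\<close> rests on norm estimates and on a power series square root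
  whose commutation property stands in for functional calculus.\<close>

lemma star_one: "star 1 = (1::'a::complex_star_algebra)"
  by (metis mult.left_neutral star_mult star_star)

lemma star_zero: "star 0 = (0::'a::complex_star_algebra)"
  by (metis add_cancel_right_right star_add)

lemma star_minus: "star (- x) = - star (x::'a::complex_star_algebra)"
  by (metis add_eq_0_iff star_add star_zero)

lemma star_diff: "star (x - y) = star x - star (y::'a::complex_star_algebra)"
  by (metis diff_conv_add_uminus star_add star_minus)

lemma star_sum: "star (sum f A) = (\<Sum>i\<in>A. star (f i :: 'a::complex_star_algebra))"
  by (induction A rule: infinite_finite_induct) (simp_all add: star_zero star_add)

lemma star_power: "star (x ^ n) = star (x::'a::complex_star_algebra) ^ n"
  by (induction n) (simp_all add: star_one star_mult power_commutes)

lemma star_scaleR: "star (r *\<^sub>R x) = r *\<^sub>R star (x::'a::cstar_algebra)"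
  by (simp add: scaleR_scaleC star_scaleC)

lemma norm_star: "norm (star x) = norm (x::'a::cstar_algebra)"
proof -
  have "norm x \<le> norm (star x)" for x :: 'a
  proof (cases "x = 0")
    case False
    have "norm x * norm x \<le> norm (star x) * norm x"
      using norm_mult_ineq[of "star x" x] by (simp add: cstar_identity power2_eq_square)
    then show ?thesis using False by simp
  qed simp
  from this[of x] this[of "star x"] show ?thesis by (simp add: star_star)
qed

text \<open>At 1 the C*-identity reads norm 1 = (norm 1)^2. The instance supplies
  \<open>norm_power_ineq\<close>, on which the power series below rests.\<close>

instance cstar_algebra \<subseteq> real_normed_algebra_1
proof
  show "norm (1::'a) = 1"
    using cstar_identity[of "1::'a"] by (simp add: star_one power2_eq_square)
qed

lemma bounded_linear_star: "bounded_linear (star :: 'a::cstar_algebra \<Rightarrow> 'a)"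
  by (rule bounded_linear_intro[where K = 1]) (simp_all add: star_add star_scaleR norm_star)

lemma norm_self_adjoint_square:
  "star x = x \<Longrightarrow> norm (x * x) = (norm (x::'a::cstar_algebra))\<^sup>2"
  using cstar_identity[of x] by simp

section \<open>The binomial series of sqrt (1 - t), up to the boundary of its disc of
  convergence\<close>

definition sqrt_coeff :: "nat \<Rightarrow> real"
  where "sqrt_coeff n = (1/2 gchoose n) * (-1) ^ n"

text \<open>Consecutive coefficients have the ratio (n + 1/2) / (n + 2), and the coefficient of t is
  -1/2. The factor (-1)^n in \<open>sqrt_coeff\<close> turns the alternating binomial coefficients
  into ones of constant sign after the zeroth.\<close>

lemma sqrt_coeff_nonpos: "sqrt_coeff (Suc n) \<le> 0"
proof (induction n)
  case (Suc n)
  have "(1/2 gchoose Suc (Suc n)) = (1/2 gchoose Suc n) * ((1/2 - real (Suc n)) / real (Suc (Suc n)))"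
    using gbinomial_mult_1[of "1/2::real" "Suc n"] by (simp add: field_simps)
  then have "sqrt_coeff (Suc (Suc n)) = sqrt_coeff (Suc n) * ((real (Suc n) - 1/2) / real (Suc (Suc n)))"
    by (simp only: sqrt_coeff_def power_Suc) (simp add: field_simps)
  then show ?case
    using Suc by (auto intro!: mult_nonpos_nonneg divide_nonneg_nonneg simp del: times_divide_eq_right)
qed (simp add: sqrt_coeff_def)

lemma sqrt_coeff_sums:
  assumes "\<bar>t\<bar> < 1"
  shows "(\<lambda>n. sqrt_coeff n * t ^ n) sums sqrt (1 - t)"
  using gen_binomial_real[of "- t" "1/2"] assms
  by (simp add: sqrt_coeff_def powr_half_sqrt power_minus[of t] mult.assoc)

lemma sqrt_coeff_partial_sum: "(\<Sum>n<m. - sqrt_coeff (Suc n)) \<le> 1"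
proof -
  have le: "(\<Sum>n<m. - sqrt_coeff (Suc n) * t ^ Suc n) \<le> 1" if t: "0 < t" "t < 1" for t :: real
  proof -
    have "(\<lambda>n. sqrt_coeff (Suc n) * t ^ Suc n) sums (sqrt (1 - t) - sqrt_coeff 0 * t ^ 0)"
      using sqrt_coeff_sums[of t] t by (subst sums_Suc_iff) simp
    then have *: "(\<lambda>n. - sqrt_coeff (Suc n) * t ^ Suc n) sums (1 - sqrt (1 - t))"
      using sums_minus by (fastforce simp: sqrt_coeff_def)
    have "(\<Sum>n<m. - sqrt_coeff (Suc n) * t ^ Suc n) \<le> 1 - sqrt (1 - t)"
      using sum_le_suminf[OF sums_summable[OF *], of "{..<m}"] sums_unique[OF *] t
      by (simp add: sqrt_coeff_nonpos mult_nonpos_nonneg)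
    then show ?thesis using t by (smt (verit) real_sqrt_ge_0_iff)
  qed
  have "((\<lambda>t. \<Sum>n<m. - sqrt_coeff (Suc n) * t ^ Suc n) \<longlongrightarrow> (\<Sum>n<m. - sqrt_coeff (Suc n) * 1 ^ Suc n)) (at_left 1)"
    by (intro tendsto_intros)
  moreover have "eventually (\<lambda>t. (\<Sum>n<m. - sqrt_coeff (Suc n) * t ^ Suc n) \<le> 1) (at_left (1::real))"
  proof (rule eventually_mono)
    show "eventually (\<lambda>t. t \<in> {0<..<1}) (at_left (1::real))" by (rule eventually_at_left_real) simp
  qed (rule le, auto)
  ultimately show ?thesis
    using tendsto_upperbound[of _ _ "at_left (1::real)" 1] by simp
qed

lemma sqrt_coeff_Suc_summable: "summable (\<lambda>n. norm (sqrt_coeff (Suc n)))"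
  and sqrt_coeff_Suc_suminf: "(\<Sum>n. norm (sqrt_coeff (Suc n))) \<le> 1"
proof -
  have *: "(\<Sum>n<m. norm (sqrt_coeff (Suc n))) \<le> 1" for m
    using sqrt_coeff_partial_sum[of m] by (simp add: sqrt_coeff_nonpos abs_of_nonpos)
  then show "summable (\<lambda>n. norm (sqrt_coeff (Suc n)))"
    by (intro summableI_nonneg_bounded[where x = 1]) auto
  then show "(\<Sum>n. norm (sqrt_coeff (Suc n))) \<le> 1"
    using * by (rule suminf_le_const)
qed

text \<open>The series evaluated at \<open>x\<close>. The bound on \<open>1 - c\<close> is the norm
  form of positivity of \<open>c\<close>, and the last clause is what later makes several roots
  commute with each other.\<close>

lemma sqrt_one_minus_exists:
  fixes x :: "'a::cstar_algebra"
  assumes x: "star x = x" "norm x \<le> 1"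
  obtains c where "star c = c" "c * c = 1 - x" "norm (1 - c) \<le> 1"
    "\<forall>y. y * x = x * y \<longrightarrow> y * c = c * y"
proof -
  define f where "f n = sqrt_coeff n *\<^sub>R x ^ n" for n
  define c where "c = suminf f"
  have norm_f: "norm (f n) \<le> norm (sqrt_coeff n)" for n
  proof -
    have "norm (x ^ n) \<le> 1"
      using norm_power_ineq[of x n] power_le_one[of "norm x" n] x by simp
    then show ?thesis by (simp add: f_def mult_left_le)
  qed
  have "summable (\<lambda>n. norm (sqrt_coeff n))"
    using sqrt_coeff_Suc_summable by (subst (asm) summable_Suc_iff)
  then have snf: "summable (\<lambda>n. norm (f n))"
    using norm_f by (intro summable_comparison_test[of "\<lambda>n. norm (f n)"]) auto
  then have sf: "summable f" by (rule summable_norm_cancel)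
  show ?thesis
  proof
    have "star (f n) = f n" for n by (simp add: f_def star_scaleR star_power x)
    then show "star c = c"
      unfolding c_def bounded_linear.suminf[OF bounded_linear_star sf] by simp
    \<comment> \<open>Vandermonde with 1/2 + 1/2 = 1: the squared series has the coefficients of 1 -
      t, so only the first two survive.\<close>
    have conv: "(\<Sum>i\<le>k. f i * f (k - i)) = (if k = 0 then 1 else if k = 1 then - x else 0)" for k
    proof -
      have "(\<Sum>i\<le>k. sqrt_coeff i * sqrt_coeff (k - i))
          = (\<Sum>i\<le>k. (1/2 gchoose i) * (1/2 gchoose (k - i)) * (-1) ^ k)"
        by (rule sum.cong) (auto simp: sqrt_coeff_def simp flip: power_add)
      also have "\<dots> = (1 gchoose k) * (-1) ^ k"
        using gbinomial_Vandermonde[of "1/2::real" "1/2" k] by (simp add: atLeast0AtMost flip: sum_distrib_right)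
      also have "\<dots> = (if k = 0 then 1 else if k = 1 then - 1 else 0)"
        using binomial_gbinomial[of 1 k, where 'a = real]
        by (cases "k \<le> 1") (auto simp: binomial_eq_0 le_Suc_eq)
      finally have *: "(\<Sum>i\<le>k. sqrt_coeff i * sqrt_coeff (k - i)) = \<dots>" .
      have "(\<Sum>i\<le>k. f i * f (k - i)) = (\<Sum>i\<le>k. (sqrt_coeff i * sqrt_coeff (k - i)) *\<^sub>R x ^ k)"
        by (rule sum.cong) (auto simp: f_def mult.commute simp flip: power_add)
      also have "\<dots> = (\<Sum>i\<le>k. sqrt_coeff i * sqrt_coeff (k - i)) *\<^sub>R x ^ k"
        by (simp add: scaleR_left.sum)
      finally show ?thesis by (simp add: *)
    qed
    have "c * c = (\<Sum>k. \<Sum>i\<le>k. f i * f (k - i))"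
      unfolding c_def by (rule Cauchy_product[OF snf snf])
    also have "\<dots> = (\<Sum>k\<in>{0,1}. if k = 0 then 1 else if k = (1::nat) then - x else 0)"
      unfolding conv by (rule suminf_finite) auto
    finally show "c * c = 1 - x" by simp
    have c: "c = 1 + (\<Sum>n. f (Suc n))"
      unfolding c_def using suminf_split_head[OF sf] by (simp add: f_def sqrt_coeff_def)
    have "norm (\<Sum>n. f (Suc n)) \<le> (\<Sum>n. norm (sqrt_coeff (Suc n)))"
      by (rule norm_suminf_le[OF norm_f sqrt_coeff_Suc_summable])
    then show "norm (1 - c) \<le> 1"
      unfolding c using sqrt_coeff_Suc_suminf by simp
    have "y * c = c * y" if y: "y * x = x * y" for y
    proof -
      have "y * x ^ n = x ^ n * y" for n
        using power_commuting_commutes[OF y[symmetric]] by simp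
      then show ?thesis
        unfolding c_def suminf_mult[OF sf, symmetric] suminf_mult2[OF sf] by (simp add: f_def)
    qed
    then show "\<forall>y. y * x = x * y \<longrightarrow> y * c = c * y" by blast
  qed
qed

section \<open>Square roots and order estimates through norms\<close>

text \<open>A norm characterisation of positivity, under which closure under sums is the triangle
  inequality.\<close>

definition norm_positive :: "'a::cstar_algebra \<Rightarrow> bool"
  where "norm_positive x \<longleftrightarrow> star x = x \<and> (\<exists>t\<ge>0. norm (t *\<^sub>R 1 - x) \<le> t)"

lemma norm_positive_add:
  assumes "norm_positive x" "norm_positive y"
  shows "norm_positive (x + y)"
proof -
  from assms obtain s t where st: "s \<ge> 0" "norm (s *\<^sub>R 1 - x) \<le> s" "t \<ge> 0" "norm (t *\<^sub>R 1 - y) \<le> t"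
    and star: "star x = x" "star y = y" unfolding norm_positive_def by auto
  have "norm ((s + t) *\<^sub>R 1 - (x + y)) \<le> s + t"
    using norm_triangle_ineq[of "s *\<^sub>R 1 - x" "t *\<^sub>R 1 - y"] st by (simp add: algebra_simps)
  with st star show ?thesis
    unfolding norm_positive_def by (auto simp: star_add intro!: exI[of _ "s + t"])
qed

lemma norm_positive_0: "norm_positive 0"
  by (auto simp: norm_positive_def star_zero)

lemma norm_positive_sum: "(\<And>i. i \<in> A \<Longrightarrow> norm_positive (f i)) \<Longrightarrow> norm_positive (sum f A)"
  by (induction A rule: infinite_finite_induct) (auto simp: norm_positive_0 norm_positive_add)

lemma norm_positive_scaleR:
  assumes "norm_positive x" "r \<ge> 0"
  shows "norm_positive (r *\<^sub>R x)"
proof -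
  from assms obtain t where t: "t \<ge> 0" "norm (t *\<^sub>R 1 - x) \<le> t" "star x = x"
    unfolding norm_positive_def by auto
  have "norm ((r * t) *\<^sub>R 1 - r *\<^sub>R x) = r * norm (t *\<^sub>R 1 - x)"
    using assms(2) by (simp flip: scaleR_scaleR scaleR_diff_right)
  with t assms(2) show ?thesis
    unfolding norm_positive_def by (auto simp: star_scaleR intro!: exI[of _ "r * t"] mult_left_mono)
qed

lemma norm_positive_norm_minus: "star x = x \<Longrightarrow> norm_positive (norm x *\<^sub>R 1 - x)"
  unfolding norm_positive_def
  by (auto simp: star_diff star_scaleR star_one intro!: exI[of _ "norm x"])

text \<open>For t > 0 the element z = 1 - x/t has norm at most 1, and the series root of 1 - z = x/t
  is rescaled by sqrt t; t = 0 forces x = 0.\<close>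

lemma norm_positive_sqrt:
  assumes "norm_positive x"
  obtains c where "norm_positive c" "c * c = x" "\<forall>y. y * x = x * y \<longrightarrow> y * c = c * y"
proof -
  from assms obtain t where t: "t \<ge> 0" "norm (t *\<^sub>R 1 - x) \<le> t" and star: "star x = x"
    unfolding norm_positive_def by auto
  show ?thesis
  proof (cases "t = 0")
    case True
    with t have "x = 0" by simp
    then show ?thesis by (intro that[of 0]) (auto simp: norm_positive_0)
  next
    case False
    define z where "z = 1 - (1 / t) *\<^sub>R x"
    have "norm z = (1 / t) * norm (t *\<^sub>R z)" using False t by simp
    also have "t *\<^sub>R z = t *\<^sub>R 1 - x" using False by (simp add: z_def scaleR_diff_right)
    finally have norm_z: "norm z \<le> 1" using t False by (simp add: divide_le_eq)
    have star_z: "star z = z" by (simp add: z_def star_diff star_one star_scaleR star)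
    obtain d where d: "star d = d" "d * d = 1 - z" "norm (1 - d) \<le> 1"
      "\<forall>y. y * z = z * y \<longrightarrow> y * d = d * y"
      by (rule sqrt_one_minus_exists[OF star_z norm_z]) (rule that)
    show ?thesis
    proof (rule that)
      have "norm_positive d" using d(1,3) unfolding norm_positive_def by (auto intro!: exI[of _ 1])
      then show "norm_positive (sqrt t *\<^sub>R d)" by (rule norm_positive_scaleR) (simp add: t)
      show "(sqrt t *\<^sub>R d) * (sqrt t *\<^sub>R d) = x"
        using t False by (simp add: d(2) z_def)
      have "y * (sqrt t *\<^sub>R d) = (sqrt t *\<^sub>R d) * y" if "y * x = x * y" for y
      proof -
        have "y * z = z * y" using that by (simp add: z_def algebra_simps)
        then have "y * d = d * y" by (rule d(4)[rule_format])
        then show ?thesis by simp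
      qed
      then show "\<forall>y. y * x = x * y \<longrightarrow> y * (sqrt t *\<^sub>R d) = (sqrt t *\<^sub>R d) * y" by blast
    qed
  qed
qed

text \<open>\<open>x + \<i> y\<close> is \<open>s\<close> times a unitary, and \<open>x\<close> is its real part.\<close>

lemma norm_le_of_commuting_squares:
  fixes x y :: "'a::cstar_algebra"
  assumes "star x = x" "star y = y" "x * y = y * x" "x * x + y * y = s\<^sup>2 *\<^sub>R 1" "s \<ge> 0"
  shows "norm x \<le> s"
proof -
  define w where "w = x + \<i> *\<^sub>C y"
  have neg: "(- \<i>) *\<^sub>C z = - (\<i> *\<^sub>C z)" for z :: 'a by (rule cvec.scale_minus_left)
  have star_w: "star w = x - \<i> *\<^sub>C y"
    using assms neg by (simp add: w_def star_add star_scaleC)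
  have "star w * w = x * x + y * y"
    unfolding star_w unfolding w_def
    by (simp add: algebra_simps mult_scaleC_left mult_scaleC_right scaleC_scaleC assms(3))
  then have "(norm w)\<^sup>2 = s\<^sup>2"
    using assms(4) cstar_identity[of w] by simp
  then have w: "norm w = s" using assms(5) by (simp add: power2_eq_iff_nonneg)
  have "2 *\<^sub>R x = w + star w" unfolding star_w by (simp add: w_def scaleR_2)
  then have "2 * norm x \<le> 2 * s"
    using norm_triangle_ineq[of w "star w"] norm_star[of w] w norm_scaleR[of 2 x] by simp
  then show ?thesis by simp
qed

text \<open>The element (norm h)^2 - h^2 is positive by \<open>norm_positive_norm_minus\<close>, so
  it has a root \<open>c\<close>, which commutes with \<open>h\<close>. As c^2 + h^2 is a scalar,
  \<open>c\<close> is no larger than \<open>h\<close> in norm, and this is the estimate needed for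
  h^2.\<close>

lemma norm_positive_square:
  assumes "star h = h"
  shows "norm ((norm h)\<^sup>2 *\<^sub>R 1 - h * h) \<le> (norm h)\<^sup>2" and "norm_positive (h * h)"
proof -
  let ?t = "norm h"
  have pos: "norm_positive (?t\<^sup>2 *\<^sub>R 1 - h * h)"
    using norm_positive_norm_minus[of "h * h"] assms by (simp add: star_mult norm_self_adjoint_square)
  obtain c where c: "norm_positive c" "c * c = ?t\<^sup>2 *\<^sub>R 1 - h * h"
    "\<forall>y. y * (?t\<^sup>2 *\<^sub>R 1 - h * h) = (?t\<^sup>2 *\<^sub>R 1 - h * h) * y \<longrightarrow> y * c = c * y"
    by (rule norm_positive_sqrt[OF pos]) (rule that)
  have star: "star c = c" using c(1) by (simp add: norm_positive_def)
  have comm: "h * c = c * h" by (rule c(3)[rule_format]) (simp add: algebra_simps)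
  have "norm c \<le> ?t"
    by (rule norm_le_of_commuting_squares[of c h]) (simp_all add: star assms comm c(2))
  then show "norm (?t\<^sup>2 *\<^sub>R 1 - h * h) \<le> ?t\<^sup>2"
    unfolding c(2)[symmetric] norm_self_adjoint_square[OF star] by (simp add: power_mono)
  then show "norm_positive (h * h)"
    unfolding norm_positive_def using assms by (auto simp: star_mult intro!: exI[of _ "?t\<^sup>2"])
qed

text \<open>The radius in \<open>norm_positive\<close> may always be taken to be
  \<open>norm x\<close>, because \<open>x\<close> is the square of a self-adjoint element.\<close>

lemma norm_positive_norm:
  assumes "norm_positive x"
  shows "norm (norm x *\<^sub>R 1 - x) \<le> norm x"
proof -
  obtain c where "norm_positive c" "c * c = x" by (rule norm_positive_sqrt[OF assms]) (rule that)
  then show ?thesis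
    using norm_positive_square(1)[of c] norm_self_adjoint_square[of c] by (simp add: norm_positive_def)
qed

text \<open>The root \<open>c\<close> of x commutes with s - x and hence with its root
  \<open>d\<close>. Their squares add up to the scalar s, so
  \<open>norm_le_of_commuting_squares\<close> bounds \<open>c\<close> by sqrt s.\<close>

lemma norm_le_of_norm_positive_diff:
  fixes x :: "'a::cstar_algebra"
  assumes "norm_positive x" "norm_positive (s *\<^sub>R 1 - x)" "s \<ge> 0"
  shows "norm x \<le> s"
proof -
  obtain c where c: "norm_positive c" "c * c = x" "\<forall>y. y * x = x * y \<longrightarrow> y * c = c * y"
    by (rule norm_positive_sqrt[OF assms(1)]) (rule that)
  obtain d where d: "norm_positive d" "d * d = s *\<^sub>R 1 - x"
    "\<forall>y. y * (s *\<^sub>R 1 - x) = (s *\<^sub>R 1 - x) * y \<longrightarrow> y * d = d * y"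
    by (rule norm_positive_sqrt[OF assms(2)]) (rule that)
  have star: "star c = c" "star d = d" using c(1) d(1) by (auto simp: norm_positive_def)
  have "c * x = x * c" unfolding c(2)[symmetric] by (simp add: mult.assoc)
  then have "c * d = d * c" by (intro d(3)[rule_format]) (simp add: algebra_simps)
  then have "norm c \<le> sqrt s"
    using star assms(3) by (intro norm_le_of_commuting_squares[of c d]) (simp_all add: c(2) d(2))
  then have "(norm c)\<^sup>2 \<le> s" using assms(3) real_le_rsqrt real_sqrt_ge_0_iff
    by (metis norm_ge_zero power_mono real_sqrt_pow2)
  then show ?thesis using norm_self_adjoint_square[OF star(1)] c(2) by simp
qed

text \<open>Adding \<open>y\<close> to the positive element norm (x + y) - (x + y) leaves norm (x +
  y) - x, so the preceding order estimate applies.\<close>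

lemma norm_mono_norm_positive:
  fixes x y :: "'a::cstar_algebra"
  assumes "norm_positive x" "norm_positive y"
  shows "norm x \<le> norm (x + y)"
proof (rule norm_le_of_norm_positive_diff)
  have "norm_positive (y + (norm (x + y) *\<^sub>R 1 - (x + y)))"
    using assms norm_positive_add[OF assms]
    by (intro norm_positive_add norm_positive_norm_minus) (auto simp: norm_positive_def)
  then show "norm_positive (norm (x + y) *\<^sub>R 1 - x)" by (simp add: algebra_simps)
qed (use assms in auto)

text \<open>For \<open>t = \<parallel>b\<parallel>\<^sup>2\<close> and \<open>q = - b\<^sup>* b\<close>, compressing \<open>t - b b\<^sup>*\<close>, of norm at most \<open>t\<close>, by \<open>b\<close> gives
  \<open>\<parallel>t q + q\<^sup>2\<parallel> \<le> t\<^sup>2\<close>; but \<open>q\<close> is positive of norm \<open>t\<close>, so the left side is \<open>2 t\<^sup>2\<close>.\<close>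

lemma norm_positive_star_mult_eq_0:
  fixes b :: "'a::cstar_algebra"
  assumes p: "norm_positive (b * star b)" and q: "norm_positive (- (star b * b))"
  shows "b = 0"
proof -
  define p q t where "p = b * star b" and "q = - (star b * b)" and "t = (norm b)\<^sup>2"
  have norms: "norm p = t" "norm q = t" "t \<ge> 0"
    using cstar_identity[of "star b"] cstar_identity[of b]
    by (simp_all add: p_def q_def t_def norm_star star_star)
  have star_q: "star q = q" using q by (simp add: q_def norm_positive_def)
  have "norm (t *\<^sub>R q + q * q) = norm (star b * (t *\<^sub>R 1 - p) * b)"
    unfolding p_def q_def by (subst norm_minus_cancel[symmetric]) (simp add: algebra_simps)
  also have "\<dots> \<le> norm (star b) * norm (t *\<^sub>R 1 - p) * norm b"
    by (meson mult_right_mono norm_ge_zero norm_mult_ineq order_trans)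
  also have "\<dots> \<le> norm (star b) * t * norm b"
    using norm_positive_norm[of p] p norms by (intro mult_right_mono mult_left_mono) (auto simp: p_def)
  also have "\<dots> = t\<^sup>2" by (simp add: norm_star t_def power2_eq_square)
  finally have *: "norm (t *\<^sub>R q + q * q) \<le> t\<^sup>2" .
  \<comment> \<open>Completing the square. The bound just found gives (norm r)^2 \<le> 5/4 t^2,
    while positivity of q pushes norm r up to at least norm q + t/2 = 3/2 t; both hold only for t =
    0.\<close>
  define r where "r = q + (t / 2) *\<^sub>R 1"
  have star_r: "star r = r" by (simp add: r_def star_add star_scaleR star_one star_q)
  have "r * r = (t *\<^sub>R q + q * q) + (t\<^sup>2 / 4) *\<^sub>R 1"
    by (simp add: r_def algebra_simps power2_eq_square scaleR_left_distrib[symmetric])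
  then have "(norm r)\<^sup>2 \<le> norm (t *\<^sub>R q + q * q) + norm ((t\<^sup>2 / 4) *\<^sub>R (1::'a))"
    using norm_self_adjoint_square[OF star_r] by (metis norm_triangle_ineq)
  with * have r_le: "(norm r)\<^sup>2 \<le> t\<^sup>2 + t\<^sup>2 / 4" by simp
  have half: "norm_positive ((t / 2) *\<^sub>R (1::'a))"
    unfolding norm_positive_def using norms(3)
    by (auto simp: star_scaleR star_one intro!: exI[of _ "t / 2"])
  have "norm_positive ((norm r - t / 2) *\<^sub>R 1 - q)"
    using norm_positive_norm_minus[OF star_r] by (simp add: r_def algebra_simps)
  moreover have "norm r - t / 2 \<ge> 0"
    using norm_mono_norm_positive[OF half, of q] q norms(3) by (simp add: r_def q_def add.commute)
  ultimately have "norm q \<le> norm r - t / 2"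
    using norm_le_of_norm_positive_diff[of q] q by (simp add: q_def)
  then have "(3 / 2 * t)\<^sup>2 \<le> (norm r)\<^sup>2" using norms by (intro power_mono) auto
  with r_le have "t\<^sup>2 \<le> 0" by (simp add: power_mult_distrib power2_eq_square)
  then show "b = 0" by (simp add: t_def)
qed

text \<open>The Fukamiya--Kaplansky argument: for the negative part \<open>m\<close> of \<open>a\<^sup>* a\<close> and \<open>b = a m\<close>, the
  element \<open>b\<^sup>* b = - m\<^sup>3\<close> is negative, and hence \<open>b b\<^sup>*\<close> is positive.\<close>

lemma norm_positive_star_mult: "norm_positive (star a * (a::'a::cstar_algebra))"
proof -
  define h where "h = star a * a"
  have star_h: "star h = h" by (simp add: h_def star_mult star_star)
  obtain k where k: "norm_positive k" "k * k = h * h" "\<forall>y. y * (h * h) = (h * h) * y \<longrightarrow> y * k = k * y"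
    by (rule norm_positive_sqrt[OF norm_positive_square(2)[OF star_h]]) (rule that)
  \<comment> \<open>Here \<open>k\<close> plays the role of the absolute value of \<open>h\<close>.
    Its root \<open>l\<close> turns m h m = - m k m into minus the square of the self-adjoint
    \<open>m * l\<close>, which settles the sign without knowing that \<open>m\<close> itself is
    positive.\<close>
  obtain l where l: "norm_positive l" "l * l = k" "\<forall>y. y * k = k * y \<longrightarrow> y * l = l * y"
    by (rule norm_positive_sqrt[OF k(1)]) (rule that)
  have star: "star k = k" "star l = l" using k(1) l(1) by (auto simp: norm_positive_def)
  have hk: "h * k = k * h" by (rule k(3)[rule_format]) (simp add: mult.assoc)
  define m where "m = (1/2) *\<^sub>R (k - h)"
  have star_m: "star m = m" by (simp add: m_def star_scaleR star_diff star star_h)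
  have hm: "h * m = - (k * m)"
    by (simp add: m_def algebra_simps k(2) hk)
  have ml: "m * l = l * m" by (rule l(3)[rule_format]) (simp add: m_def algebra_simps hk)
  have lml: "l * m = m * l" using ml by simp
  define b where "b = a * m"
  have star_bb: "star b * b = - ((m * l) * (m * l))"
  proof -
    have "star b * b = m * (h * m)" by (simp add: b_def h_def star_mult star_m mult.assoc)
    also have "\<dots> = - (m * (l * (l * m)))" by (simp add: hm l(2)[symmetric] mult.assoc)
    finally show ?thesis by (simp add: lml mult.assoc)
  qed
  have star_ml: "star (m * l) = m * l" by (simp add: star_mult star star_m ml)
  have neg: "norm_positive (- (star b * b))"
    unfolding star_bb using norm_positive_square(2)[OF star_ml] by simp
  \<comment> \<open>Up to sign these are twice the real and the imaginary part of \<open>b\<close>.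
    Half the sum of their squares is b b* + b* b, so adding - b* b exhibits b b* as
    positive.\<close>
  have x: "star (b + star b) = b + star b" by (simp add: star_add star_star add.commute)
  have y: "star (\<i> *\<^sub>C (b - star b)) = \<i> *\<^sub>C (b - star b)"
    by (simp add: star_scaleC star_diff star_star cvec.scale_minus_left cvec.scale_right_diff_distrib)
  have "norm_positive ((1/2) *\<^sub>R ((b + star b) * (b + star b)
      + (\<i> *\<^sub>C (b - star b)) * (\<i> *\<^sub>C (b - star b))) + (- (star b * b)))"
    by (intro norm_positive_add norm_positive_scaleR norm_positive_square(2) x y neg) simp
  also have "(1/2) *\<^sub>R ((b + star b) * (b + star b)
      + (\<i> *\<^sub>C (b - star b)) * (\<i> *\<^sub>C (b - star b))) + (- (star b * b)) = b * star b"
  proof -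
    have "(b + star b) * (b + star b) + (\<i> *\<^sub>C (b - star b)) * (\<i> *\<^sub>C (b - star b))
        = 2 *\<^sub>R (b * star b + star b * b)"
      by (simp add: mult_scaleC_left mult_scaleC_right scaleC_scaleC cvec.scale_minus_left scaleC_one
          algebra_simps scaleR_2)
    then show ?thesis by simp
  qed
  finally have "b = 0" using neg by (intro norm_positive_star_mult_eq_0)
  \<comment> \<open>The square of the self-adjoint \<open>m * l\<close> vanishes, so m l = 0 and m k
    = 0. Since h m = - k m, also m^2 = k m = 0, and \<open>h\<close> agrees with the positive
    \<open>k\<close>.\<close>
  then have "(m * l) * (m * l) = 0" using star_bb by (simp add: star_zero)
  then have "m * l = 0" using norm_self_adjoint_square[OF star_ml] by simp
  then have "m * k = 0" by (simp add: l(2)[symmetric] flip: mult.assoc)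
  then have km: "k * m = 0"
    by (metis star_mult star(1) star_m star_zero)
  have "m * m = (1/2) *\<^sub>R (k * m - h * m)"
    by (subst m_def) (simp only: mult_scaleR_left left_diff_distrib)
  then have "m * m = 0" by (simp add: hm km)
  then have "m = 0" using norm_self_adjoint_square[OF star_m] by simp
  then have "k = h" by (simp add: m_def)
  with k(1) show ?thesis by (simp add: h_def)
qed

lemma cstar_positive_iff: "cstar_positive x \<longleftrightarrow> norm_positive x"
proof
  assume x: "norm_positive x"
  obtain c where "norm_positive c" "c * c = x" by (rule norm_positive_sqrt[OF x]) (rule that)
  then show "cstar_positive x" unfolding cstar_positive_def norm_positive_def by metis
qed (auto simp: cstar_positive_def norm_positive_star_mult)

lemma cstar_positive_sum_star_mult: "cstar_positive (\<Sum>i\<in>A. star (f i) * f i)"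
  unfolding cstar_positive_iff by (intro norm_positive_sum norm_positive_star_mult)

text \<open>The remaining summands are positive and cannot lower the norm. This controls each frame
  coordinate by the Hilbert norm, both for definiteness and for completeness.\<close>

lemma norm_le_sum_star_mult:
  fixes f :: "'i \<Rightarrow> 'a::cstar_algebra"
  assumes "finite A" "i \<in> A"
  shows "(norm (f i))\<^sup>2 \<le> norm (\<Sum>i\<in>A. star (f i) * f i)"
proof -
  have "norm (star (f i) * f i) \<le> norm (star (f i) * f i + (\<Sum>i\<in>A - {i}. star (f i) * f i))"
    by (intro norm_mono_norm_positive norm_positive_sum norm_positive_star_mult)
  then show ?thesis using assms by (simp add: cstar_identity sum.remove)
qed

section \<open>Extension of scalars and frames\<close>

lemma balanced_pure_simps:
  assumes "x \<in> E"
  shows "y \<in> E \<Longrightarrow> balanced_pure B \<iota> E act (x + y) c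
      = balanced_pure B \<iota> E act x c + balanced_pure B \<iota> E act y c"
    and "balanced_pure B \<iota> E act (z *\<^sub>C x) c = z *\<^sub>C balanced_pure B \<iota> E act x c"
    and "balanced_pure B \<iota> E act x (c + d)
      = balanced_pure B \<iota> E act x c + balanced_pure B \<iota> E act x d"
    and "balanced_pure B \<iota> E act x (z *\<^sub>C c) = z *\<^sub>C balanced_pure B \<iota> E act x c"
    and "b \<in> B \<Longrightarrow> balanced_pure B \<iota> E act (act x b) c = balanced_pure B \<iota> E act x (\<iota> b * c)"
  using assms by (auto simp: balanced_pure_def balanced_form_def scaleC_fun_def fun_eq_iff clinear_iff)

lemma balanced_pure_zero:
  assumes "x \<in> E"
  shows "balanced_pure B \<iota> E act x 0 = 0"
  using balanced_pure_simps(4)[OF assms, of B \<iota> act 0 0] by simp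

lemma balanced_pure_sum:
  assumes E: "cvec.subspace E" and f: "\<And>k. k \<in> A \<Longrightarrow> f k \<in> E"
  shows "balanced_pure B \<iota> E act (sum f A) c = (\<Sum>k\<in>A. balanced_pure B \<iota> E act (f k) c)"
proof -
  have zero: "balanced_pure B \<iota> E act 0 c = 0"
    using balanced_pure_simps(2)[OF cvec.subspace_0[OF E], of B \<iota> act 0] by simp
  show ?thesis using f
  proof (induction A rule: infinite_finite_induct)
    case (insert a A)
    then have "sum f A \<in> E" by (intro cvec.subspace_sum[OF E]) auto
    with insert show ?case by (simp add: balanced_pure_simps(1))
  qed (simp_all add: zero)
qed

text \<open>A vector of the target is pinned down by its images under linear functionals, and
  \<open>f\<close> followed by a functional is a scalar form on which \<xi> can be evaluated. The
  chosen \<open>w\<close> is thus unique wherever it exists, which for balanced \<open>f\<close> is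
  on all of \<open>scalar_extension\<close>.\<close>

definition scalar_extension_lift ::
    "('x \<Rightarrow> 'c \<Rightarrow> 'd::complex_vector) \<Rightarrow> (('x \<Rightarrow> 'c \<Rightarrow> complex) \<Rightarrow> complex) \<Rightarrow> 'd"
  where "scalar_extension_lift f \<xi> = (SOME w. \<forall>\<phi>. clinear \<phi> \<longrightarrow> \<phi> w = \<xi> (\<lambda>x c. \<phi> (f x c)))"

lemma scalar_extension_pure: "x \<in> E \<Longrightarrow> balanced_pure B \<iota> E act x c \<in> scalar_extension B \<iota> E act"
  unfolding scalar_extension_def by (rule cvec.span_base) auto

lemma subspace_scalar_extension: "cvec.subspace (scalar_extension B \<iota> E act)"
  unfolding scalar_extension_def by (rule cvec.subspace_span)

text \<open>The universal property, with balancedness tested through functionals. Witnesses exist on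
  generators and can be added and scaled, so induction over the span suffices.\<close>

lemma scalar_extension_lift:
  fixes f :: "'x::complex_vector \<Rightarrow> 'c::cstar_algebra \<Rightarrow> 'd::complex_vector"
  assumes bal: "\<And>\<phi>. clinear \<phi> \<Longrightarrow> balanced_form B \<iota> E act (\<lambda>x c. \<phi> (f x c))"
  shows "x \<in> E \<Longrightarrow> scalar_extension_lift f (balanced_pure B \<iota> E act x c) = f x c"
    and "\<xi> \<in> scalar_extension B \<iota> E act \<Longrightarrow> \<eta> \<in> scalar_extension B \<iota> E act \<Longrightarrow>
      scalar_extension_lift f (\<xi> + \<eta>) = scalar_extension_lift f \<xi> + scalar_extension_lift f \<eta>"
    and "\<xi> \<in> scalar_extension B \<iota> E act \<Longrightarrow>
      scalar_extension_lift f (z *\<^sub>C \<xi>) = z *\<^sub>C scalar_extension_lift f \<xi>"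
proof -
  let ?S = "scalar_extension B \<iota> E act" and ?pure = "balanced_pure B \<iota> E act"
  have ex: "\<exists>w. \<forall>\<phi>. clinear \<phi> \<longrightarrow> \<phi> w = \<xi> (\<lambda>x c. \<phi> (f x c))" if "\<xi> \<in> ?S" for \<xi>
    using that unfolding scalar_extension_def
  proof (induction rule: cvec.span_induct_alt)
    case base
    show ?case by (rule exI[of _ 0]) (simp add: clinearD)
  next
    case (step z \<xi> \<eta>)
    then obtain x c w where x: "x \<in> E" "\<xi> = ?pure x c"
      and w: "\<And>\<phi>. clinear \<phi> \<Longrightarrow> \<phi> w = \<eta> (\<lambda>x c. \<phi> (f x c))" by auto
    show ?case
      by (rule exI[of _ "z *\<^sub>C f x c + w"])
        (simp add: clinearD w x bal balanced_pure_def scaleC_fun_def)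
  qed
  have lift: "\<phi> (scalar_extension_lift f \<xi>) = \<xi> (\<lambda>x c. \<phi> (f x c))"
    if "\<xi> \<in> ?S" "clinear \<phi>" for \<xi> \<phi>
    using someI_ex[OF ex[OF that(1)]] that(2) unfolding scalar_extension_lift_def by blast
  note sub = subspace_scalar_extension[of B \<iota> E act]
  show "scalar_extension_lift f (?pure x c) = f x c" if "x \<in> E"
  proof (rule separating_functional)
    fix \<phi> :: "'d \<Rightarrow> complex" assume \<phi>: "clinear \<phi>"
    have "?pure x c (\<lambda>x c. \<phi> (f x c)) = \<phi> (f x c)" by (simp add: balanced_pure_def bal \<phi>)
    then show "\<phi> (scalar_extension_lift f (?pure x c)) = \<phi> (f x c)"
      unfolding lift[OF scalar_extension_pure[OF that] \<phi>] .
  qed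
  show "scalar_extension_lift f (\<xi> + \<eta>) = scalar_extension_lift f \<xi> + scalar_extension_lift f \<eta>"
    if "\<xi> \<in> ?S" "\<eta> \<in> ?S"
    by (rule separating_functional) (simp add: lift that cvec.subspace_add[OF sub] clinearD)
  show "scalar_extension_lift f (z *\<^sub>C \<xi>) = z *\<^sub>C scalar_extension_lift f \<xi>" if "\<xi> \<in> ?S"
    by (rule separating_functional)
      (simp add: lift that cvec.subspace_scale[OF sub] clinearD, simp add: scaleC_fun_def)
qed

text \<open>The bundle is left behind here: what remains is a \<open>B\<close>-valued Hermitian form
  with the reconstruction formula \<open>frame\<close>, from which positivity, definiteness and
  completeness are derived.\<close>

locale framed_module =
  fixes B :: "'b::complex_star_algebra set" and \<iota> :: "'b \<Rightarrow> 'c::cstar_algebra"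
    and E :: "'x::complex_vector set" and act :: "'x \<Rightarrow> 'b \<Rightarrow> 'x" and ip :: "'x \<Rightarrow> 'x \<Rightarrow> 'b"
    and d :: nat and Y :: "nat \<Rightarrow> 'x"
  assumes B: "star_subalgebra B" and completion: "cstar_completion B \<iota>"
    and E: "cvec.subspace E"
    and act_mem: "\<And>x b. x \<in> E \<Longrightarrow> b \<in> B \<Longrightarrow> act x b \<in> E"
    and act_add_left: "\<And>x y b. x \<in> E \<Longrightarrow> y \<in> E \<Longrightarrow> b \<in> B \<Longrightarrow> act (x + y) b = act x b + act y b"
    and act_add_right: "\<And>x b b'. x \<in> E \<Longrightarrow> b \<in> B \<Longrightarrow> b' \<in> B \<Longrightarrow> act x (b + b') = act x b + act x b'"
    and act_mult: "\<And>x b b'. x \<in> E \<Longrightarrow> b \<in> B \<Longrightarrow> b' \<in> B \<Longrightarrow> act x (b * b') = act (act x b) b'"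
    and act_scaleC_left: "\<And>x b z. x \<in> E \<Longrightarrow> b \<in> B \<Longrightarrow> act (z *\<^sub>C x) b = z *\<^sub>C act x b"
    and act_scaleC_right: "\<And>x b z. x \<in> E \<Longrightarrow> b \<in> B \<Longrightarrow> act x (z *\<^sub>C b) = z *\<^sub>C act x b"
    and act_one: "\<And>x. x \<in> E \<Longrightarrow> act x 1 = x"
    and ip_mem: "\<And>x y. x \<in> E \<Longrightarrow> y \<in> E \<Longrightarrow> ip x y \<in> B"
    and ip_star: "\<And>x y. x \<in> E \<Longrightarrow> y \<in> E \<Longrightarrow> ip y x = star (ip x y)"
    and ip_add: "\<And>x y z. x \<in> E \<Longrightarrow> y \<in> E \<Longrightarrow> z \<in> E \<Longrightarrow> ip x (y + z) = ip x y + ip x z"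
    and ip_scaleC: "\<And>x y z. x \<in> E \<Longrightarrow> y \<in> E \<Longrightarrow> ip x (z *\<^sub>C y) = z *\<^sub>C ip x y"
    and ip_act: "\<And>x y b. x \<in> E \<Longrightarrow> y \<in> E \<Longrightarrow> b \<in> B \<Longrightarrow> ip x (act y b) = ip x y * b"
    and Y_mem: "\<And>k. k < d \<Longrightarrow> Y k \<in> E"
    and frame: "\<And>x. x \<in> E \<Longrightarrow> x = (\<Sum>k<d. act (Y k) (ip (Y k) x))"
begin

lemma iota:
  assumes "x \<in> B"
  shows "y \<in> B \<Longrightarrow> \<iota> (x + y) = \<iota> x + \<iota> y" "y \<in> B \<Longrightarrow> \<iota> (x * y) = \<iota> x * \<iota> y"
    "\<iota> (star x) = star (\<iota> x)" "\<iota> (z *\<^sub>C x) = z *\<^sub>C \<iota> x"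
  using completion assms unfolding cstar_completion_def by blast+

lemma B_closed:
  "0 \<in> B" "x \<in> B \<Longrightarrow> y \<in> B \<Longrightarrow> x * y \<in> B" "x \<in> B \<Longrightarrow> star x \<in> B"
  using B cvec.subspace_0 unfolding star_subalgebra_def by blast+

lemma iota_zero: "\<iota> 0 = 0"
  using iota(4)[OF B_closed(1), of 0] by simp

lemma iota_sum: "(\<And>k. k \<in> A \<Longrightarrow> f k \<in> B) \<Longrightarrow> \<iota> (sum f A) = (\<Sum>k\<in>A. \<iota> (f k))"
proof (induction A rule: infinite_finite_induct)
  case (insert a A)
  then have "sum f A \<in> B"
    using B unfolding star_subalgebra_def by (intro cvec.subspace_sum) auto
  with insert show ?case by (simp add: iota)
qed (simp_all add: iota_zero)

lemma ip_zero: "x \<in> E \<Longrightarrow> ip x 0 = 0"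
  using ip_scaleC[of x 0 0] cvec.subspace_0[OF E] by simp

lemma ip_sum:
  "x \<in> E \<Longrightarrow> (\<And>k. k \<in> A \<Longrightarrow> f k \<in> E) \<Longrightarrow> ip x (sum f A) = (\<Sum>k\<in>A. ip x (f k))"
proof (induction A rule: infinite_finite_induct)
  case (insert a A)
  then have "sum f A \<in> E" by (intro cvec.subspace_sum[OF E]) auto
  with insert show ?case by (simp add: ip_add)
qed (simp_all add: ip_zero)

text \<open>Parseval's identity, obtained by expanding \<open>y\<close>; every factor on the right
  lies in \<open>B\<close>.\<close>

lemma ip_frame:
  assumes "x \<in> E" "y \<in> E"
  shows "ip x y = (\<Sum>k<d. star (ip (Y k) x) * ip (Y k) y)"
proof -
  have "ip x y = ip x (\<Sum>k<d. act (Y k) (ip (Y k) y))" using frame[OF assms(2)] by simp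
  also have "\<dots> = (\<Sum>k<d. ip x (act (Y k) (ip (Y k) y)))"
    using assms by (intro ip_sum) (auto intro: act_mem ip_mem Y_mem)
  also have "\<dots> = (\<Sum>k<d. star (ip (Y k) x) * ip (Y k) y)"
    using assms by (intro sum.cong) (auto simp: ip_act Y_mem ip_mem simp flip: ip_star)
  finally show ?thesis .
qed

lemma iota_ip:
  assumes "x \<in> E" "y \<in> E"
  shows "\<iota> (ip x y) = (\<Sum>k<d. star (\<iota> (ip (Y k) x)) * \<iota> (ip (Y k) y))"
  unfolding ip_frame[OF assms]
  by (subst iota_sum) (auto intro!: sum.cong simp: iota B_closed ip_mem Y_mem assms)

text \<open>The images of the frame coefficients vanish in the completion, because the sum dominates
  each of its terms. Injectivity of \<iota> on \<open>B\<close> carries this back, and the frame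
  formula leaves x = 0.\<close>

lemma ip_definite:
  assumes x: "x \<in> E" and "ip x x = 0"
  shows "x = 0"
proof -
  have "ip (Y k) x = 0" if k: "k < d" for k
  proof -
    have "(norm (\<iota> (ip (Y k) x)))\<^sup>2 \<le> norm (\<iota> (ip x x))"
      unfolding iota_ip[OF x x] using k by (intro norm_le_sum_star_mult) auto
    then have "\<iota> (ip (Y k) x) = \<iota> 0" using assms(2) by (simp add: iota_zero)
    then show ?thesis
      using completion ip_mem[OF Y_mem[OF k] x] B_closed(1)
      unfolding cstar_completion_def inj_on_def by blast
  qed
  moreover have "act (Y k) 0 = 0" if "k < d" for k
    using act_scaleC_right[of "Y k" 0 0] Y_mem[OF that] B_closed(1) by simp
  ultimately show ?thesis using frame[OF x] by simp
qed

lemma right_inner_product_module: "right_inner_product_module B \<iota> E act ip"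
  unfolding right_inner_product_module_def
proof (intro conjI ballI allI impI)
  fix x y assume "x \<in> E" "y \<in> E"
  then show "ip y x = star (ip x y)" by (rule ip_star)
next
  fix x assume x: "x \<in> E"
  show "cstar_positive (\<iota> (ip x x))"
    unfolding iota_ip[OF x x] by (rule cstar_positive_sum_star_mult)
qed (simp_all add: E act_mem act_add_left act_add_right act_mult act_scaleC_left act_scaleC_right
    act_one ip_mem ip_add ip_scaleC ip_act ip_definite)

abbreviation "ext \<equiv> scalar_extension B \<iota> E act"

abbreviation "pure \<equiv> balanced_pure B \<iota> E act"

text \<open>The k-th frame coefficient, extended to the completion. Together with
  \<open>combine\<close> it realises the scalar extension as a direct summand of the free module of
  rank \<open>d\<close> over \<open>'c\<close>.\<close>

definition coord :: "nat \<Rightarrow> (('x \<Rightarrow> 'c \<Rightarrow> complex) \<Rightarrow> complex) \<Rightarrow> 'c"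
  where "coord k = scalar_extension_lift (\<lambda>x c. \<iota> (ip (Y k) x) * c)"

lemma coord:
  assumes k: "k < d"
  shows "x \<in> E \<Longrightarrow> coord k (pure x c) = \<iota> (ip (Y k) x) * c"
    and "\<xi> \<in> ext \<Longrightarrow> \<eta> \<in> ext \<Longrightarrow> coord k (\<xi> + \<eta>) = coord k \<xi> + coord k \<eta>"
    and "\<xi> \<in> ext \<Longrightarrow> coord k (z *\<^sub>C \<xi>) = z *\<^sub>C coord k \<xi>"
proof -
  have "balanced_form B \<iota> E act (\<lambda>x c. \<phi> (\<iota> (ip (Y k) x) * c))" if "clinear \<phi>" for \<phi> :: "'c \<Rightarrow> complex"
    unfolding balanced_form_def clinear_iff
    by (auto simp: clinearD[OF that] distrib_left distrib_right mult_scaleC_left mult_scaleC_right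
        ip_add ip_scaleC ip_act Y_mem k iota ip_mem mult.assoc)
  note lift = scalar_extension_lift[of B \<iota> E act "\<lambda>x c. \<iota> (ip (Y k) x) * c", OF this, folded coord_def]
  show "x \<in> E \<Longrightarrow> coord k (pure x c) = \<iota> (ip (Y k) x) * c"
    "\<xi> \<in> ext \<Longrightarrow> \<eta> \<in> ext \<Longrightarrow> coord k (\<xi> + \<eta>) = coord k \<xi> + coord k \<eta>"
    "\<xi> \<in> ext \<Longrightarrow> coord k (z *\<^sub>C \<xi>) = z *\<^sub>C coord k \<xi>"
    by (rule lift; assumption)+
qed

lemma coord_zero: "k < d \<Longrightarrow> coord k 0 = 0"
  using coord(3)[OF _ cvec.subspace_0[OF subspace_scalar_extension], of k 0] by simp

lemma coord_sum:
  assumes k: "k < d"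
  shows "(\<And>i. i \<in> A \<Longrightarrow> f i \<in> ext) \<Longrightarrow> coord k (sum f A) = (\<Sum>i\<in>A. coord k (f i))"
proof (induction A rule: infinite_finite_induct)
  case (insert a A)
  have "sum f A \<in> ext"
    by (rule cvec.subspace_sum[OF subspace_scalar_extension]) (use insert.prems in blast)
  then have "coord k (f a + sum f A) = coord k (f a) + coord k (sum f A)"
    using insert.prems by (intro coord(2)[OF k]) blast+
  moreover have "coord k (sum f A) = (\<Sum>i\<in>A. coord k (f i))"
    using insert.prems by (intro insert.IH) blast
  ultimately show ?case by (simp only: sum.insert[OF insert.hyps])
qed (simp_all add: coord_zero k)

lemma coord_diff:
  assumes k: "k < d" and "\<xi> \<in> ext" "\<eta> \<in> ext"
  shows "coord k (\<xi> - \<eta>) = coord k \<xi> - coord k \<eta>"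
proof -
  have "\<xi> - \<eta> \<in> ext" using assms by (intro cvec.subspace_diff[OF subspace_scalar_extension])
  from coord(2)[OF k this assms(3)] show ?thesis by simp
qed

definition combine :: "(nat \<Rightarrow> 'c) \<Rightarrow> ('x \<Rightarrow> 'c \<Rightarrow> complex) \<Rightarrow> complex"
  where "combine z = (\<Sum>k<d. pure (Y k) (z k))"

lemma combine_mem: "combine z \<in> ext"
  unfolding combine_def
  by (intro cvec.subspace_sum[OF subspace_scalar_extension] scalar_extension_pure) (auto intro: Y_mem)

text \<open>Balancedness moves the coefficient \<open>ip (Y k) x\<close> from the module into the
  completion, which turns the frame formula into a statement about coordinates.\<close>

lemma combine_coord_pure:
  assumes x: "x \<in> E"
  shows "combine (\<lambda>k. \<iota> (ip (Y k) x) * c) = pure x c"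
proof -
  have "pure x c = pure (\<Sum>k<d. act (Y k) (ip (Y k) x)) c" using frame[OF x] by simp
  also have "\<dots> = (\<Sum>k<d. pure (act (Y k) (ip (Y k) x)) c)"
    by (rule balanced_pure_sum[OF E]) (auto intro: act_mem ip_mem Y_mem x)
  also have "\<dots> = combine (\<lambda>k. \<iota> (ip (Y k) x) * c)"
    unfolding combine_def by (intro sum.cong) (auto simp: balanced_pure_simps(5) Y_mem ip_mem x)
  finally show ?thesis ..
qed

lemma combine_add: "combine (\<lambda>k. z k + w k) = combine z + combine w"
  and combine_scaleC: "combine (\<lambda>k. c *\<^sub>C z k) = c *\<^sub>C combine z"
  unfolding combine_def
  by (auto simp: balanced_pure_simps(3,4) Y_mem sum.distrib cvec.scale_sum_right intro!: sum.cong)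

lemma combine_cong: "(\<And>k. k < d \<Longrightarrow> z k = w k) \<Longrightarrow> combine z = combine w"
  unfolding combine_def by (intro sum.cong) auto

lemma combine_coord:
  assumes "\<xi> \<in> ext"
  shows "combine (\<lambda>k. coord k \<xi>) = \<xi>"
proof -
  note sub = subspace_scalar_extension[of B \<iota> E act]
  have "\<xi> \<in> cvec.span {pure x c | x c. x \<in> E}"
    using assms unfolding scalar_extension_def .
  then have "\<xi> \<in> ext \<and> combine (\<lambda>k. coord k \<xi>) = \<xi>"
  proof (induction rule: cvec.span_induct_alt)
    case base
    have "combine (\<lambda>k. coord k 0) = 0"
      unfolding combine_def by (rule sum.neutral) (simp add: coord_zero balanced_pure_zero Y_mem)
    with cvec.subspace_0[OF sub] show ?case by blast
  next
    case (step z \<xi> \<eta>)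
    then obtain x c where x: "x \<in> E" "\<xi> = pure x c" by auto
    have \<xi>: "\<xi> \<in> ext" unfolding x(2) by (rule scalar_extension_pure[OF x(1)])
    have \<eta>: "\<eta> \<in> ext" "combine (\<lambda>k. coord k \<eta>) = \<eta>" using step by auto
    have z\<xi>: "z *\<^sub>C \<xi> \<in> ext" by (rule cvec.subspace_scale[OF sub \<xi>])
    have "combine (\<lambda>k. coord k (z *\<^sub>C \<xi> + \<eta>)) = combine (\<lambda>k. z *\<^sub>C coord k \<xi> + coord k \<eta>)"
      by (rule combine_cong) (simp only: coord(2)[OF _ z\<xi> \<eta>(1)] coord(3)[OF _ \<xi>])
    also have "\<dots> = z *\<^sub>C combine (\<lambda>k. coord k \<xi>) + \<eta>"
      by (simp only: combine_add combine_scaleC \<eta>(2))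
    also have "combine (\<lambda>k. coord k \<xi>) = combine (\<lambda>k. \<iota> (ip (Y k) x) * c)"
      unfolding x(2) by (rule combine_cong) (rule coord(1)[OF _ x(1)])
    also have "\<dots> = \<xi>" unfolding x(2) by (rule combine_coord_pure[OF x(1)])
    finally show ?case using cvec.subspace_add[OF sub z\<xi> \<eta>(1)] by blast
  qed
  then show ?thesis ..
qed

text \<open>The Gram matrix of the frame acts on \<open>d\<close>-tuples as an idempotent, whose
  image is the set of coordinate tuples of \<open>ext\<close>.\<close>

lemma coord_combine:
  assumes l: "l < d"
  shows "coord l (combine z) = (\<Sum>k<d. \<iota> (ip (Y l) (Y k)) * z k)"
proof -
  have "coord l (combine z) = (\<Sum>k<d. coord l (pure (Y k) (z k)))"
    unfolding combine_def by (rule coord_sum[OF l]) (simp add: scalar_extension_pure Y_mem)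
  also have "\<dots> = (\<Sum>k<d. \<iota> (ip (Y l) (Y k)) * z k)"
    by (rule sum.cong) (simp_all add: coord(1)[OF l] Y_mem)
  finally show ?thesis .
qed

text \<open>Coordinate tuples are fixed by the Gram matrix. This condition is closed and compatible
  with right multiplication, which is behind completeness and the module action
  respectively.\<close>

lemma coord_eq:
  assumes "l < d" "\<xi> \<in> ext"
  shows "coord l \<xi> = (\<Sum>k<d. \<iota> (ip (Y l) (Y k)) * coord k \<xi>)"
  using coord_combine[OF assms(1), of "\<lambda>k. coord k \<xi>"] unfolding combine_coord[OF assms(2)] .

section \<open>The Hilbert module structure of the scalar extension\<close>

definition ext_act :: "(('x \<Rightarrow> 'c \<Rightarrow> complex) \<Rightarrow> complex) \<Rightarrow> 'c \<Rightarrow> ('x \<Rightarrow> 'c \<Rightarrow> complex) \<Rightarrow> complex"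
  where "ext_act \<xi> c = combine (\<lambda>k. coord k \<xi> * c)"

text \<open>The standard inner product of the free module of rank \<open>d\<close>, pulled back
  along the coordinates; Parseval's identity makes it an extension of \<open>ip\<close>.\<close>

definition ext_ip :: "(('x \<Rightarrow> 'c \<Rightarrow> complex) \<Rightarrow> complex) \<Rightarrow> (('x \<Rightarrow> 'c \<Rightarrow> complex) \<Rightarrow> complex) \<Rightarrow> 'c"
  where "ext_ip \<xi> \<eta> = (\<Sum>k<d. star (coord k \<xi>) * coord k \<eta>)"

lemma coord_ext_act:
  assumes "l < d" "\<xi> \<in> ext"
  shows "coord l (ext_act \<xi> c) = coord l \<xi> * c"
  unfolding ext_act_def coord_combine[OF assms(1)] coord_eq[OF assms]
  by (simp add: sum_distrib_right mult.assoc)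

lemma ext_act_pure: "x \<in> E \<Longrightarrow> ext_act (pure x c) c' = pure x (c * c')"
  unfolding ext_act_def combine_coord_pure[symmetric]
  by (rule combine_cong) (simp add: combine_coord_pure coord mult.assoc)

lemma ext_ip_pure:
  assumes "x \<in> E" "y \<in> E"
  shows "ext_ip (pure x c) (pure y c') = star c * \<iota> (ip x y) * c'"
  unfolding ext_ip_def iota_ip[OF assms]
  by (auto simp: coord assms star_mult sum_distrib_left sum_distrib_right mult.assoc intro!: sum.cong)

lemma norm_coord_le:
  assumes "k < d"
  shows "norm (coord k \<xi>) \<le> hilbert_norm ext_ip \<xi>"
proof -
  have "(norm (coord k \<xi>))\<^sup>2 \<le> norm (ext_ip \<xi> \<xi>)"
    unfolding ext_ip_def using assms by (intro norm_le_sum_star_mult) auto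
  then show ?thesis unfolding hilbert_norm_def by (rule real_le_rsqrt)
qed

lemma ext_ip_definite:
  assumes "\<xi> \<in> ext" "ext_ip \<xi> \<xi> = 0"
  shows "\<xi> = 0"
proof -
  have "coord k \<xi> = 0" if "k < d" for k
    using norm_coord_le[OF that, of \<xi>] assms(2) by (simp add: hilbert_norm_def)
  then show ?thesis
    using combine_coord[OF assms(1)] by (simp add: combine_def balanced_pure_zero Y_mem)
qed

lemma ext_inner_product_module: "right_inner_product_module UNIV id ext ext_act ext_ip"
  unfolding right_inner_product_module_def
proof (intro conjI ballI allI impI)
  note sub = subspace_scalar_extension[of B \<iota> E act]
  show "cvec.subspace ext" by (rule sub)
  fix \<xi> assume \<xi>: "\<xi> \<in> ext"
  show act_mem: "ext_act \<xi> b \<in> ext" for b unfolding ext_act_def by (rule combine_mem)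
  show "ext_act \<xi> (b + b') = ext_act \<xi> b + ext_act \<xi> b'" for b b'
    unfolding ext_act_def by (simp add: distrib_left combine_add)
  show "ext_act \<xi> (b * b') = ext_act (ext_act \<xi> b) b'" for b b'
    unfolding ext_act_def[of _ b'] ext_act_def[of _ "b * b'"]
    by (rule combine_cong) (simp add: coord_ext_act \<xi> mult.assoc)
  show "ext_act (z *\<^sub>C \<xi>) b = z *\<^sub>C ext_act \<xi> b" for z b
    unfolding ext_act_def combine_scaleC[symmetric]
    by (rule combine_cong) (simp add: coord \<xi> mult_scaleC_left)
  show "ext_act \<xi> (z *\<^sub>C b) = z *\<^sub>C ext_act \<xi> b" for z b
    unfolding ext_act_def combine_scaleC[symmetric] by (simp add: mult_scaleC_right)
  show "ext_act \<xi> 1 = \<xi>" unfolding ext_act_def by (simp add: combine_coord \<xi>)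
  show "cstar_positive (id (ext_ip \<xi> \<xi>))"
    unfolding ext_ip_def id_apply by (rule cstar_positive_sum_star_mult)
  show "ext_ip \<xi> \<xi> = 0 \<Longrightarrow> \<xi> = 0" by (rule ext_ip_definite[OF \<xi>])
  fix \<eta> assume \<eta>: "\<eta> \<in> ext"
  show "ext_act (\<xi> + \<eta>) b = ext_act \<xi> b + ext_act \<eta> b" for b
    unfolding ext_act_def combine_add[symmetric]
    by (rule combine_cong) (simp add: coord \<xi> \<eta> distrib_right)
  show "ext_ip \<xi> \<eta> \<in> UNIV" ..
  show "ext_ip \<eta> \<xi> = star (ext_ip \<xi> \<eta>)"
    unfolding ext_ip_def by (simp add: star_sum star_mult star_star)
  show "ext_ip \<xi> (z *\<^sub>C \<eta>) = z *\<^sub>C ext_ip \<xi> \<eta>" for z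
    unfolding ext_ip_def by (simp add: coord \<eta> mult_scaleC_right cvec.scale_sum_right)
  show "ext_ip \<xi> (ext_act \<eta> b) = ext_ip \<xi> \<eta> * b" for b
    unfolding ext_ip_def by (simp add: coord_ext_act \<eta> sum_distrib_right mult.assoc)
  fix \<zeta> assume \<zeta>: "\<zeta> \<in> ext"
  show "ext_ip \<xi> (\<eta> + \<zeta>) = ext_ip \<xi> \<eta> + ext_ip \<xi> \<zeta>"
    unfolding ext_ip_def by (simp add: coord \<eta> \<zeta> distrib_left sum.distrib)
qed

lemma ext_complete:
  fixes X :: "nat \<Rightarrow> ('x \<Rightarrow> 'c \<Rightarrow> complex) \<Rightarrow> complex"
  assumes X: "range X \<subseteq> ext"
    and Cauchy_X: "\<forall>r>0. \<exists>N. \<forall>m\<ge>N. \<forall>n\<ge>N. hilbert_norm ext_ip (X m - X n) < r"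
  shows "\<exists>x\<in>ext. (\<lambda>n. hilbert_norm ext_ip (X n - x)) \<longlonglongrightarrow> 0"
proof -
  have mem: "X n \<in> ext" for n using X by auto
  have "\<exists>z. (\<lambda>n. coord k (X n)) \<longlonglongrightarrow> z" if k: "k < d" for k
  proof -
    have "dist (coord k (X m)) (coord k (X n)) \<le> hilbert_norm ext_ip (X m - X n)" for m n
      using norm_coord_le[OF k, of "X m - X n"] by (simp add: coord_diff k mem dist_norm)
    then have "Cauchy (\<lambda>n. coord k (X n))"
      unfolding Cauchy_def using Cauchy_X by (meson le_less_trans)
    then show ?thesis using Cauchy_convergent convergent_def by blast
  qed
  then obtain z where z: "\<And>k. k < d \<Longrightarrow> (\<lambda>n. coord k (X n)) \<longlonglongrightarrow> z k" by metis
  define x where "x = combine z"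
  have x: "x \<in> ext" unfolding x_def by (rule combine_mem)
  \<comment> \<open>A tuple \<open>z\<close> is in general not the coordinate tuple of
    \<open>combine z\<close>. This one is, since the fixed point equation \<open>coord_eq\<close> of
    the \<open>X n\<close> passes to the limit.\<close>
  have coord_x: "coord l x = z l" if l: "l < d" for l
  proof (rule LIMSEQ_unique[OF _ z[OF l]])
    show "(\<lambda>n. coord l (X n)) \<longlonglongrightarrow> coord l x"
      unfolding x_def coord_combine[OF l] coord_eq[OF l mem]
      by (intro tendsto_sum tendsto_mult tendsto_const z) auto
  qed
  have "(\<lambda>n. coord k (X n - x)) \<longlonglongrightarrow> 0" if k: "k < d" for k
    unfolding coord_diff[OF k mem x] coord_x[OF k] using z[OF k] by (rule LIM_zero)
  then have "(\<lambda>n. hilbert_norm ext_ip (X n - x)) \<longlonglongrightarrow> sqrt (norm (\<Sum>k<d. star 0 * (0::'c)))"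
    unfolding hilbert_norm_def ext_ip_def
    by (intro tendsto_intros bounded_linear.tendsto[OF bounded_linear_star]) auto
  with x show ?thesis by auto
qed

lemma right_hilbert_module_by_completion: "right_hilbert_module_by_completion B \<iota> E act ip"
  unfolding right_hilbert_module_by_completion_def right_hilbert_module_def
  using right_inner_product_module ext_inner_product_module ext_complete ext_act_pure ext_ip_pure
  by blast

end

section \<open>Orthonormal bases\<close>

text \<open>Positivity is kept out of the locale: \<open>coord_form n G\<close> ignores all entries
  from \<open>n\<close> on and so is degenerate on the whole function space. It is demanded on the
  subspace concerned.\<close>

locale hermitian_form =
  fixes g :: "'v::complex_vector \<Rightarrow> 'v \<Rightarrow> complex"
  assumes add_right: "g x (y + z) = g x y + g x z"
    and scale_right: "g x (c *\<^sub>C y) = c * g x y"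
    and hermitian: "g y x = cnj (g x y)"
begin

lemma scale_left: "g (c *\<^sub>C x) y = cnj c * g x y"
  by (metis complex_cnj_mult hermitian scale_right)

lemma zero_right: "g x 0 = 0"
  using scale_right[of x 0 0] by simp

lemma sum_right: "g x (sum f A) = (\<Sum>i\<in>A. g x (f i))"
  by (induction A rule: infinite_finite_induct) (simp_all add: zero_right add_right)

lemma diff_right: "g x (y - z) = g x y - g x z"
  using add_right[of x "y - z" z] by simp

definition orthonormal :: "nat \<Rightarrow> (nat \<Rightarrow> 'v) \<Rightarrow> bool"
  where "orthonormal m f \<longleftrightarrow> (\<forall>i<m. \<forall>j<m. g (f i) (f j) = (if i = j then 1 else 0))"

lemma orthonormal_expansion:
  assumes f: "orthonormal m f" and w: "w \<in> cvec.span (f ` {..<m})"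
  shows "w = (\<Sum>j<m. g (f j) w *\<^sub>C f j)"
  using w
proof (induction rule: cvec.span_induct_alt)
  case base
  show ?case by (simp add: zero_right)
next
  case (step c x y)
  then obtain i where i: "i < m" "x = f i" by auto
  have "(\<Sum>j<m. g (f j) (c *\<^sub>C x + y) *\<^sub>C f j)
      = (\<Sum>j<m. if j = i then c *\<^sub>C f i else 0) + (\<Sum>j<m. g (f j) y *\<^sub>C f j)"
    unfolding sum.distrib[symmetric] using f i
    by (intro sum.cong) (auto simp: orthonormal_def add_right scale_right scaleC_add_left)
  then show ?case using i step by simp
qed

lemma orthonormal_vanish:
  assumes f: "orthonormal m f" and i: "i < m" and I: "I \<subseteq> {..<m}" "i \<notin> I"
    and w: "w \<in> cvec.span (f ` I)"
  shows "g (f i) w = 0"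
  using w
proof (induction rule: cvec.span_induct_alt)
  case (step c x y)
  then obtain j where "j \<in> I" "x = f j" by auto
  then have "g (f i) x = 0" using f i I unfolding orthonormal_def by auto
  then show ?case using step by (simp add: add_right scale_right)
qed (simp add: zero_right)

text \<open>An orthonormal family is independent, so any finite spanning set bounds its length. This
  both stops the Gram--Schmidt process and compares the lengths of two bases.\<close>

lemma orthonormal_card:
  assumes f: "orthonormal m f" and T: "finite T" "f ` {..<m} \<subseteq> cvec.span T"
  shows "m \<le> card T"
proof -
  have one: "g (f i) (f i) = 1" if "i < m" for i using f that by (simp add: orthonormal_def)
  have inj: "inj_on f {..<m}"
  proof (rule inj_onI)
    fix i j assume "i \<in> {..<m}" "j \<in> {..<m}" "f i = f j"
    then show "i = j" using f one[of i] unfolding orthonormal_def by (metis lessThan_iff zero_neq_one)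
  qed
  have "cvec.independent (f ` {..<m})"
  proof
    assume "cvec.dependent (f ` {..<m})"
    then obtain i where i: "i < m" "f i \<in> cvec.span (f ` {..<m} - {f i})"
      unfolding cvec.dependent_def by auto
    have "f ` {..<m} - {f i} = f ` ({..<m} - {i})"
      using inj_on_image_set_diff[OF inj, of "{..<m}" "{i}"] i(1) by auto
    then show False using orthonormal_vanish[OF f i(1), of "{..<m} - {i}" "f i"] i one by auto
  qed
  from cvec.independent_span_bound[OF T(1) this T(2)]
  show ?thesis by (simp add: card_image[OF inj])
qed

text \<open>Gram--Schmidt from a given start, so that bases adapted to a subspace can be built;
  \<open>card T\<close> bounds the number of steps.\<close>

lemma orthonormal_extend:
  assumes W: "cvec.subspace W" and pos: "\<And>x. x \<in> W \<Longrightarrow> x \<noteq> 0 \<Longrightarrow> 0 < Re (g x x)"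
    and T: "finite T" "W \<subseteq> cvec.span T"
  shows "orthonormal p f \<Longrightarrow> (\<forall>i<p. f i \<in> W) \<Longrightarrow>
    \<exists>m f'. p \<le> m \<and> (\<forall>i<p. f' i = f i) \<and> (\<forall>i<m. f' i \<in> W) \<and> orthonormal m f'
      \<and> cvec.span (f' ` {..<m}) = W"
proof (induction "card T - p" arbitrary: p f rule: less_induct)
  case less
  have sub: "cvec.span (f ` {..<p}) \<subseteq> W"
    using less.prems(2) W by (intro cvec.span_minimal) auto
  show ?case
  proof (cases "cvec.span (f ` {..<p}) = W")
    case True
    with less.prems show ?thesis by blast
  next
    case False
    with sub obtain w where w: "w \<in> W" "w \<notin> cvec.span (f ` {..<p})" by blast
    define r where "r = w - (\<Sum>j<p. g (f j) w *\<^sub>C f j)"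
    have proj: "(\<Sum>j<p. g (f j) w *\<^sub>C f j) \<in> cvec.span (f ` {..<p})"
      by (intro cvec.span_sum cvec.span_scale cvec.span_base) auto
    have r: "r \<in> W" unfolding r_def using sub proj w(1) by (intro cvec.subspace_diff[OF W]) auto
    have "r \<noteq> 0" using proj w(2) by (auto simp: r_def)
    then have s: "0 < Re (g r r)" by (rule pos[OF r])
    have grr: "g r r = complex_of_real (Re (g r r))"
      using hermitian[of r r] by (simp add: complex_eq_iff)
    define v where "v = complex_of_real (1 / sqrt (Re (g r r))) *\<^sub>C r"
    have gvv: "g v v = 1"
      unfolding v_def scale_left scale_right by (subst grr) (use s in \<open>simp flip: of_real_mult of_real_divide\<close>)
    have orth: "g (f i) r = 0" if "i < p" for i
    proof -
      have "(\<Sum>j<p. g (f j) w * g (f i) (f j)) = (\<Sum>j<p. if j = i then g (f i) w else 0)"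
        using less.prems(1) that by (intro sum.cong) (auto simp: orthonormal_def)
      then show ?thesis using that by (simp add: r_def diff_right sum_right scale_right)
    qed
    have gfv: "g (f i) v = 0" "g v (f i) = 0" if "i < p" for i
      using orth[OF that] hermitian[of v "f i"] by (simp_all add: v_def scale_right)
    let ?f = "f(p := v)"
    have on: "orthonormal (Suc p) ?f"
      using less.prems(1) gvv gfv unfolding orthonormal_def by (auto simp: less_Suc_eq)
    have mem: "\<forall>i<Suc p. ?f i \<in> W"
      using less.prems(2) cvec.subspace_scale[OF W r] by (auto simp: less_Suc_eq v_def)
    have "Suc p \<le> card T"
      using mem T(2) by (intro orthonormal_card[OF on T(1)]) auto
    then have "card T - Suc p < card T - p" by simp
    from less.hyps[OF this on mem] obtain m f' where
      "Suc p \<le> m" "\<forall>i<Suc p. f' i = ?f i" "\<forall>i<m. f' i \<in> W" "orthonormal m f'"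
      "cvec.span (f' ` {..<m}) = W" by blast
    then show ?thesis by (intro exI[of _ m] exI[of _ f']) auto
  qed
qed

end

section \<open>Coordinate spaces and their Hermitian forms\<close>

lemma sum_fun_apply: "sum f A x = (\<Sum>i\<in>A. f i x)"
  for f :: "'i \<Rightarrow> 'b \<Rightarrow> 'c::comm_monoid_add"
  by (induction A rule: infinite_finite_induct) simp_all

definition unit_vector :: "nat \<Rightarrow> nat \<Rightarrow> complex"
  where "unit_vector i = (\<lambda>k. if k = i then 1 else 0)"

lemma subspace_coordinate_space: "cvec.subspace (coordinate_space n)"
  by (auto simp: cvec.subspace_def coordinate_space_def scaleC_fun_def scaleC_complex_def)

lemma unit_vector_mem: "i < n \<Longrightarrow> unit_vector i \<in> coordinate_space n"
  by (auto simp: coordinate_space_def unit_vector_def)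

lemma coordinate_space_span: "coordinate_space n \<subseteq> cvec.span (unit_vector ` {..<n})"
proof
  fix w assume w: "w \<in> coordinate_space n"
  have "w = (\<Sum>i<n. w i *\<^sub>C unit_vector i)"
  proof
    fix k
    have "(\<Sum>i<n. w i *\<^sub>C unit_vector i) k = (\<Sum>i<n. if i = k then w k else 0)"
      unfolding sum_fun_apply
      by (intro sum.cong) (auto simp: unit_vector_def scaleC_fun_def scaleC_complex_def)
    then show "w k = (\<Sum>i<n. w i *\<^sub>C unit_vector i) k"
      using w by (auto simp: coordinate_space_def)
  qed
  then show "w \<in> cvec.span (unit_vector ` {..<n})"
    by (metis (no_types, lifting) cvec.span_sum cvec.span_scale cvec.span_base imageI)
qed

definition coord_form :: "nat \<Rightarrow> (nat \<Rightarrow> nat \<Rightarrow> complex) \<Rightarrow> (nat \<Rightarrow> complex) \<Rightarrow> (nat \<Rightarrow> complex) \<Rightarrow> complex"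
  where "coord_form n G x y = (\<Sum>i<n. \<Sum>j<n. cnj (x i) * G i j * y j)"

lemma hermitian_coord_form:
  assumes "\<And>i j. i < n \<Longrightarrow> j < n \<Longrightarrow> G j i = cnj (G i j)"
  shows "hermitian_form (coord_form n G)"
proof
  fix x y z :: "nat \<Rightarrow> complex" and c :: complex
  show "coord_form n G x (y + z) = coord_form n G x y + coord_form n G x z"
    by (simp add: coord_form_def distrib_left sum.distrib)
  show "coord_form n G x (c *\<^sub>C y) = c * coord_form n G x y"
    by (simp add: coord_form_def scaleC_fun_def scaleC_complex_def sum_distrib_left mult_ac)
  have eq: "cnj (y i) * G i j * x j = cnj (cnj (x j) * G j i * y i)" if "i < n" "j < n" for i j
    by (simp add: assms[OF that])
  have "coord_form n G y x = (\<Sum>j<n. \<Sum>i<n. cnj (y i) * G i j * x j)"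
    unfolding coord_form_def by (rule sum.swap)
  also have "\<dots> = (\<Sum>j<n. \<Sum>i<n. cnj (cnj (x j) * G j i * y i))"
    by (intro sum.cong refl eq) auto
  finally show "coord_form n G y x = cnj (coord_form n G x y)"
    by (simp add: coord_form_def)
qed

lemma coord_form_unit_vector: "j < n \<Longrightarrow> coord_form n G x (unit_vector j) = (\<Sum>i<n. cnj (x i) * G i j)"
  by (simp add: coord_form_def unit_vector_def if_distrib cong: if_cong)

section \<open>Change of basis\<close>

definition inverse_matrices :: "nat \<Rightarrow> (nat \<Rightarrow> nat \<Rightarrow> complex) \<Rightarrow> (nat \<Rightarrow> nat \<Rightarrow> complex) \<Rightarrow> bool"
  where "inverse_matrices n A A' \<longleftrightarrow> (\<forall>i<n. \<forall>j<n. (\<Sum>k<n. A i k * A' k j) = (if i = j then 1 else 0)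
    \<and> (\<Sum>k<n. A' i k * A k j) = (if i = j then 1 else 0))"

text \<open>The matrix with the basis vectors as columns is inverted by the coefficient functionals
  of the basis. The prescribed initial part \<open>f\<close> allows for a basis adapted to a
  subspace.\<close>

lemma coord_form_basis:
  assumes G: "\<And>i j. i < n \<Longrightarrow> j < n \<Longrightarrow> G j i = cnj (G i j)"
    and pos: "\<And>c. \<exists>i<n. c i \<noteq> 0 \<Longrightarrow> 0 < Re (coord_form n G c c)"
    and f: "hermitian_form.orthonormal (coord_form n G) p f" "\<forall>i<p. f i \<in> coordinate_space n"
  obtains f' where "p \<le> n" "\<forall>i<p. f' i = f i" "\<forall>i<n. f' i \<in> coordinate_space n"
    "hermitian_form.orthonormal (coord_form n G) n f'"
    "cvec.span (f' ` {..<n}) = coordinate_space n"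
    "inverse_matrices n (\<lambda>i a. f' a i) (\<lambda>a i. coord_form n G (f' a) (unit_vector i))"
proof -
  interpret hermitian_form "coord_form n G" by (rule hermitian_coord_form) (rule G)
  interpret std: hermitian_form "coord_form n (\<lambda>i j. if i = j then 1 else 0)"
    by (rule hermitian_coord_form) auto
  let ?C = "coordinate_space n"
  have "0 < Re (coord_form n G x x)" if "x \<in> ?C" "x \<noteq> 0" for x
  proof (rule pos)
    from that(2) obtain i where "x i \<noteq> 0" by (auto simp: fun_eq_iff)
    with that(1) show "\<exists>i<n. x i \<noteq> 0" unfolding coordinate_space_def by (metis (mono_tags) mem_Collect_eq not_less)
  qed
  from orthonormal_extend[OF subspace_coordinate_space this _ coordinate_space_span f]
  obtain m f' where f': "p \<le> m" "\<forall>i<p. f' i = f i" "\<forall>i<m. f' i \<in> ?C" "orthonormal m f'"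
      "cvec.span (f' ` {..<m}) = ?C" by auto
  have "m \<le> card (unit_vector ` {..<n})"
    using f'(3) coordinate_space_span by (intro orthonormal_card[OF f'(4)]) auto
  then have "m \<le> n" using card_image_le[of "{..<n}" unit_vector] by simp
  \<comment> \<open>The reverse inequality uses a second form: the unit vectors are orthonormal for
    the standard one and lie in the span of the \<open>m\<close> vectors \<open>f'\<close>.\<close>
  moreover have "std.orthonormal n unit_vector"
    unfolding std.orthonormal_def
  proof (intro allI impI)
    fix i j assume ij: "i < n" "j < n"
    have "(\<Sum>k<n. cnj (unit_vector i k) * (if k = j then 1 else 0))
        = (\<Sum>k<n. if k = j then (if i = j then 1 else 0) else 0)"
      by (intro sum.cong) (auto simp: unit_vector_def)
    then show "coord_form n (\<lambda>i j. if i = j then 1 else 0) (unit_vector i) (unit_vector j)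
        = (if i = j then 1 else 0)"
      unfolding coord_form_unit_vector[OF ij(2)] using ij by simp
  qed
  then have "n \<le> card (f' ` {..<m})"
    by (rule std.orthonormal_card) (auto simp: f'(5) unit_vector_mem)
  then have "n \<le> m" using card_image_le[of "{..<m}" f'] by simp
  ultimately have m: "m = n" by simp
  have "inverse_matrices n (\<lambda>i a. f' a i) (\<lambda>a i. coord_form n G (f' a) (unit_vector i))"
    unfolding inverse_matrices_def
  proof (intro allI impI conjI)
    fix i j assume ij: "i < n" "j < n"
    have "unit_vector j = (\<Sum>a<n. coord_form n G (f' a) (unit_vector j) *\<^sub>C f' a)"
      using f'(4) unit_vector_mem[OF ij(2)] unfolding f'(5)[symmetric] m by (rule orthonormal_expansion)
    then have "unit_vector j i = (\<Sum>a<n. coord_form n G (f' a) (unit_vector j) *\<^sub>C f' a) i" by simp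
    also have "\<dots> = (\<Sum>a<n. f' a i * coord_form n G (f' a) (unit_vector j))"
      unfolding sum_fun_apply by (simp add: scaleC_fun_def scaleC_complex_def mult.commute)
    finally show "(\<Sum>k<n. f' k i * coord_form n G (f' k) (unit_vector j)) = (if i = j then 1 else 0)"
      by (simp add: unit_vector_def)
    have "(\<Sum>k<n. coord_form n G (f' i) (unit_vector k) * f' j k)
        = (\<Sum>k<n. \<Sum>l<n. cnj (f' i l) * G l k * f' j k)"
      by (simp add: coord_form_unit_vector sum_distrib_right)
    also have "\<dots> = coord_form n G (f' i) (f' j)"
      unfolding coord_form_def by (rule sum.swap)
    also have "\<dots> = (if i = j then 1 else 0)" using f'(4) ij by (simp add: orthonormal_def m)
    finally show "(\<Sum>k<n. coord_form n G (f' i) (unit_vector k) * f' j k) = (if i = j then 1 else 0)" .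
  qed
  with f' m show ?thesis by (intro that[of f']) auto
qed

lemma cbilinear_times: "cbilinear ((*) :: 'a::complex_star_algebra \<Rightarrow> 'a \<Rightarrow> 'a)"
  by (simp add: cbilinear_def clinear_iff distrib_left distrib_right mult_scaleC_left mult_scaleC_right)

lemma cbilinear_tensor: "cbilinear (\<otimes>\<^sub>C)"
  by (simp add: cbilinear_def clinear_iff tensor_pure_bilinear)

lemma clinear_sum: "clinear f \<Longrightarrow> f (sum x A) = (\<Sum>i\<in>A. f (x i))"
  by (induction A rule: infinite_finite_induct) (simp_all add: clinearD)

lemma cbilinear_simps:
  assumes "cbilinear f"
  shows "f (sum x A) b = (\<Sum>i\<in>A. f (x i) b)" "f a (sum y A) = (\<Sum>i\<in>A. f a (y i))"
    "f (c *\<^sub>C a) b = c *\<^sub>C f a b" "f a (c *\<^sub>C b) = c *\<^sub>C f a b"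
  using assms clinear_sum[of "\<lambda>a. f a b"] clinear_sum[of "f a"] clinearD[of "\<lambda>a. f a b"] clinearD[of "f a"]
  unfolding cbilinear_def by auto

lemmas tensor_sum = cbilinear_simps(1,2)[OF cbilinear_tensor]

lemma bilinear_contraction:
  assumes f: "cbilinear f"
  shows "(\<Sum>c<n. f (\<Sum>k<n. P k c *\<^sub>C x k) (\<Sum>l<n. Q c l *\<^sub>C y l))
    = (\<Sum>k<n. \<Sum>l<n. (\<Sum>c<n. P k c * Q c l) *\<^sub>C f (x k) (y l))"
proof -
  have "(\<Sum>c<n. f (\<Sum>k<n. P k c *\<^sub>C x k) (\<Sum>l<n. Q c l *\<^sub>C y l))
      = (\<Sum>c<n. \<Sum>k<n. \<Sum>l<n. (P k c * Q c l) *\<^sub>C f (x k) (y l))"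
    by (simp only: cbilinear_simps(1,3)[OF f])
      (simp add: cbilinear_simps(2,4)[OF f] scaleC_scaleC cvec.scale_sum_right)
  also have "\<dots> = (\<Sum>k<n. \<Sum>c<n. \<Sum>l<n. (P k c * Q c l) *\<^sub>C f (x k) (y l))"
    by (rule sum.swap)
  also have "\<dots> = (\<Sum>k<n. \<Sum>l<n. \<Sum>c<n. (P k c * Q c l) *\<^sub>C f (x k) (y l))"
    by (intro sum.cong sum.swap refl)
  finally show ?thesis by (simp add: cvec.scale_sum_left)
qed

lemma sum_delta_scaleC: "k < (n::nat) \<Longrightarrow> (\<Sum>l<n. (if k = l then 1 else 0) *\<^sub>C z l) = z k"
proof -
  assume k: "k < n"
  have "(\<Sum>l<n. (if k = l then 1 else 0) *\<^sub>C z l) = (\<Sum>l<n. if l = k then z k else 0)"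
    by (rule sum.cong) (auto simp: scaleC_one)
  with k show ?thesis by simp
qed

text \<open>A matrix and its inverse cancel across the two arguments. For
  \<open>\<otimes>\<^sub>C\<close> this is why a change of basis respects the
  comultiplication.\<close>

lemma bilinear_contraction_inverse:
  fixes n :: nat
  assumes f: "cbilinear f"
    and inv: "\<And>k l. k < n \<Longrightarrow> l < n \<Longrightarrow> (\<Sum>c<n. P k c * Q c l) = (if k = l then 1 else 0)"
  shows "(\<Sum>c<n. f (\<Sum>k<n. P k c *\<^sub>C x k) (\<Sum>l<n. Q c l *\<^sub>C y l)) = (\<Sum>k<n. f (x k) (y k))"
  unfolding bilinear_contraction[OF f] by (intro sum.cong) (auto simp: inv sum_delta_scaleC)

lemma linear_contraction:
  "(\<Sum>a<n. c a *\<^sub>C (\<Sum>j<n. d j a *\<^sub>C y j)) = (\<Sum>j<n. (\<Sum>a<n. d j a * c a) *\<^sub>C y j)"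
proof -
  have "(\<Sum>a<n. c a *\<^sub>C (\<Sum>j<n. d j a *\<^sub>C y j)) = (\<Sum>a<n. \<Sum>j<n. (d j a * c a) *\<^sub>C y j)"
    by (simp add: cvec.scale_sum_right scaleC_scaleC mult.commute)
  also have "\<dots> = (\<Sum>j<n. \<Sum>a<n. (d j a * c a) *\<^sub>C y j)" by (rule sum.swap)
  finally show ?thesis by (simp add: cvec.scale_sum_left)
qed

text \<open>The matrix product A' w A; for inverse matrices it is \<open>w\<close> in the basis
  formed by the columns of \<open>A\<close>.\<close>

definition conjugate_matrix ::
    "nat \<Rightarrow> (nat \<Rightarrow> nat \<Rightarrow> complex) \<Rightarrow> (nat \<Rightarrow> nat \<Rightarrow> complex) \<Rightarrow> (nat \<Rightarrow> nat \<Rightarrow> 'h::complex_vector) \<Rightarrow> nat \<Rightarrow> nat \<Rightarrow> 'h"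
  where "conjugate_matrix n A A' w a b = (\<Sum>j<n. A j b *\<^sub>C (\<Sum>i<n. A' a i *\<^sub>C w i j))"

lemma conjugate_matrix_alt:
  "conjugate_matrix n A A' w a b = (\<Sum>i<n. A' a i *\<^sub>C (\<Sum>j<n. A j b *\<^sub>C w i j))"
proof -
  have "conjugate_matrix n A A' w a b = (\<Sum>j<n. \<Sum>i<n. A' a i *\<^sub>C (A j b *\<^sub>C w i j))"
    unfolding conjugate_matrix_def by (simp add: cvec.scale_sum_right scaleC_scaleC mult.commute)
  also have "\<dots> = (\<Sum>i<n. \<Sum>j<n. A' a i *\<^sub>C (A j b *\<^sub>C w i j))" by (rule sum.swap)
  finally show ?thesis by (simp add: cvec.scale_sum_right)
qed

lemma matrix_corepresentation_conjugate:
  assumes \<Delta>: "clinear \<Delta>" and \<epsilon>: "clinear \<epsilon>" and inv: "inverse_matrices n A A'"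
    and w: "matrix_corepresentation \<Delta> \<epsilon> n w"
  shows "matrix_corepresentation \<Delta> \<epsilon> n (conjugate_matrix n A A' w)"
  unfolding matrix_corepresentation_def
proof (intro allI impI conjI)
  fix a b assume ab: "a < n" "b < n"
  let ?y = "\<lambda>a j. \<Sum>i<n. A' a i *\<^sub>C w i j" and ?z = "\<lambda>i b. \<Sum>j<n. A j b *\<^sub>C w i j"
  have "\<Delta> (conjugate_matrix n A A' w a b)
      = (\<Sum>j<n. A j b *\<^sub>C (\<Sum>i<n. A' a i *\<^sub>C (\<Sum>k<n. w i k \<otimes>\<^sub>C w k j)))"
    using w unfolding conjugate_matrix_def matrix_corepresentation_def
    by (simp add: clinear_sum[OF \<Delta>] clinearD(2)[OF \<Delta>])
  also have "\<dots> = (\<Sum>j<n. A j b *\<^sub>C (\<Sum>k<n. ?y a k \<otimes>\<^sub>C w k j))"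
  proof -
    have "(\<Sum>i<n. A' a i *\<^sub>C (\<Sum>k<n. w i k \<otimes>\<^sub>C w k j)) = (\<Sum>k<n. ?y a k \<otimes>\<^sub>C w k j)" for j
    proof -
      have "(\<Sum>i<n. A' a i *\<^sub>C (\<Sum>k<n. w i k \<otimes>\<^sub>C w k j)) = (\<Sum>i<n. \<Sum>k<n. (A' a i *\<^sub>C w i k) \<otimes>\<^sub>C w k j)"
        by (simp add: cvec.scale_sum_right tensor_pure_bilinear)
      also have "\<dots> = (\<Sum>k<n. \<Sum>i<n. (A' a i *\<^sub>C w i k) \<otimes>\<^sub>C w k j)" by (rule sum.swap)
      finally show ?thesis by (simp add: tensor_sum)
    qed
    then show ?thesis by simp
  qed
  also have "\<dots> = (\<Sum>j<n. \<Sum>k<n. ?y a k \<otimes>\<^sub>C (A j b *\<^sub>C w k j))"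
    by (simp add: cvec.scale_sum_right tensor_pure_bilinear)
  also have "\<dots> = (\<Sum>k<n. ?y a k \<otimes>\<^sub>C ?z k b)"
    by (subst sum.swap) (simp add: tensor_sum)
  also have "\<dots> = (\<Sum>c<n. (\<Sum>k<n. A k c *\<^sub>C ?y a k) \<otimes>\<^sub>C (\<Sum>l<n. A' c l *\<^sub>C ?z l b))"
    by (rule bilinear_contraction_inverse[OF cbilinear_tensor, symmetric])
      (use inv in \<open>simp add: inverse_matrices_def\<close>)
  finally show "\<Delta> (conjugate_matrix n A A' w a b)
      = (\<Sum>c<n. conjugate_matrix n A A' w a c \<otimes>\<^sub>C conjugate_matrix n A A' w c b)"
    by (simp only: conjugate_matrix_def[of _ _ _ _ a] conjugate_matrix_alt[of _ _ _ _ _ b])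
  have "\<epsilon> (conjugate_matrix n A A' w a b)
      = (\<Sum>j<n. A j b * (\<Sum>i<n. A' a i * (if i = j then 1 else 0)))"
    using w unfolding conjugate_matrix_def matrix_corepresentation_def
    by (simp add: clinear_sum[OF \<epsilon>] clinearD(2)[OF \<epsilon>] scaleC_complex_def)
  also have "\<dots> = (\<Sum>j<n. A' a j * A j b)"
    by (intro sum.cong) (auto simp: if_distrib cong: if_cong)
  also have "\<dots> = (if a = b then 1 else 0)"
    using inv ab by (simp add: inverse_matrices_def)
  finally show "\<epsilon> (conjugate_matrix n A A' w a b) = (if a = b then 1 else 0)" .
qed

text \<open>Since A' = A* G and A A' = 1, one has A'* A' = G: an isometry for the form
  \<open>G\<close> becomes one for the standard form in a \<open>G\<close>-orthonormal basis. With G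
  the identity this covers unitary changes of basis.\<close>

lemma conjugate_matrix_isometric:
  fixes w :: "nat \<Rightarrow> nat \<Rightarrow> 'h::complex_star_algebra"
  assumes G: "\<And>i j. i < n \<Longrightarrow> j < n \<Longrightarrow> G j i = cnj (G i j)"
    and inv: "inverse_matrices n A A'"
    and A': "\<And>a i. i < n \<Longrightarrow> A' a i = (\<Sum>k<n. cnj (A k a) * G k i)"
    and w: "\<And>i j. i < n \<Longrightarrow> j < n \<Longrightarrow> (\<Sum>k<n. \<Sum>l<n. G k l *\<^sub>C (star (w k i) * w l j)) = G i j *\<^sub>C 1"
    and ab: "a < n" "b < n"
  defines "v \<equiv> conjugate_matrix n A A' w"
  shows "(\<Sum>c<n. star (v c a) * v c b) = (if a = b then 1 else 0)"
proof -
  let ?z = "\<lambda>i b. \<Sum>j<n. A j b *\<^sub>C w i j"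
  have gram: "(\<Sum>c<n. cnj (A' c i) * A' c k) = G i k" if ik: "i < n" "k < n" for i k
  proof -
    have "cnj (A' c i) = (\<Sum>m<n. G i m * A m c)" for c
      by (simp add: A' ik G[OF _ ik(1)] mult.commute)
    then have "(\<Sum>c<n. cnj (A' c i) * A' c k) = (\<Sum>c<n. \<Sum>m<n. G i m * (A m c * A' c k))"
      by (simp add: sum_distrib_right mult.assoc)
    also have "\<dots> = (\<Sum>m<n. G i m * (\<Sum>c<n. A m c * A' c k))"
      by (subst sum.swap) (simp add: sum_distrib_left)
    also have "\<dots> = (\<Sum>m<n. if m = k then G i k else 0)"
      using inv ik by (intro sum.cong) (auto simp: inverse_matrices_def)
    finally show ?thesis using ik by simp
  qed
  have "(\<Sum>c<n. star (v c a) * v c b)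
      = (\<Sum>c<n. (\<Sum>i<n. cnj (A' c i) *\<^sub>C star (?z i a)) * (\<Sum>k<n. A' c k *\<^sub>C ?z k b))"
    unfolding v_def conjugate_matrix_alt by (simp add: star_sum star_scaleC)
  also have "\<dots> = (\<Sum>i<n. \<Sum>k<n. G i k *\<^sub>C (star (?z i a) * ?z k b))"
    unfolding bilinear_contraction[OF cbilinear_times, where P = "\<lambda>i c. cnj (A' c i)"]
    by (intro sum.cong) (auto simp: gram)
  also have "\<dots> = (\<Sum>i<n. \<Sum>k<n. \<Sum>j<n. \<Sum>l<n. (cnj (A j a) * A l b) *\<^sub>C G i k *\<^sub>C (star (w i j) * w k l))"
    by (simp add: star_sum star_scaleC sum_product cvec.scale_sum_right mult_scaleC_left
        mult_scaleC_right scaleC_scaleC mult_ac)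
  also have "\<dots> = (\<Sum>j<n. \<Sum>l<n. \<Sum>i<n. \<Sum>k<n. (cnj (A j a) * A l b) *\<^sub>C G i k *\<^sub>C (star (w i j) * w k l))"
  proof -
    have "(\<Sum>i<n. \<Sum>k<n. \<Sum>j<n. \<Sum>l<n. F i k j l) = (\<Sum>j<n. \<Sum>l<n. \<Sum>i<n. \<Sum>k<n. F i k j l)"
      for F :: "nat \<Rightarrow> nat \<Rightarrow> nat \<Rightarrow> nat \<Rightarrow> 'h"
    proof -
      have "(\<Sum>i<n. \<Sum>k<n. \<Sum>j<n. \<Sum>l<n. F i k j l) = (\<Sum>i<n. \<Sum>j<n. \<Sum>k<n. \<Sum>l<n. F i k j l)"
        by (rule sum.cong[OF refl], rule sum.swap)
      also have "\<dots> = (\<Sum>j<n. \<Sum>i<n. \<Sum>k<n. \<Sum>l<n. F i k j l)" by (rule sum.swap)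
      also have "\<dots> = (\<Sum>j<n. \<Sum>i<n. \<Sum>l<n. \<Sum>k<n. F i k j l)"
        by (rule sum.cong[OF refl], rule sum.cong[OF refl], rule sum.swap)
      also have "\<dots> = (\<Sum>j<n. \<Sum>l<n. \<Sum>i<n. \<Sum>k<n. F i k j l)"
        by (rule sum.cong[OF refl], rule sum.swap)
      finally show ?thesis .
    qed
    then show ?thesis .
  qed
  also have "\<dots> = (\<Sum>j<n. \<Sum>l<n. (cnj (A j a) * A l b) *\<^sub>C G j l *\<^sub>C 1)"
    by (intro sum.cong refl) (simp only: cvec.scale_sum_right[symmetric] w lessThan_iff)
  also have "\<dots> = (\<Sum>l<n. (\<Sum>j<n. cnj (A j a) * G j l) * A l b) *\<^sub>C 1"
    by (subst sum.swap) (simp add: cvec.scale_sum_left scaleC_scaleC sum_distrib_left mult_ac)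
  also have "(\<Sum>l<n. (\<Sum>j<n. cnj (A j a) * G j l) * A l b) = (\<Sum>l<n. A' a l * A l b)"
    by (intro sum.cong) (auto simp: A')
  also have "\<dots> *\<^sub>C 1 = (if a = b then 1 else (0::'h))"
    using inv ab by (simp add: inverse_matrices_def scaleC_one)
  finally show ?thesis .
qed

section \<open>Frames of intertwiners\<close>

definition intertwines ::
    "('p::complex_vector \<Rightarrow> ('p, 'h::complex_vector) tensor) \<Rightarrow> nat \<Rightarrow> (nat \<Rightarrow> nat \<Rightarrow> 'h) \<Rightarrow> (nat \<Rightarrow> 'p) \<Rightarrow> bool"
  where "intertwines \<Delta>P n u t \<longleftrightarrow> (\<forall>i<n. \<Delta>P (t i) = (\<Sum>j<n. t j \<otimes>\<^sub>C u j i))"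

text \<open>A morphism out of the new basis is composed with the change of basis \<open>A'\<close>;
  the computation is A' w A A' = A' w.\<close>

lemma intertwines_conjugate:
  assumes \<Delta>P: "clinear \<Delta>P" and inv: "inverse_matrices n A A'"
    and t: "intertwines \<Delta>P n (conjugate_matrix n A A' w) t"
  shows "intertwines \<Delta>P n w (\<lambda>i. \<Sum>a<n. A' a i *\<^sub>C t a)"
  unfolding intertwines_def
proof (intro allI impI)
  fix i assume i: "i < n"
  let ?v = "conjugate_matrix n A A' w" and ?y = "\<lambda>a j. \<Sum>i<n. A' a i *\<^sub>C w i j"
  have y: "(\<Sum>a<n. A' a i *\<^sub>C ?v b a) = ?y b i" for b
    unfolding conjugate_matrix_def linear_contraction
    using inv i by (simp add: inverse_matrices_def sum_delta_scaleC[OF i] eq_commute[of _ i])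
  have "\<Delta>P (\<Sum>a<n. A' a i *\<^sub>C t a) = (\<Sum>a<n. \<Sum>b<n. t b \<otimes>\<^sub>C (A' a i *\<^sub>C ?v b a))"
    using t by (simp add: clinear_sum[OF \<Delta>P] clinearD(2)[OF \<Delta>P] intertwines_def
        cvec.scale_sum_right tensor_pure_bilinear)
  also have "\<dots> = (\<Sum>b<n. t b \<otimes>\<^sub>C ?y b i)"
    unfolding y[symmetric] tensor_sum by (rule sum.swap)
  also have "\<dots> = (\<Sum>b<n. \<Sum>j<n. (A' b j *\<^sub>C t b) \<otimes>\<^sub>C w j i)"
    by (simp add: tensor_sum tensor_pure_bilinear)
  also have "\<dots> = (\<Sum>j<n. (\<Sum>b<n. A' b j *\<^sub>C t b) \<otimes>\<^sub>C w j i)"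
    unfolding tensor_sum by (rule sum.swap)
  finally show "\<Delta>P (\<Sum>a<n. A' a i *\<^sub>C t a) = (\<Sum>j<n. (\<Sum>a<n. A' a j *\<^sub>C t a) \<otimes>\<^sub>C w j i)" .
qed

text \<open>The two factors transform by different matrices, the conjugate of \<open>A\<close> and
  the inverse \<open>A'\<close>. A frame thus becomes a dual pair in general, and stays a frame when
  \<open>A'\<close> is the adjoint of \<open>A\<close>.\<close>

lemma frame_conjugate:
  fixes T :: "nat \<Rightarrow> nat \<Rightarrow> 'p::complex_star_algebra"
  assumes inv: "inverse_matrices n A A'"
    and T: "\<And>a b. a < n \<Longrightarrow> b < n \<Longrightarrow> (\<Sum>k<d. star (T k a) * T k b) = (if a = b then 1 else 0)"
    and ij: "i < n" "j < n"
  shows "(\<Sum>k<d. star (\<Sum>a<n. cnj (A i a) *\<^sub>C T k a) * (\<Sum>b<n. A' b j *\<^sub>C T k b)) = (if i = j then 1 else 0)"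
proof -
  have "(\<Sum>k<d. star (\<Sum>a<n. cnj (A i a) *\<^sub>C T k a) * (\<Sum>b<n. A' b j *\<^sub>C T k b))
      = (\<Sum>k<d. \<Sum>a<n. \<Sum>b<n. (A i a * A' b j) *\<^sub>C (star (T k a) * T k b))"
    by (simp add: star_sum star_scaleC sum_product mult_scaleC_left mult_scaleC_right scaleC_scaleC mult_ac)
  also have "\<dots> = (\<Sum>a<n. \<Sum>k<d. \<Sum>b<n. (A i a * A' b j) *\<^sub>C (star (T k a) * T k b))"
    by (rule sum.swap)
  also have "\<dots> = (\<Sum>a<n. \<Sum>b<n. \<Sum>k<d. (A i a * A' b j) *\<^sub>C (star (T k a) * T k b))"
    by (intro sum.cong sum.swap refl)
  also have "\<dots> = (\<Sum>a<n. \<Sum>b<n. if b = a then (A i a * A' a j) *\<^sub>C 1 else 0)"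
    by (intro sum.cong refl) (auto simp: T simp flip: cvec.scale_sum_right)
  also have "\<dots> = (\<Sum>a<n. A i a * A' a j) *\<^sub>C 1"
    by (simp add: cvec.scale_sum_left)
  finally show ?thesis using inv ij by (simp add: inverse_matrices_def scaleC_one)
qed

lemma matrix_inverse_unique:
  fixes a b c :: "nat \<Rightarrow> nat \<Rightarrow> 'h::ring_1"
  assumes ab: "\<And>i j. i < n \<Longrightarrow> j < n \<Longrightarrow> (\<Sum>k<n. a i k * b k j) = (if i = j then 1 else 0)"
    and bc: "\<And>i j. i < n \<Longrightarrow> j < n \<Longrightarrow> (\<Sum>k<n. b i k * c k j) = (if i = j then 1 else 0)"
    and ij: "i < n" "j < n"
  shows "a i j = c i j"
proof -
  have "(\<Sum>k<n. a i k * (\<Sum>l<n. b k l * c l j)) = (\<Sum>k<n. if k = j then a i j else 0)"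
    by (intro sum.cong) (auto simp: bc ij)
  then have "a i j = (\<Sum>k<n. a i k * (\<Sum>l<n. b k l * c l j))" using ij by simp
  also have "\<dots> = (\<Sum>k<n. \<Sum>l<n. a i k * b k l * c l j)"
    by (simp add: sum_distrib_left mult.assoc)
  also have "\<dots> = (\<Sum>l<n. (\<Sum>k<n. a i k * b k l) * c l j)"
    by (subst sum.swap) (simp add: sum_distrib_right)
  also have "\<dots> = (\<Sum>l<n. if l = i then c i j else 0)"
    by (intro sum.cong) (auto simp: ab ij)
  finally show ?thesis using ij by simp
qed

section \<open>Existence of frames\<close>

lemma antipode_matrix_inverse:
  fixes \<Delta> :: "'h::complex_star_algebra \<Rightarrow> ('h, 'h) tensor"
  assumes hopf: "hopf_star_algebra \<Delta> \<epsilon> S" and u: "matrix_corepresentation \<Delta> \<epsilon> n u"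
    and ij: "i < n" "j < n"
  shows "(\<Sum>k<n. S (u i k) * u k j) = (if i = j then 1 else 0)"
    and "(\<Sum>k<n. u i k * S (u k j)) = (if i = j then 1 else 0)"
proof -
  have S: "clinear S" and id: "clinear (id :: 'h \<Rightarrow> 'h)"
    and inv: "tensor_lift (*) (tensor_map S id (\<Delta> h)) = \<epsilon> h *\<^sub>C 1"
      "tensor_lift (*) (tensor_map id S (\<Delta> h)) = \<epsilon> h *\<^sub>C 1" for h
    using hopf by (auto simp: hopf_star_algebra_def clinear_iff)
  have u: "\<Delta> (u i j) = (\<Sum>k<n. u i k \<otimes>\<^sub>C u k j)" "\<epsilon> (u i j) = (if i = j then 1 else 0)"
    using u ij by (auto simp: matrix_corepresentation_def)
  note mult = tensor_lift[OF cbilinear_times[where 'a = 'h]]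
  show "(\<Sum>k<n. S (u i k) * u k j) = (if i = j then 1 else 0)"
    using inv(1)[of "u i j"]
    by (simp add: u clinear_sum[OF tensor_map(1)[OF S id]] clinear_sum[OF mult(1)]
        tensor_map(2)[OF S id] mult(2) scaleC_one split: if_splits)
  show "(\<Sum>k<n. u i k * S (u k j)) = (if i = j then 1 else 0)"
    using inv(2)[of "u i j"]
    by (simp add: u clinear_sum[OF tensor_map(1)[OF id S]] clinear_sum[OF mult(1)]
        tensor_map(2)[OF id S] mult(2) scaleC_one split: if_splits)
qed

text \<open>The matrix of the \<open>S (u i j)\<close> is a two-sided inverse of \<open>u\<close>,
  so a one-sided inverse formed by adjoints coincides with it. In particular an isometric
  corepresentation is unitary.\<close>

lemma antipode_eq_star:
  fixes \<Delta> :: "'h::complex_star_algebra \<Rightarrow> ('h, 'h) tensor"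
  assumes hopf: "hopf_star_algebra \<Delta> \<epsilon> S" and u: "matrix_corepresentation \<Delta> \<epsilon> n u"
    and one_sided: "(\<forall>i<n. \<forall>j<n. (\<Sum>k<n. star (u k i) * u k j) = (if i = j then 1 else 0))
      \<or> (\<forall>i<n. \<forall>j<n. (\<Sum>k<n. u i k * star (u j k)) = (if i = j then 1 else 0))"
    and ij: "i < n" "j < n"
  shows "S (u i j) = star (u j i)"
  using one_sided
proof
  assume *: "\<forall>i<n. \<forall>j<n. (\<Sum>k<n. star (u k i) * u k j) = (if i = j then 1 else 0)"
  show ?thesis
    by (rule matrix_inverse_unique[of n "\<lambda>i j. star (u j i)" u "\<lambda>i j. S (u i j)", symmetric])
      (use * in blast, rule antipode_matrix_inverse(2)[OF hopf u], assumption+, use ij in simp_all)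
next
  assume *: "\<forall>i<n. \<forall>j<n. (\<Sum>k<n. u i k * star (u j k)) = (if i = j then 1 else 0)"
  show ?thesis
    by (rule matrix_inverse_unique[of n "\<lambda>i j. S (u i j)" u "\<lambda>i j. star (u j i)"])
      (rule antipode_matrix_inverse(1)[OF hopf u], assumption+, use * in blast, use ij in simp_all)
qed

lemma unitary_matrix_of_one_sided:
  fixes \<Delta> :: "'h::complex_star_algebra \<Rightarrow> ('h, 'h) tensor"
  assumes hopf: "hopf_star_algebra \<Delta> \<epsilon> S" and u: "matrix_corepresentation \<Delta> \<epsilon> n u"
    and one_sided: "(\<forall>i<n. \<forall>j<n. (\<Sum>k<n. star (u k i) * u k j) = (if i = j then 1 else 0))
      \<or> (\<forall>i<n. \<forall>j<n. (\<Sum>k<n. u i k * star (u j k)) = (if i = j then 1 else 0))"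
  shows "unitary_matrix n u"
  unfolding unitary_matrix_def
proof (intro allI impI conjI)
  fix i j assume ij: "i < n" "j < n"
  note S = antipode_eq_star[OF hopf u one_sided]
  show "(\<Sum>k<n. star (u k i) * u k j) = (if i = j then 1 else 0)"
    using antipode_matrix_inverse(1)[OF hopf u ij] ij(1) by (simp add: S)
  show "(\<Sum>k<n. u i k * star (u j k)) = (if i = j then 1 else 0)"
    using antipode_matrix_inverse(2)[OF hopf u ij] ij(2) by (simp add: S)
qed

section \<open>Slices, block decompositions and reducible matrices\<close>

lemma cbilinear_scaleC:
  assumes "clinear \<phi>"
  shows "cbilinear (\<lambda>v h :: 'b::complex_vector. \<phi> v *\<^sub>C h)"
  by (auto simp: cbilinear_def clinear_iff clinearD[OF assms] scaleC_add_left scaleC_add_right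
      scaleC_scaleC scaleC_complex_def mult.commute)

definition tensor_slice :: "('v::complex_vector \<Rightarrow> complex) \<Rightarrow> ('v, 'h::complex_vector) tensor \<Rightarrow> 'h"
  where "tensor_slice \<phi> = tensor_lift (\<lambda>v h. \<phi> v *\<^sub>C h)"

lemma tensor_slice:
  assumes "clinear \<phi>"
  shows "clinear (tensor_slice \<phi>)" "tensor_slice \<phi> (v \<otimes>\<^sub>C h) = \<phi> v *\<^sub>C h"
  unfolding tensor_slice_def by (rule tensor_lift[OF cbilinear_scaleC[OF assms]])+

lemma tensor_zero: "0 \<otimes>\<^sub>C b = 0" "a \<otimes>\<^sub>C 0 = 0"
  using tensor_pure_bilinear(3)[of 0 0 b] tensor_pure_bilinear(4)[of a 0 0] by simp_all

lemma sum_lessThan_add: "(\<Sum>k<p+q. f k) = (\<Sum>k<p. f k) + (\<Sum>k<q. f (p + k))"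
  for f :: "nat \<Rightarrow> 'a::comm_monoid_add"
  by (induction q) (simp_all add: add.assoc)

definition left_frame ::
    "('p::complex_star_algebra \<Rightarrow> ('p, 'h::complex_vector) tensor) \<Rightarrow> nat \<Rightarrow> (nat \<Rightarrow> nat \<Rightarrow> 'h)
      \<Rightarrow> nat \<Rightarrow> (nat \<Rightarrow> nat \<Rightarrow> 'p) \<Rightarrow> bool"
  where "left_frame \<Delta>P n u d T \<longleftrightarrow> (\<forall>k<d. intertwines \<Delta>P n u (T k))
    \<and> (\<forall>i<n. \<forall>j<n. (\<Sum>k<d. star (T k i) * T k j) = (if i = j then 1 else 0))"

text \<open>The frames of the two blocks are extended by zero and put one after the other, so that
  products mixing the blocks vanish.\<close>

lemma left_frame_block_diagonal:
  assumes \<Delta>P: "clinear \<Delta>P"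
    and zero: "\<And>a b. a < p \<Longrightarrow> b < q \<Longrightarrow> v a (p + b) = 0 \<and> v (p + b) a = 0"
    and T: "left_frame \<Delta>P p v d T" and T': "left_frame \<Delta>P q (\<lambda>i j. v (p + i) (p + j)) d' T'"
  shows "left_frame \<Delta>P (p + q) v (d + d') (\<lambda>k a. if k < d then if a < p then T k a else 0
    else if a < p then 0 else T' (k - d) (a - p))" (is "left_frame _ _ _ _ ?F")
  unfolding left_frame_def
proof (intro conjI allI impI)
  fix k assume k: "k < d + d'"
  show "intertwines \<Delta>P (p + q) v (?F k)"
    unfolding intertwines_def
  proof (intro allI impI)
    fix a assume a: "a < p + q"
    show "\<Delta>P (?F k a) = (\<Sum>j<p+q. ?F k j \<otimes>\<^sub>C v j a)"
    proof (cases "a < p")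
      case True
      then show ?thesis
        using T k zero by (auto simp: sum_lessThan_add tensor_zero clinearD(3)[OF \<Delta>P] left_frame_def intertwines_def)
    next
      case False
      then obtain b where b: "a = p + b" "b < q"
        using a by (metis add_less_cancel_left le_iff_add not_less)
      then show ?thesis
        using T' k zero by (auto simp: sum_lessThan_add tensor_zero clinearD(3)[OF \<Delta>P] left_frame_def intertwines_def)
    qed
  qed
next
  fix i j assume ij: "i < p + q" "j < p + q"
  have off: "i - p < q" if "\<not> i < p" "i < p + q" for i using that by linarith
  show "(\<Sum>k<d+d'. star (?F k i) * ?F k j) = (if i = j then 1 else 0)"
    using T T' off[OF _ ij(1)] off[OF _ ij(2)] unfolding sum_lessThan_add
    by (cases "i < p"; cases "j < p") (auto simp: left_frame_def star_zero)
qed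

lemma block_diagonal_corepresentation:
  assumes v: "matrix_corepresentation \<Delta> \<epsilon> (p + q) v" "unitary_matrix (p + q) v"
    and zero: "\<And>a b. a < p \<Longrightarrow> b < q \<Longrightarrow> v a (p + b) = 0 \<and> v (p + b) a = 0"
  shows "matrix_corepresentation \<Delta> \<epsilon> p v" "unitary_matrix p v"
    "matrix_corepresentation \<Delta> \<epsilon> q (\<lambda>i j. v (p + i) (p + j))"
    "unitary_matrix q (\<lambda>i j. v (p + i) (p + j))"
proof -
  have low: "(\<Sum>k<p+q. f k) = (\<Sum>k<p. f k)" if "\<And>k. k < q \<Longrightarrow> f (p + k) = 0"
    for f :: "nat \<Rightarrow> 'b::comm_monoid_add"
    unfolding sum_lessThan_add using that by simp
  have high: "(\<Sum>k<p+q. f k) = (\<Sum>k<q. f (p + k))" if "\<And>k. k < p \<Longrightarrow> f k = 0"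
    for f :: "nat \<Rightarrow> 'b::comm_monoid_add"
    unfolding sum_lessThan_add using that by simp
  have v': "\<Delta> (v i j) = (\<Sum>k<p+q. v i k \<otimes>\<^sub>C v k j)" "\<epsilon> (v i j) = (if i = j then 1 else 0)"
    "(\<Sum>k<p+q. star (v k i) * v k j) = (if i = j then 1 else 0)"
    "(\<Sum>k<p+q. v i k * star (v j k)) = (if i = j then 1 else 0)"
    if "i < p + q" "j < p + q" for i j
    using v that by (simp_all add: matrix_corepresentation_def unitary_matrix_def)
  have "\<Delta> (v i j) = (\<Sum>k<p. v i k \<otimes>\<^sub>C v k j)" "\<epsilon> (v i j) = (if i = j then 1 else 0)"
    "(\<Sum>k<p. star (v k i) * v k j) = (if i = j then 1 else 0)"
    "(\<Sum>k<p. v i k * star (v j k)) = (if i = j then 1 else 0)"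
    if "i < p" "j < p" for i j
    using v'[of i j] that by (auto simp: low zero tensor_zero star_zero)
  then show "matrix_corepresentation \<Delta> \<epsilon> p v" "unitary_matrix p v"
    by (simp_all add: matrix_corepresentation_def unitary_matrix_def)
  have "\<Delta> (v (p + i) (p + j)) = (\<Sum>k<q. v (p + i) (p + k) \<otimes>\<^sub>C v (p + k) (p + j))"
    "\<epsilon> (v (p + i) (p + j)) = (if i = j then 1 else 0)"
    "(\<Sum>k<q. star (v (p + k) (p + i)) * v (p + k) (p + j)) = (if i = j then 1 else 0)"
    "(\<Sum>k<q. v (p + i) (p + k) * star (v (p + j) (p + k))) = (if i = j then 1 else 0)"
    if "i < q" "j < q" for i j
    using v'[of "p + i" "p + j"] that by (auto simp: high zero tensor_zero star_zero)
  then show "matrix_corepresentation \<Delta> \<epsilon> q (\<lambda>i j. v (p + i) (p + j))"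
    "unitary_matrix q (\<lambda>i j. v (p + i) (p + j))"
    by (simp_all add: matrix_corepresentation_def unitary_matrix_def)
qed

lemma coord_form_identity:
  "coord_form n (\<lambda>i j. if i = j then 1 else 0) x y = (\<Sum>i<n. cnj (x i) * y i)"
  unfolding coord_form_def
proof (intro sum.cong refl)
  fix i assume "i \<in> {..<n}"
  then show "(\<Sum>j<n. cnj (x i) * (if i = j then 1 else 0) * y j) = cnj (x i) * y i"
    by (subst sum.remove[of _ i]) auto
qed

lemma coord_form_identity_pos:
  assumes "\<exists>i<n. c i \<noteq> 0"
  shows "0 < Re (coord_form n (\<lambda>i j. if i = j then 1 else 0) c c)"
proof -
  from assms obtain i where i: "i < n" "c i \<noteq> 0" by blast
  have "0 < (\<Sum>i<n. (cmod (c i))\<^sup>2)"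
    by (rule sum_pos2[of _ i]) (use i in auto)
  moreover have "cnj (c i) * c i = complex_of_real ((cmod (c i))\<^sup>2)" for i
    unfolding complex_norm_square by (rule mult.commute)
  ultimately show ?thesis unfolding coord_form_identity by simp
qed

text \<open>An orthonormal basis of a proper nonzero invariant subspace is extended to the whole
  space. The entry (a, b) is the coaction on \<open>f' b\<close> sliced by the inner product with
  \<open>f' a\<close>; for \<open>f' b\<close> in the subspace and \<open>f' a\<close> orthogonal to
  it, invariance makes it vanish.\<close>

lemma reducible_block_triangular:
  fixes u :: "nat \<Rightarrow> nat \<Rightarrow> 'h::complex_star_algebra"
  assumes n: "0 < n" and red: "\<not> irreducible_matrix n u"
  obtains p A A' where "0 < p" "p < n" "inverse_matrices n A A'"
    "\<And>a i. i < n \<Longrightarrow> A' a i = cnj (A i a)"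
    "\<And>a b. p \<le> a \<Longrightarrow> a < n \<Longrightarrow> b < p \<Longrightarrow> conjugate_matrix n A A' u a b = 0"
proof -
  let ?C = "coordinate_space n" and ?\<delta> = "\<lambda>i j::nat. if i = j then 1 else (0::complex)"
  have herm: "?\<delta> j i = cnj (?\<delta> i j)" for i j by auto
  interpret hermitian_form "coord_form n ?\<delta>" by (rule hermitian_coord_form) (rule herm)
  from n red obtain W where W: "cvec.subspace W" "W \<subseteq> ?C" "W \<noteq> {0}" "W \<noteq> ?C"
    and inv: "\<And>w. w \<in> W \<Longrightarrow> matrix_coaction n u w \<in> cvec.span {v \<otimes>\<^sub>C h | v h. v \<in> W}"
    unfolding irreducible_matrix_def by blast
  have pos: "0 < Re (coord_form n ?\<delta> x x)" if x: "x \<in> W" "x \<noteq> 0" for x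
  proof (rule coord_form_identity_pos)
    from x(2) obtain i where "x i \<noteq> 0" by (auto simp: fun_eq_iff)
    moreover have "x \<in> ?C" using x(1) W(2) by blast
    then have "i < n" using \<open>x i \<noteq> 0\<close> unfolding coordinate_space_def by (metis (mono_tags) mem_Collect_eq not_less)
    ultimately show "\<exists>i<n. x i \<noteq> 0" by blast
  qed
  have "W \<subseteq> cvec.span (unit_vector ` {..<n})" using W(2) coordinate_space_span by blast
  \<comment> \<open>The process starts from the empty family; \<open>unit_vector\<close> is a
    dummy.\<close>
  from orthonormal_extend[OF W(1) pos _ this, of 0 unit_vector]
  obtain p f where f: "\<forall>i<p. f i \<in> W" "orthonormal p f" "cvec.span (f ` {..<p}) = W"
    by (auto simp: orthonormal_def)
  have f_C: "\<forall>i<p. f i \<in> ?C" using f(1) W(2) by blast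
  obtain f' where f': "p \<le> n" "\<forall>i<p. f' i = f i" "orthonormal n f'" "cvec.span (f' ` {..<n}) = ?C"
    "inverse_matrices n (\<lambda>i a. f' a i) (\<lambda>a i. coord_form n ?\<delta> (f' a) (unit_vector i))"
    by (rule coord_form_basis[where G = ?\<delta>, OF herm coord_form_identity_pos f(2) f_C]) (assumption, rule that)
  have W_eq: "cvec.span (f' ` {..<p}) = W"
    unfolding f(3)[symmetric] using f'(2) by (intro arg_cong[where f = cvec.span]) auto
  have "p \<noteq> n" using W_eq f'(4) W(4) by auto
  then have pn: "p < n" using f'(1) by simp
  have p0: "0 < p" using W_eq W(3) by (cases p) auto
  have adj: "coord_form n ?\<delta> (f' a) (unit_vector i) = cnj (f' a i)" if "i < n" for a i
  proof -
    have "coord_form n ?\<delta> (f' a) (unit_vector i) = (\<Sum>j<n. if j = i then cnj (f' a i) else 0)"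
      unfolding coord_form_identity by (intro sum.cong) (auto simp: unit_vector_def)
    with that show ?thesis by simp
  qed
  have tri: "conjugate_matrix n (\<lambda>i a. f' a i) (\<lambda>a i. coord_form n ?\<delta> (f' a) (unit_vector i)) u a b = 0"
    if ab: "p \<le> a" "a < n" "b < p" for a b
  proof -
    let ?\<phi> = "coord_form n ?\<delta> (f' a)"
    have "clinear ?\<phi>"
      by (rule clinearI) (simp_all add: add_right scale_right scaleC_complex_def)
    note L = tensor_slice[OF this]
    have "tensor_slice ?\<phi> z = 0"
      if "z \<in> cvec.span {v \<otimes>\<^sub>C h | v h. v \<in> W}" for z
      using that
    proof (induction rule: cvec.span_induct_alt)
      case (step c x y)
      then obtain v h where "x = v \<otimes>\<^sub>C h" "v \<in> W" by auto
      moreover from this have "?\<phi> v = 0"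
        using ab W_eq by (intro orthonormal_vanish[OF f'(3), of a "{..<p}"]) auto
      ultimately show ?case using step(2) by (simp add: clinearD[OF L(1)] L(2))
    qed (simp add: clinearD[OF L(1)])
    moreover have "f' b \<in> W" using f f'(2) ab(3) by auto
    ultimately have "tensor_slice ?\<phi> (matrix_coaction n u (f' b)) = 0"
      using inv by blast
    then show ?thesis
      unfolding matrix_coaction_def conjugate_matrix_alt unit_vector_def[symmetric]
      by (simp add: clinear_sum[OF L(1)] L(2) cvec.scale_sum_right)
  qed
  show ?thesis by (rule that[OF p0 pn f'(5) adj tri])
qed

section \<open>Frames over a quantum principal bundle\<close>

locale bundle_frames =
  fixes \<Delta> :: "'h::complex_star_algebra \<Rightarrow> ('h, 'h) tensor" and \<epsilon> :: "'h \<Rightarrow> complex" and S :: "'h \<Rightarrow> 'h"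
    and \<Delta>P :: "'p::complex_star_algebra \<Rightarrow> ('p, 'h) tensor"
  assumes hopf: "hopf_star_algebra \<Delta> \<epsilon> S"
    and unitarizable: "corepresentations_unitarizable \<Delta> \<epsilon>"
    and frames: "admits_left_frames \<Delta> \<epsilon> \<Delta>P"
    and \<Delta>P: "star_hom \<Delta>P"
begin

lemma linear: "clinear \<Delta>" "clinear \<epsilon>" "clinear S" "clinear \<Delta>P"
  using hopf \<Delta>P by (auto simp: hopf_star_algebra_def star_hom_def)

lemma left_frame_conjugate:
  assumes "inverse_matrices n A A'" "\<And>a i. i < n \<Longrightarrow> A' a i = cnj (A i a)"
    and T: "left_frame \<Delta>P n (conjugate_matrix n A A' u) d T"
  shows "left_frame \<Delta>P n u d (\<lambda>k i. \<Sum>a<n. A' a i *\<^sub>C T k a)"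
  unfolding left_frame_def
proof (intro conjI allI impI)
  fix k assume "k < d"
  then show "intertwines \<Delta>P n u (\<lambda>i. \<Sum>a<n. A' a i *\<^sub>C T k a)"
    using T by (intro intertwines_conjugate[OF linear(4) assms(1)]) (auto simp: left_frame_def)
next
  fix i j assume ij: "i < n" "j < n"
  have "(\<Sum>k<d. star (\<Sum>a<n. cnj (A i a) *\<^sub>C T k a) * (\<Sum>b<n. A' b j *\<^sub>C T k b)) = (if i = j then 1 else 0)"
    using T by (intro frame_conjugate[OF assms(1) _ ij]) (auto simp: left_frame_def)
  then show "(\<Sum>k<d. star (\<Sum>a<n. A' a i *\<^sub>C T k a) * (\<Sum>b<n. A' b j *\<^sub>C T k b)) = (if i = j then 1 else 0)"
    by (simp add: assms(2) ij)
qed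

text \<open>Complete reducibility: unitarity and the antipode turn the block triangular form of a
  reducible matrix into a block diagonal one.\<close>

lemma left_frame_exists:
  "matrix_corepresentation \<Delta> \<epsilon> n u \<Longrightarrow> unitary_matrix n u \<Longrightarrow> \<exists>d T. left_frame \<Delta>P n u d T"
proof (induction n arbitrary: u rule: less_induct)
  case (less n)
  consider "n = 0" | "irreducible_matrix n u" | "0 < n" "\<not> irreducible_matrix n u" by blast
  then show ?case
  proof cases
    case 1
    then show ?thesis by (auto simp: left_frame_def)
  next
    case 2
    with less.prems frames show ?thesis
      unfolding admits_left_frames_def left_frame_def intertwines_def by blast
  next
    case 3
    obtain p A A' where p: "0 < p" "p < n" and inv: "inverse_matrices n A A'"
      and A': "\<And>a i. i < n \<Longrightarrow> A' a i = cnj (A i a)"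
      and zero: "\<And>a b. p \<le> a \<Longrightarrow> a < n \<Longrightarrow> b < p \<Longrightarrow> conjugate_matrix n A A' u a b = 0"
      by (rule reducible_block_triangular[OF 3]) (rule that)
    define v where "v = conjugate_matrix n A A' u"
    define q where "q = n - p"
    have n: "n = p + q" and q: "q < n" using p by (auto simp: q_def)
    have v: "matrix_corepresentation \<Delta> \<epsilon> n v"
      unfolding v_def by (rule matrix_corepresentation_conjugate[OF linear(1,2) inv less.prems(1)])
    have "(\<Sum>c<n. star (v c a) * v c b) = (if a = b then 1 else 0)" if ab: "a < n" "b < n" for a b
      unfolding v_def
    proof (rule conjugate_matrix_isometric[OF _ inv _ _ ab, of "\<lambda>i j. if i = j then 1 else 0"])
      show "A' a i = (\<Sum>k<n. cnj (A k a) * (if k = i then 1 else 0))" if "i < n" for a i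
      proof -
        have "(\<Sum>k<n. cnj (A k a) * (if k = i then 1 else 0)) = (\<Sum>k<n. if k = i then cnj (A i a) else 0)"
          by (intro sum.cong) auto
        with that show ?thesis by (simp add: A')
      qed
      show "(\<Sum>k<n. \<Sum>l<n. (if k = l then 1 else 0) *\<^sub>C (star (u k i) * u l j)) = (if i = j then 1 else 0) *\<^sub>C 1"
        if "i < n" "j < n" for i j
      proof -
        have "(\<Sum>k<n. \<Sum>l<n. (if k = l then 1 else 0) *\<^sub>C (star (u k i) * u l j)) = (\<Sum>k<n. star (u k i) * u k j)"
          by (intro sum.cong refl sum_delta_scaleC) simp
        then show ?thesis using less.prems(2) that by (simp add: unitary_matrix_def scaleC_one)
      qed
    qed auto
    then have one_sided: "(\<forall>i<n. \<forall>j<n. (\<Sum>k<n. star (v k i) * v k j) = (if i = j then 1 else 0))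
      \<or> (\<forall>i<n. \<forall>j<n. (\<Sum>k<n. v i k * star (v j k)) = (if i = j then 1 else 0))" by blast
    \<comment> \<open>The lower left block is zero by the choice of basis, and the linear map
      \<open>S\<close> sends its entries to the adjoints of those of the upper right block.\<close>
    have zero': "v a (p + b) = 0 \<and> v (p + b) a = 0" if ab: "a < p" "b < q" for a b
    proof -
      have low: "v (p + b) a = 0" unfolding v_def using ab n by (intro zero) auto
      have "star (v a (p + b)) = S (v (p + b) a)"
        using ab n by (intro antipode_eq_star[OF hopf v one_sided, symmetric]) auto
      also have "\<dots> = 0" using low clinearD(3)[OF linear(3)] by simp
      finally have "v a (p + b) = 0" by (metis star_star star_zero)
      with low show ?thesis by simp
    qed
    note blocks = block_diagonal_corepresentation[OF v[unfolded n]
        unitary_matrix_of_one_sided[OF hopf v one_sided, unfolded n] zero']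
    from less.IH[OF p(2) blocks(1,2)] less.IH[OF q blocks(3,4)]
    obtain d T d' T' where "left_frame \<Delta>P p v d T" "left_frame \<Delta>P q (\<lambda>i j. v (p + i) (p + j)) d' T'"
      by blast
    from left_frame_block_diagonal[OF linear(4) zero' this]
    obtain d T where "left_frame \<Delta>P n v d T" unfolding n[symmetric] by blast
    then have "left_frame \<Delta>P n (conjugate_matrix n A A' u) d T" by (simp add: v_def)
    from left_frame_conjugate[OF inv A' this] show ?thesis by blast
  qed
qed

text \<open>A basis orthonormal for the invariant form \<open>G\<close> makes \<open>w\<close>
  unitary, and the left frame found there is pulled back. In the original basis it splits into
  intertwiners \<open>X\<close> and a dual family \<open>Z\<close>, for which no intertwining is
  claimed.\<close>

lemma dual_left_frame_exists:
  assumes w: "matrix_corepresentation \<Delta> \<epsilon> n w"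
  obtains d :: nat and X Z where "\<And>k. k < d \<Longrightarrow> intertwines \<Delta>P n w (X k)"
    "\<And>i j. i < n \<Longrightarrow> j < n \<Longrightarrow> (\<Sum>k<d. star (Z k i) * X k j) = (if i = j then 1 else 0)"
proof -
  from unitarizable w obtain G where
    G: "\<forall>i<n. \<forall>j<n. G j i = cnj (G i j)"
    and pos: "\<forall>c. (\<exists>i<n. c i \<noteq> 0) \<longrightarrow> 0 < Re (coord_form n G c c)"
    and isom: "\<forall>i<n. \<forall>j<n. (\<Sum>k<n. \<Sum>l<n. G k l *\<^sub>C (star (w k i) * w l j)) = G i j *\<^sub>C 1"
    unfolding corepresentations_unitarizable_def coord_form_def[symmetric] by blast
  note G = G[rule_format] and pos = pos[rule_format] and isom = isom[rule_format]
  interpret hermitian_form "coord_form n G" by (rule hermitian_coord_form) (rule G)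
  obtain f where f: "inverse_matrices n (\<lambda>i a. f a i) (\<lambda>a i. coord_form n G (f a) (unit_vector i))"
    by (rule coord_form_basis[OF G pos, of 0 unit_vector]) (simp_all add: orthonormal_def)
  define A A' where "A = (\<lambda>i a. f a i)" and "A' = (\<lambda>a i. coord_form n G (f a) (unit_vector i))"
  have inv: "inverse_matrices n A A'" using f by (simp add: A_def A'_def)
  have A': "A' a i = (\<Sum>k<n. cnj (A k a) * G k i)" if "i < n" for a i
    unfolding A_def A'_def by (rule coord_form_unit_vector[OF that])
  define v where "v = conjugate_matrix n A A' w"
  have v: "matrix_corepresentation \<Delta> \<epsilon> n v"
    unfolding v_def by (rule matrix_corepresentation_conjugate[OF linear(1,2) inv w])
  have "(\<Sum>c<n. star (v c a) * v c b) = (if a = b then 1 else 0)" if ab: "a < n" "b < n" for a b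
    unfolding v_def by (rule conjugate_matrix_isometric[OF G inv A' isom ab])
  then have "unitary_matrix n v" by (intro unitary_matrix_of_one_sided[OF hopf v]) blast
  from left_frame_exists[OF v this] obtain d T where T: "left_frame \<Delta>P n v d T" by blast
  show ?thesis
  proof
    show "intertwines \<Delta>P n w (\<lambda>i. \<Sum>a<n. A' a i *\<^sub>C T k a)" if "k < d" for k
      using T that by (intro intertwines_conjugate[OF linear(4) inv]) (auto simp: left_frame_def v_def)
    show "(\<Sum>k<d. star (\<Sum>a<n. cnj (A i a) *\<^sub>C T k a) * (\<Sum>a<n. A' a j *\<^sub>C T k a)) = (if i = j then 1 else 0)"
      if "i < n" "j < n" for i j
      using T by (intro frame_conjugate[OF inv _ that]) (auto simp: left_frame_def)
  qed
qed

text \<open>The involution of the tensor square acts on each leg without exchanging them, so the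
  conjugate has its entries starred and not transposed.\<close>

lemma matrix_corepresentation_star:
  assumes "matrix_corepresentation \<Delta> \<epsilon> n u"
  shows "matrix_corepresentation \<Delta> \<epsilon> n (\<lambda>i j. star (u i j))"
proof -
  have "\<Delta> (star x) = star (\<Delta> x)" "\<epsilon> (star x) = cnj (\<epsilon> x)" for x
    using hopf by (simp_all add: hopf_star_algebra_def star_hom_def star_complex_def)
  then show ?thesis
    using assms by (auto simp: matrix_corepresentation_def star_sum star_tensor_pure)
qed

text \<open>This is what turns a left frame of the conjugate into a right frame of
  \<open>u\<close>.\<close>

lemma intertwines_star:
  "intertwines \<Delta>P n (\<lambda>i j. star (u i j)) t \<Longrightarrow> intertwines \<Delta>P n u (\<lambda>i. star (t i))"
  using \<Delta>P by (simp add: intertwines_def star_hom_def star_sum star_tensor_pure star_star)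

text \<open>The assumption that the right Hermitian structure takes values in \<open>B\<close> forces the
  conjugate corepresentation to be unitary: even for a nonunitary conjugate, intertwiners have dual
  frames, and these cancel all intertwiners from the invariance of the inner products.\<close>

lemma conjugate_unitary:
  assumes u: "matrix_corepresentation \<Delta> \<epsilon> n u" "unitary_matrix n u"
    and invariant: "\<And>s t. intertwines \<Delta>P n u s \<Longrightarrow> intertwines \<Delta>P n u t \<Longrightarrow>
      \<Delta>P (\<Sum>k<n. star (s k) * t k) = (\<Sum>k<n. star (s k) * t k) \<otimes>\<^sub>C 1"
  shows "unitary_matrix n (\<lambda>i j. star (u i j))"
proof -
  \<comment> \<open>The defect of unitarity of the conjugate. Invariance of the sum of the products
    \<open>X k i * T k' i\<close> says that the terms with \<open>D\<close> in the second leg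
    cancel.\<close>
  define D where "D l m = (\<Sum>i<n. star (u l i) * u m i) - (if l = m then 1 else 0)" for l m
  note u' = matrix_corepresentation_star[OF u(1)]
  obtain d :: nat and X Z where X: "\<And>k. k < d \<Longrightarrow> intertwines \<Delta>P n (\<lambda>i j. star (u i j)) (X k)"
    and ZX: "\<And>i j. i < n \<Longrightarrow> j < n \<Longrightarrow> (\<Sum>k<d. star (Z k i) * X k j) = (if i = j then 1 else 0)"
    using dual_left_frame_exists[OF u'] by blast
  obtain d' T where T: "left_frame \<Delta>P n u d' T" using left_frame_exists[OF u] by blast
  have mult: "(p \<otimes>\<^sub>C 1) * (\<Sum>m<n. t m \<otimes>\<^sub>C D l m) = (\<Sum>m<n. (p * t m) \<otimes>\<^sub>C D l m)" for p t l
    by (simp add: sum_distrib_left times_tensor_pure)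
  have 1: "(\<Sum>l<n. \<Sum>m<n. (X k l * T k' m) \<otimes>\<^sub>C D l m) = 0" if k: "k < d" "k' < d'" for k k'
  proof -
    define t where "t = T k'"
    have t: "intertwines \<Delta>P n u t" using T k by (simp add: left_frame_def t_def)
    have Xt: "\<Delta>P (X k i) * \<Delta>P (t i) = (\<Sum>l<n. \<Sum>m<n. (X k l * t m) \<otimes>\<^sub>C (star (u l i) * u m i))"
      if "i < n" for i
      using X[OF k(1)] t that by (simp add: intertwines_def sum_product times_tensor_pure)
    have "(\<Sum>i<n. X k i * t i) \<otimes>\<^sub>C 1 = \<Delta>P (\<Sum>i<n. X k i * t i)"
      using invariant[OF intertwines_star[OF X[OF k(1)]] t] by (simp add: star_star)
    also have "\<dots> = (\<Sum>i<n. \<Sum>l<n. \<Sum>m<n. (X k l * t m) \<otimes>\<^sub>C (star (u l i) * u m i))"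
      using \<Delta>P Xt by (simp add: clinear_sum[OF linear(4)] star_hom_def)
    also have "\<dots> = (\<Sum>l<n. \<Sum>i<n. \<Sum>m<n. (X k l * t m) \<otimes>\<^sub>C (star (u l i) * u m i))"
      by (rule sum.swap)
    also have "\<dots> = (\<Sum>l<n. \<Sum>m<n. \<Sum>i<n. (X k l * t m) \<otimes>\<^sub>C (star (u l i) * u m i))"
      by (intro sum.cong refl sum.swap)
    also have "\<dots> = (\<Sum>l<n. \<Sum>m<n. (X k l * t m) \<otimes>\<^sub>C (D l m + (if l = m then 1 else 0)))"
      by (simp add: D_def tensor_sum)
    also have "\<dots> = (\<Sum>l<n. \<Sum>m<n. (X k l * t m) \<otimes>\<^sub>C D l m)
        + (\<Sum>l<n. \<Sum>m<n. if m = l then (X k l * t l) \<otimes>\<^sub>C 1 else 0)"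
      unfolding tensor_pure_bilinear sum.distrib
      by (intro arg_cong2[where f = "(+)"] refl sum.cong) (auto simp: tensor_zero)
    also have "(\<Sum>l<n. \<Sum>m<n. if m = l then (X k l * t l) \<otimes>\<^sub>C 1 else 0) = (\<Sum>i<n. X k i * t i) \<otimes>\<^sub>C (1::'h)"
      by (simp add: tensor_sum)
    finally show ?thesis by (simp add: t_def)
  qed
  \<comment> \<open>Multiplying by the adjoints of the dual family \<open>Z\<close> and summing over
    k removes \<open>X\<close>.\<close>
  have 2: "(\<Sum>m<n. T k' m \<otimes>\<^sub>C D i m) = 0" if k': "k' < d'" and i: "i < n" for k' i
  proof -
    have "0 = (\<Sum>k<d. (star (Z k i) \<otimes>\<^sub>C 1) * (\<Sum>l<n. \<Sum>m<n. (X k l * T k' m) \<otimes>\<^sub>C D l m))"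
      by (simp add: 1 k')
    also have "\<dots> = (\<Sum>k<d. \<Sum>l<n. \<Sum>m<n. (star (Z k i) * X k l * T k' m) \<otimes>\<^sub>C D l m)"
      by (simp add: sum_distrib_left times_tensor_pure mult.assoc)
    also have "\<dots> = (\<Sum>l<n. \<Sum>k<d. \<Sum>m<n. (star (Z k i) * X k l * T k' m) \<otimes>\<^sub>C D l m)"
      by (rule sum.swap)
    also have "\<dots> = (\<Sum>l<n. \<Sum>m<n. \<Sum>k<d. (star (Z k i) * X k l * T k' m) \<otimes>\<^sub>C D l m)"
      by (intro sum.cong refl sum.swap)
    also have "\<dots> = (\<Sum>l<n. \<Sum>m<n. ((\<Sum>k<d. star (Z k i) * X k l) * T k' m) \<otimes>\<^sub>C D l m)"
      by (simp add: tensor_sum sum_distrib_right)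
    also have "\<dots> = (\<Sum>l<n. if l = i then (\<Sum>m<n. T k' m \<otimes>\<^sub>C D i m) else 0)"
      by (intro sum.cong) (auto simp: ZX i tensor_zero)
    finally show ?thesis using i by simp
  qed
  \<comment> \<open>The frame property removes \<open>T\<close> in the same way and leaves 1
    \<otimes> D; a functional with value 1 at the unit isolates \<open>D\<close>.\<close>
  have D: "D i j = 0" if ij: "i < n" "j < n" for i j
  proof -
    have "0 = (\<Sum>k<d'. (star (T k j) \<otimes>\<^sub>C 1) * (\<Sum>m<n. T k m \<otimes>\<^sub>C D i m))" by (simp add: 2 ij)
    also have "\<dots> = (\<Sum>k<d'. \<Sum>m<n. (star (T k j) * T k m) \<otimes>\<^sub>C D i m)" by (simp add: mult)
    also have "\<dots> = (\<Sum>m<n. \<Sum>k<d'. (star (T k j) * T k m) \<otimes>\<^sub>C D i m)" by (rule sum.swap)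
    also have "\<dots> = (\<Sum>m<n. (\<Sum>k<d'. star (T k j) * T k m) \<otimes>\<^sub>C D i m)" by (simp add: tensor_sum)
    also have "\<dots> = (\<Sum>m<n. if m = j then 1 \<otimes>\<^sub>C D i j else 0)"
      using T by (intro sum.cong) (auto simp: left_frame_def ij tensor_zero)
    finally have zero: "(1::'p) \<otimes>\<^sub>C D i j = 0" using ij by simp
    have "cvec.independent {1 :: 'p}" by simp
    then obtain \<phi> :: "'p \<Rightarrow> complex" where \<phi>: "clinear \<phi>" "\<phi> 1 = 1"
      using cvec.linear_independent_extend[of "{1 :: 'p}" "\<lambda>_. 1 :: complex"] by auto
    have "tensor_slice \<phi> (1 \<otimes>\<^sub>C D i j) = 0"
      unfolding zero by (rule clinearD(3)[OF tensor_slice(1)[OF \<phi>(1)]])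
    then show ?thesis by (simp add: tensor_slice(2)[OF \<phi>(1)] \<phi>(2) scaleC_one)
  qed
  have "(\<Sum>k<n. star (u i k) * star (star (u j k))) = (if i = j then 1 else 0)" if "i < n" "j < n" for i j
    using D[OF that] by (simp add: D_def star_star)
  then show ?thesis by (intro unitary_matrix_of_one_sided[OF hopf u']) blast
qed

lemma right_frame_exists:
  assumes u: "matrix_corepresentation \<Delta> \<epsilon> n u" "unitary_matrix n u"
    and invariant: "\<And>s t. intertwines \<Delta>P n u s \<Longrightarrow> intertwines \<Delta>P n u t \<Longrightarrow>
      \<Delta>P (\<Sum>k<n. star (s k) * t k) = (\<Sum>k<n. star (s k) * t k) \<otimes>\<^sub>C 1"
  obtains d :: nat and Y where "\<And>k. k < d \<Longrightarrow> intertwines \<Delta>P n u (Y k)"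
    "\<And>i j. i < n \<Longrightarrow> j < n \<Longrightarrow> (\<Sum>k<d. Y k i * star (Y k j)) = (if i = j then 1 else 0)"
proof -
  from left_frame_exists[OF matrix_corepresentation_star[OF u(1)] conjugate_unitary[OF u invariant]]
  obtain d T where "left_frame \<Delta>P n (\<lambda>i j. star (u i j)) d T" by blast
  then show ?thesis
    by (intro that[of d "\<lambda>k i. star (T k i)"]) (auto simp: left_frame_def intertwines_star star_star)
qed

end

section \<open>Coordinates of a unitary corepresentation\<close>

locale orthonormal_coordinates =
  fixes ip :: "'v::complex_vector \<Rightarrow> 'v \<Rightarrow> complex" and n :: nat and e :: "nat \<Rightarrow> 'v"
  assumes inner_product: "inner_product ip" and basis: "orthonormal_basis ip n e"
begin

sublocale hermitian_form ip
proof
  fix x y z :: 'v and c :: complex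
  have "clinear (ip x)" using inner_product unfolding inner_product_def by blast
  then show "ip x (y + z) = ip x y + ip x z" "ip x (c *\<^sub>C y) = c * ip x y"
    by (simp_all add: clinearD scaleC_complex_def)
  show "ip y x = cnj (ip x y)" using inner_product unfolding inner_product_def by blast
qed

lemma linear_ip: "clinear (ip x)"
  using inner_product unfolding inner_product_def by blast

lemma ip_basis: "i < n \<Longrightarrow> j < n \<Longrightarrow> ip (e i) (e j) = (if i = j then 1 else 0)"
  using basis by (simp add: orthonormal_basis_def)

lemma expansion: "x = (\<Sum>i<n. ip (e i) x *\<^sub>C e i)"
  using basis by (intro orthonormal_expansion) (auto simp: orthonormal_basis_def orthonormal_def)

lemma linear_ext:
  assumes "clinear S" "clinear T" "\<And>i. i < n \<Longrightarrow> S (e i) = T (e i)"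
  shows "S = T"
proof
  fix x
  have "S (\<Sum>i<n. ip (e i) x *\<^sub>C e i) = T (\<Sum>i<n. ip (e i) x *\<^sub>C e i)"
    using assms by (simp add: clinear_sum clinearD)
  then show "S x = T x" by (simp flip: expansion)
qed

text \<open>The tensor product becomes an n-fold power of its second factor, so equations between
  tensors can be checked on slices.\<close>

lemma tensor_expansion: "z = (\<Sum>i<n. e i \<otimes>\<^sub>C tensor_slice (ip (e i)) z)"
proof (induction z rule: tensor_induct)
  case (pure a b)
  have "a \<otimes>\<^sub>C b = (\<Sum>i<n. ip (e i) a *\<^sub>C e i) \<otimes>\<^sub>C b" by (simp flip: expansion)
  also have "\<dots> = (\<Sum>i<n. e i \<otimes>\<^sub>C tensor_slice (ip (e i)) (a \<otimes>\<^sub>C b))"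
    by (simp add: tensor_slice[OF linear_ip] tensor_sum tensor_pure_bilinear)
  finally show ?case .
next
  case (add x y)
  then show ?case
    by (simp add: clinearD[OF tensor_slice(1)[OF linear_ip]] tensor_pure_bilinear sum.distrib)
qed

lemma slice_expansion:
  assumes "i < n"
  shows "tensor_slice (ip (e i)) (\<Sum>j<n. e j \<otimes>\<^sub>C h j) = h i"
proof -
  have "tensor_slice (ip (e i)) (\<Sum>j<n. e j \<otimes>\<^sub>C h j) = (\<Sum>j<n. (if i = j then 1 else 0) *\<^sub>C h j)"
    unfolding clinear_sum[OF tensor_slice(1)[OF linear_ip]] tensor_slice(2)[OF linear_ip]
    using assms by (intro sum.cong) (auto simp: ip_basis)
  then show ?thesis by (simp add: sum_delta_scaleC[OF assms])
qed

definition coefficient :: "('v \<Rightarrow> ('v, 'h::complex_vector) tensor) \<Rightarrow> nat \<Rightarrow> nat \<Rightarrow> 'h"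
  where "coefficient \<delta> i j = tensor_slice (ip (e i)) (\<delta> (e j))"

lemma coefficient: "\<delta> (e j) = (\<Sum>i<n. e i \<otimes>\<^sub>C coefficient \<delta> i j)"
  unfolding coefficient_def by (rule tensor_expansion)

lemma matrix_corepresentation_coefficient:
  fixes \<Delta> :: "'h::complex_star_algebra \<Rightarrow> ('h, 'h) tensor"
  assumes \<Delta>: "clinear \<Delta>" and \<epsilon>: "clinear \<epsilon>" and \<delta>: "corepresentation \<Delta> \<epsilon> \<delta>"
  shows "matrix_corepresentation \<Delta> \<epsilon> n (coefficient \<delta>)"
  unfolding matrix_corepresentation_def
proof (intro allI impI conjI)
  fix i j assume ij: "i < n" "j < n"
  let ?u = "coefficient \<delta>"
  have id: "clinear (id :: 'v \<Rightarrow> 'v)" "clinear (id :: 'h \<Rightarrow> 'h)" by (simp_all add: clinear_iff)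
  have lin: "clinear \<delta>" and counit: "tensor_map id \<epsilon> (\<delta> (e j)) = e j \<otimes>\<^sub>C 1"
    and coassoc: "tensor_map id \<Delta> (\<delta> (e j)) = tensor_assoc (tensor_map \<delta> id (\<delta> (e j)))"
    using \<delta> by (auto simp: corepresentation_def)
  have "(\<Sum>i<n. e i \<otimes>\<^sub>C \<epsilon> (?u i j)) = e j \<otimes>\<^sub>C 1"
    using counit unfolding coefficient[of \<delta>]
    by (simp add: clinear_sum[OF tensor_map(1)[OF id(1) \<epsilon>]] tensor_map(2)[OF id(1) \<epsilon>])
  from arg_cong[OF this, of "tensor_slice (ip (e i))"]
  show "\<epsilon> (?u i j) = (if i = j then 1 else 0)"
    by (simp add: slice_expansion ij tensor_slice[OF linear_ip] ip_basis scaleC_complex_def)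
  have "tensor_map id \<Delta> (\<delta> (e j)) = (\<Sum>i<n. e i \<otimes>\<^sub>C \<Delta> (?u i j))"
    by (subst coefficient) (simp add: clinear_sum[OF tensor_map(1)[OF id(1) \<Delta>]] tensor_map(2)[OF id(1) \<Delta>])
  moreover have "tensor_assoc (tensor_map \<delta> id (\<delta> (e j))) = (\<Sum>i<n. e i \<otimes>\<^sub>C (\<Sum>k<n. ?u i k \<otimes>\<^sub>C ?u k j))"
  proof -
    have "tensor_map \<delta> id (\<delta> (e j)) = (\<Sum>k<n. \<delta> (e k) \<otimes>\<^sub>C ?u k j)"
      by (subst coefficient) (simp add: clinear_sum[OF tensor_map(1)[OF lin id(2)]] tensor_map(2)[OF lin id(2)])
    also have "\<dots> = (\<Sum>k<n. \<Sum>i<n. (e i \<otimes>\<^sub>C ?u i k) \<otimes>\<^sub>C ?u k j)"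
      by (rule sum.cong[OF refl], subst coefficient) (simp add: tensor_sum)
    also have "tensor_assoc \<dots> = (\<Sum>k<n. \<Sum>i<n. e i \<otimes>\<^sub>C (?u i k \<otimes>\<^sub>C ?u k j))"
      by (simp add: clinear_sum[OF tensor_assoc(1)] tensor_assoc(2))
    also have "\<dots> = (\<Sum>i<n. \<Sum>k<n. e i \<otimes>\<^sub>C (?u i k \<otimes>\<^sub>C ?u k j))" by (rule sum.swap)
    finally show ?thesis by (simp add: tensor_sum)
  qed
  ultimately have "(\<Sum>i<n. e i \<otimes>\<^sub>C \<Delta> (?u i j)) = (\<Sum>i<n. e i \<otimes>\<^sub>C (\<Sum>k<n. ?u i k \<otimes>\<^sub>C ?u k j))"
    using coassoc by simp
  from arg_cong[OF this, of "tensor_slice (ip (e i))"]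
  show "\<Delta> (?u i j) = (\<Sum>k<n. ?u i k \<otimes>\<^sub>C ?u k j)"
    by (simp only: slice_expansion[OF ij(1)])
qed

lemma coefficient_pairing_sum:
  fixes g h :: "nat \<Rightarrow> 'h::complex_star_algebra"
  shows "coefficient_pairing ip (\<Sum>k<n. e k \<otimes>\<^sub>C g k) (\<Sum>l<n. e l \<otimes>\<^sub>C h l) = (\<Sum>k<n. star (g k) * h k)"
proof -
  have inner: "cbilinear (\<lambda>v (g::'h). ip w v *\<^sub>C (star h * g))" for w and h :: 'h
    unfolding cbilinear_def clinear_iff
    by (auto simp: add_right scale_right scaleC_add_left scaleC_add_right distrib_left mult_scaleC_right
        scaleC_scaleC mult.commute)
  have outer: "cbilinear (\<lambda>w (h::'h). \<Sum>k<n. ip (e k) w *\<^sub>C (star (g k) * h))"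
    unfolding cbilinear_def clinear_iff
    by (auto simp: add_right scale_right scaleC_add_left scaleC_add_right distrib_left mult_scaleC_right
        scaleC_scaleC mult.commute sum.distrib cvec.scale_sum_right)
  have "star (tensor_lift (\<lambda>v g. ip w v *\<^sub>C (star h * g)) (\<Sum>k<n. e k \<otimes>\<^sub>C g k))
      = (\<Sum>k<n. ip (e k) w *\<^sub>C (star (g k) * h))" for w and h :: 'h
    by (simp add: clinear_sum[OF tensor_lift(1)[OF inner]] tensor_lift(2)[OF inner] star_sum star_scaleC
        star_mult star_star flip: hermitian)
  then have "coefficient_pairing ip (\<Sum>k<n. e k \<otimes>\<^sub>C g k) (\<Sum>l<n. e l \<otimes>\<^sub>C h l)
      = (\<Sum>l<n. \<Sum>k<n. ip (e k) (e l) *\<^sub>C (star (g k) * h l))"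
    by (simp add: coefficient_pairing_def clinear_sum[OF tensor_lift(1)[OF outer]] tensor_lift(2)[OF outer])
  also have "\<dots> = (\<Sum>l<n. \<Sum>k<n. (if l = k then 1 else 0) *\<^sub>C (star (g k) * h l))"
    by (intro sum.cong refl) (auto simp: ip_basis)
  also have "\<dots> = (\<Sum>l<n. star (g l) * h l)"
    by (intro sum.cong refl sum_delta_scaleC) simp
  finally show ?thesis .
qed

lemma coefficient_isometric:
  fixes \<delta> :: "'v \<Rightarrow> ('v, 'h::complex_star_algebra) tensor"
  assumes "unitary_corepresentation ip \<delta>" "i < n" "j < n"
  shows "(\<Sum>k<n. star (coefficient \<delta> k i) * coefficient \<delta> k j) = (if i = j then 1 else 0)"
proof -
  have "coefficient_pairing ip (\<delta> (e i)) (\<delta> (e j)) = ip (e i) (e j) *\<^sub>C 1"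
    using assms(1) unfolding unitary_corepresentation_def by blast
  then show ?thesis
    using assms(2,3) unfolding coefficient[of \<delta>] coefficient_pairing_sum by (simp add: ip_basis scaleC_one)
qed

text \<open>Both sides of the intertwining condition are linear in the vector, so comparing them on
  the basis is enough.\<close>

lemma Mor_iff_intertwines:
  fixes \<delta> :: "'v \<Rightarrow> ('v, 'h::complex_star_algebra) tensor"
  assumes \<delta>: "clinear \<delta>" and \<Delta>P: "clinear \<Delta>P"
  shows "T \<in> Mor \<delta> \<Delta>P \<longleftrightarrow> clinear T \<and> intertwines \<Delta>P n (coefficient \<delta>) (\<lambda>i. T (e i))"
proof -
  have "(\<forall>x. tensor_map T id (\<delta> x) = \<Delta>P (T x)) \<longleftrightarrow> intertwines \<Delta>P n (coefficient \<delta>) (\<lambda>i. T (e i))"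
    if T: "clinear T"
  proof -
    have id: "clinear (id :: 'h \<Rightarrow> 'h)" by (simp add: clinear_iff)
    note map = tensor_map[OF T id]
    have map_e: "tensor_map T id (\<delta> (e i)) = (\<Sum>j<n. T (e j) \<otimes>\<^sub>C coefficient \<delta> j i)" for i
      by (subst coefficient) (simp add: clinear_sum[OF map(1)] map(2))
    have "(\<lambda>x. tensor_map T id (\<delta> x)) = (\<lambda>x. \<Delta>P (T x))" if "intertwines \<Delta>P n (coefficient \<delta>) (\<lambda>i. T (e i))"
    proof (rule linear_ext)
      show "clinear (\<lambda>x. tensor_map T id (\<delta> x))" "clinear (\<lambda>x. \<Delta>P (T x))"
        by (rule clinearI; simp add: clinearD \<delta> \<Delta>P T map(1))+
      show "tensor_map T id (\<delta> (e i)) = \<Delta>P (T (e i))" if "i < n" for i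
        unfolding map_e using \<open>intertwines _ _ _ _\<close> that by (simp add: intertwines_def)
    qed
    then show ?thesis by (auto simp: fun_eq_iff intertwines_def simp flip: map_e)
  qed
  then show ?thesis by (auto simp: Mor_def)
qed

text \<open>Inverse to restricting a linear map to the basis.\<close>

definition extend :: "(nat \<Rightarrow> 'p::complex_vector) \<Rightarrow> 'v \<Rightarrow> 'p"
  where "extend t x = (\<Sum>i<n. ip (e i) x *\<^sub>C t i)"

lemma linear_extend: "clinear (extend t)"
  by (rule clinearI) (simp_all add: extend_def add_right scale_right scaleC_add_left sum.distrib
      cvec.scale_sum_right scaleC_scaleC)

lemma extend_basis: "i < n \<Longrightarrow> extend t (e i) = t i"
proof -
  assume i: "i < n"
  have "extend t (e i) = (\<Sum>j<n. (if i = j then 1 else 0) *\<^sub>C t j)"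
    unfolding extend_def using i by (intro sum.cong) (auto simp: ip_basis)
  then show ?thesis by (simp add: sum_delta_scaleC[OF i])
qed

lemma extend_mem_Mor:
  assumes "clinear \<delta>" "clinear \<Delta>P" "intertwines \<Delta>P n (coefficient \<delta>) t"
  shows "extend t \<in> Mor \<delta> \<Delta>P"
  unfolding Mor_iff_intertwines[OF assms(1,2)]
  using assms(3) by (auto simp: linear_extend intertwines_def extend_basis)

lemma subspace_Mor:
  fixes \<delta> :: "'v \<Rightarrow> ('v, 'h::complex_star_algebra) tensor"
  assumes \<delta>: "clinear \<delta>" and \<Delta>P: "clinear \<Delta>P"
  shows "cvec.subspace (Mor \<delta> \<Delta>P)"
proof -
  have "Mor \<delta> \<Delta>P = {T. clinear T \<and> intertwines \<Delta>P n (coefficient \<delta>) (\<lambda>i. T (e i))}"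
    using Mor_iff_intertwines[OF \<delta> \<Delta>P] by blast
  then show ?thesis
    unfolding cvec.subspace_def
    by (auto simp: clinear_iff intertwines_def clinearD[OF \<Delta>P] scaleC_fun_def tensor_zero
        tensor_pure_bilinear sum.distrib cvec.scale_sum_right scaleC_add_right scaleC_scaleC mult.commute
        algebra_simps)
qed

end

theorem theorem3p14:
  fixes \<Delta> :: "'h::complex_star_algebra \<Rightarrow> ('h, 'h) tensor"
    and \<epsilon> :: "'h \<Rightarrow> complex" and S :: "'h \<Rightarrow> 'h"
    and \<iota>G :: "'h \<Rightarrow> 'a::cstar_algebra" and N :: nat and u :: "nat \<Rightarrow> nat \<Rightarrow> 'h"
    and B :: "'p::complex_star_algebra set" and \<Delta>P :: "'p \<Rightarrow> ('p, 'h) tensor"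
    and \<iota>B :: "'p \<Rightarrow> 'c::cstar_algebra"
    and \<delta>V :: "'v::complex_vector \<Rightarrow> ('v, 'h) tensor" and ip :: "'v \<Rightarrow> 'v \<Rightarrow> complex"
    and n :: nat and e :: "nat \<Rightarrow> 'v"
  assumes "compact_matrix_quantum_group \<Delta> \<epsilon> S \<iota>G N u"
    and "corepresentations_unitarizable \<Delta> \<epsilon>"
    and "quantum_principal_bundle \<Delta> \<epsilon> B \<Delta>P"
    and "cstar_completion B \<iota>B"
    and "admits_left_frames \<Delta> \<epsilon> \<Delta>P"
    and "corepresentation \<Delta> \<epsilon> \<delta>V"
    and "inner_product ip" and "unitary_corepresentation ip \<delta>V"
    and "orthonormal_basis ip n e"
    and hermitian_into_B: "\<forall>T\<^sub>1\<in>Mor \<delta>V \<Delta>P. \<forall>T\<^sub>2\<in>Mor \<delta>V \<Delta>P. canonical_hermitian_right n e T\<^sub>1 T\<^sub>2 \<in> B"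
  shows "right_hilbert_module_by_completion B \<iota>B (Mor \<delta>V \<Delta>P)
    right_multiplication (canonical_hermitian_right n e)"
proof -
  have hopf: "hopf_star_algebra \<Delta> \<epsilon> S"
    using assms(1) by (simp add: compact_matrix_quantum_group_def)
  have PB: "star_subalgebra B" "star_hom \<Delta>P" "\<And>x. \<Delta>P x = x \<otimes>\<^sub>C 1 \<longleftrightarrow> x \<in> B"
    using assms(3) by (auto simp: quantum_principal_bundle_def)
  have lin_V: "clinear \<delta>V" using assms(6) by (simp add: corepresentation_def)
  interpret bundle_frames \<Delta> \<epsilon> S \<Delta>P
    by unfold_locales (fact hopf assms(2) assms(5) PB(2))+
  interpret orthonormal_coordinates ip n e
    by unfold_locales (fact assms(7) assms(9))+
  define v where "v = coefficient \<delta>V"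
  note Mor_iff = Mor_iff_intertwines[OF lin_V linear(4), folded v_def]
  have v: "matrix_corepresentation \<Delta> \<epsilon> n v"
    unfolding v_def by (rule matrix_corepresentation_coefficient[OF linear(1,2) assms(6)])
  have unitary: "unitary_matrix n v"
    using coefficient_isometric[OF assms(8)]
    by (intro unitary_matrix_of_one_sided[OF hopf v]) (simp add: v_def)
  \<comment> \<open>The families are extended to morphisms on V, to which
    \<open>hermitian_into_B\<close> applies; membership in \<open>B\<close> is invariance under
    \<open>\<Delta>P\<close>.\<close>
  have invariant: "\<Delta>P (\<Sum>k<n. star (s k) * t k) = (\<Sum>k<n. star (s k) * t k) \<otimes>\<^sub>C 1"
    if "intertwines \<Delta>P n v s" "intertwines \<Delta>P n v t" for s t
  proof -
    have "extend s \<in> Mor \<delta>V \<Delta>P" "extend t \<in> Mor \<delta>V \<Delta>P"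
      using that unfolding v_def by (auto intro: extend_mem_Mor[OF lin_V linear(4)])
    then have "canonical_hermitian_right n e (extend s) (extend t) \<in> B"
      using hermitian_into_B by blast
    then show ?thesis unfolding PB(3) by (simp add: canonical_hermitian_right_def extend_basis)
  qed
  obtain d :: nat and Y where Y: "\<And>k. k < d \<Longrightarrow> intertwines \<Delta>P n v (Y k)"
    and YY: "\<And>i j. i < n \<Longrightarrow> j < n \<Longrightarrow> (\<Sum>k<d. Y k i * star (Y k j)) = (if i = j then 1 else 0)"
    using right_frame_exists[OF v unitary invariant] by blast
  have Y_mem: "extend (Y k) \<in> Mor \<delta>V \<Delta>P" if "k < d" for k
    using Y[OF that] unfolding v_def by (rule extend_mem_Mor[OF lin_V linear(4)])
  have linear_Mor: "clinear T" if "T \<in> Mor \<delta>V \<Delta>P" for T using that Mor_iff by blast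
  interpret framed_module B \<iota>B "Mor \<delta>V \<Delta>P" right_multiplication "canonical_hermitian_right n e"
    d "\<lambda>k. extend (Y k)"
  proof
    show "cvec.subspace (Mor \<delta>V \<Delta>P)"
      by (rule subspace_Mor[OF lin_V linear(4)])
    fix T b assume T: "T \<in> Mor \<delta>V \<Delta>P" and b: "b \<in> B"
    have "\<Delta>P b = b \<otimes>\<^sub>C 1" using b PB(3) by blast
    then have "intertwines \<Delta>P n v (\<lambda>i. T (e i) * b)"
      using T PB(2) unfolding Mor_iff
      by (simp add: intertwines_def star_hom_def sum_distrib_right times_tensor_pure)
    then show "right_multiplication T b \<in> Mor \<delta>V \<Delta>P"
      using linear_Mor[OF T] unfolding Mor_iff
      by (simp add: right_multiplication_def clinear_iff distrib_right mult_scaleC_left)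
  next
    fix T assume T: "T \<in> Mor \<delta>V \<Delta>P"
    show "T = (\<Sum>k<d. right_multiplication (extend (Y k)) (canonical_hermitian_right n e (extend (Y k)) T))"
      (is "_ = ?R")
    proof (rule linear_ext[OF linear_Mor[OF T]])
      show "clinear ?R"
        by (rule clinearI) (simp_all add: sum_fun_apply right_multiplication_def distrib_right
            mult_scaleC_left clinearD[OF linear_extend] sum.distrib cvec.scale_sum_right)
      fix i assume i: "i < n"
      \<comment> \<open>\<open>Y k i\<close> stands to the left of
        \<open>star (Y k j) * T (e j)\<close>, so the sum over k produces the right frame relation
        and singles out j = i.\<close>
      have "?R (e i) = (\<Sum>k<d. \<Sum>j<n. Y k i * star (Y k j) * T (e j))"
        by (simp add: sum_fun_apply right_multiplication_def canonical_hermitian_right_def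
            extend_basis i sum_distrib_left mult.assoc)
      also have "\<dots> = (\<Sum>j<n. (\<Sum>k<d. Y k i * star (Y k j)) * T (e j))"
        by (subst sum.swap) (simp add: sum_distrib_right)
      also have "\<dots> = (\<Sum>j<n. if j = i then T (e i) else 0)"
        by (intro sum.cong) (auto simp: YY i)
      finally show "T (e i) = ?R (e i)" using i by simp
    qed
  qed (use PB(1) assms(4) hermitian_into_B Y_mem in \<open>simp_all add: right_multiplication_def
      canonical_hermitian_right_def fun_eq_iff distrib_left distrib_right mult_scaleC_left
      mult_scaleC_right mult.assoc scaleC_fun_def star_sum star_mult star_star sum.distrib
      cvec.scale_sum_right sum_distrib_right\<close>)
  show ?thesis by (rule right_hilbert_module_by_completion)
qed

end
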